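(* Let $G$ be a compact quantum group. Let $\mathrm{Aut}^0(G)$ denote the connected component of the identity in the topological group $\mathrm{Aut}(G)$, and let $\mathrm{Aut}^0_\chi(G)$ denote the connected component of the identity in the subgroup $\mathrm{Aut}_\chi(G)$ (with the subspace topology). Then $\mathrm{Aut}^0(G)=\mathrm{Aut}^0_\chi(G)$.
   Context: A compact quantum group $G$ is given by a unital $C^*$-algebra with a coassociative comultiplication $\Delta$ satisfying Woronowicz's density conditions. Its CQG algebra $A$ is the dense Hopf $*$-algebra spanned by matrix coefficients of the irreducible finite-dimensional unitary representations of $G$; $\mathrm{Irr}(G)$ is the set of equivalence classes of irreducible representations, and $\overline{A}$ is the full (universal) enveloping $C^*$-algebra of $A$. $\mathrm{Aut}(G)=\mathrm{Aut}(A)$ is the group of comultiplication-preserving $*$-automorphisms of $\overline{A}$, equivalently (by restriction to $A$) the group of Hopf $*$-algebra automorphisms of $A$. It is a topological group with basic identity neighborhoods $\{\alpha : \|\alpha(a_i)-a_i\|<\varepsilon,\ i=1,\dots,n\}$ for $a_1,\dots,a_n\in A$ and $\varepsilon>0$, where the norm is that of $\overline{A}$. The inner automorphism group $\mathrm{Aut}_\chi(G)=\mathrm{Aut}_\chi(A)$ is the normal subgroup of those $\alpha\in\mathrm{Aut}(G)$ that preserve the class of each irreducible representation, i.e. $\alpha(\chi_V)=\chi_V$ for the character $\chi_V\in A$ of every $V\in\mathrm{Irr}(G)$. *)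

theory Defs
  imports "HOL-Analysis.Analysis"
begin

section \<open>Unital C*-algebras\<close>

text \<open>The sort \<open>real_normed_algebra_1\<close> postulates \<open>norm 1 = 1\<close>, so the zero algebra is
  excluded; it carries no compact quantum group.\<close>

class unital_cstar_algebra = real_normed_algebra_1 + banach +
  fixes scaleC :: "complex \<Rightarrow> 'a \<Rightarrow> 'a"  (infixr "*\<^sub>C" 75)
    and star :: "'a \<Rightarrow> 'a"
  assumes scaleC_add_right: "c *\<^sub>C (x + y) = c *\<^sub>C x + c *\<^sub>C y"
    and scaleC_add_left: "(c + d) *\<^sub>C x = c *\<^sub>C x + d *\<^sub>C x"
    and scaleC_scaleC: "c *\<^sub>C d *\<^sub>C x = (c * d) *\<^sub>C x"
    and scaleC_of_real: "complex_of_real r *\<^sub>C x = r *\<^sub>R x"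
    and mult_scaleC_left: "(c *\<^sub>C x) * y = c *\<^sub>C (x * y)"
    and mult_scaleC_right: "x * (c *\<^sub>C y) = c *\<^sub>C (x * y)"
    and norm_scaleC: "norm (c *\<^sub>C x) = cmod c * norm x"
    and star_add: "star (x + y) = star x + star y"
    and star_scaleC: "star (c *\<^sub>C x) = cnj c *\<^sub>C star x"
    and star_mult: "star (x * y) = star y * star x"
    and star_star: "star (star x) = x"
    and cstar_identity: "norm (star x * x) = (norm x)\<^sup>2"

interpretation complex_vector:
  vector_space "scaleC :: complex \<Rightarrow> 'a \<Rightarrow> 'a::unital_cstar_algebra"
proof
  fix c d :: complex and x y :: 'a
  show "c *\<^sub>C (x + y) = c *\<^sub>C x + c *\<^sub>C y" by (rule scaleC_add_right)
  show "(c + d) *\<^sub>C x = c *\<^sub>C x + d *\<^sub>C x" by (rule scaleC_add_left)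
  show "c *\<^sub>C d *\<^sub>C x = (c * d) *\<^sub>C x" by (rule scaleC_scaleC)
  show "1 *\<^sub>C x = x" using scaleC_of_real[of 1 x] by simp
qed

definition unital_star_hom :: "('a::unital_cstar_algebra \<Rightarrow> 'b::unital_cstar_algebra) \<Rightarrow> bool" where
  "unital_star_hom f \<longleftrightarrow> Vector_Spaces.linear scaleC scaleC f \<and> f 1 = 1 \<and>
     (\<forall>x y. f (x * y) = f x * f y) \<and> (\<forall>x. f (star x) = star (f x))"

definition state :: "('a::unital_cstar_algebra \<Rightarrow> complex) \<Rightarrow> bool" where
  "state \<phi> \<longleftrightarrow> Vector_Spaces.linear scaleC (*) \<phi> \<and> \<phi> 1 = 1 \<and> (\<forall>x. \<phi> (star x * x) \<in> \<real>\<^sub>\<ge>\<^sub>0)"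


section \<open>The spatial (minimal) tensor product\<close>

text \<open>A list \<open>[(a\<^sub>1, b\<^sub>1), \<dots>]\<close> stands for the element \<open>\<Sum>\<^sub>i a\<^sub>i \<otimes> b\<^sub>i\<close> of the algebraic tensor
  product.\<close>

definition formal_mult ::
    "('a::times \<times> 'b::times) list \<Rightarrow> ('a \<times> 'b) list \<Rightarrow> ('a \<times> 'b) list" where
  "formal_mult xs ys = concat (map (\<lambda>(a, b). map (\<lambda>(c, d). (a * c, b * d)) ys) xs)"

definition formal_star ::
    "('a::unital_cstar_algebra \<times> 'b::unital_cstar_algebra) list \<Rightarrow> ('a \<times> 'b) list" where
  "formal_star xs = map (\<lambda>(a, b). (star a, star b)) xs"

definition product_functional ::
    "('a \<Rightarrow> complex) \<Rightarrow> ('b \<Rightarrow> complex) \<Rightarrow> ('a \<times> 'b) list \<Rightarrow> complex" where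
  "product_functional \<phi> \<psi> xs = (\<Sum>(a, b)\<leftarrow>xs. \<phi> a * \<psi> b)"

text \<open>The supremum of the operator norms \<open>\<parallel>(\<pi>\<^sub>\<phi> \<otimes> \<pi>\<^sub>\<psi>)(x)\<parallel>\<close> over the GNS representations of pairs
  of states: \<open>y\<close> runs over the vectors \<open>(\<pi>\<^sub>\<phi> \<otimes> \<pi>\<^sub>\<psi>)(y) (\<xi>\<^sub>\<phi> \<otimes> \<xi>\<^sub>\<psi>)\<close> of the unit ball, which are
  dense in it.\<close>

definition spatial_norm ::
    "('a::unital_cstar_algebra \<times> 'b::unital_cstar_algebra) list \<Rightarrow> ereal" where
  "spatial_norm x = Sup {ereal (sqrt (Re (product_functional \<phi> \<psi>
        (formal_mult (formal_star (formal_mult x y)) (formal_mult x y))))) | \<phi> \<psi> y.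
      state \<phi> \<and> state \<psi> \<and> Re (product_functional \<phi> \<psi> (formal_mult (formal_star y) y)) \<le> 1}"

text \<open>The C*-algebra \<open>'d\<close>, with \<open>t a b\<close> as \<open>a \<otimes> b\<close>, is the completion of the algebraic tensor
  product of \<open>'a\<close> and \<open>'b\<close> in the spatial norm.\<close>

definition spatial_tensor_product ::
    "('a::unital_cstar_algebra \<Rightarrow> 'b::unital_cstar_algebra \<Rightarrow> 'd::unital_cstar_algebra) \<Rightarrow> bool" where
  "spatial_tensor_product t \<longleftrightarrow>
     (\<forall>a. Vector_Spaces.linear scaleC scaleC (t a)) \<and>
     (\<forall>b. Vector_Spaces.linear scaleC scaleC (\<lambda>a. t a b)) \<and>
     (\<forall>a b c d. t a b * t c d = t (a * c) (b * d)) \<and>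
     (\<forall>a b. star (t a b) = t (star a) (star b)) \<and>
     (\<forall>x. ereal (norm (\<Sum>(a, b)\<leftarrow>x. t a b)) = spatial_norm x) \<and>
     closure (complex_vector.span {t a b | a b. True}) = UNIV"


section \<open>Compact quantum groups\<close>

text \<open>The types \<open>'c\<close>, \<open>'d\<close>, \<open>'e\<close> carry \<open>C\<close>, \<open>C \<otimes> C\<close> and \<open>C \<otimes> C \<otimes> C\<close>. A *-homomorphism is
  continuous, so the maps \<open>F = \<Delta> \<otimes> id\<close> and \<open>G = id \<otimes> \<Delta>\<close> in \<open>coassoc\<close> are determined by their
  values on elementary tensors.\<close>

locale compact_quantum_group =
  fixes tens :: "'c::unital_cstar_algebra \<Rightarrow> 'c \<Rightarrow> 'd::unital_cstar_algebra"
    and tensL :: "'d \<Rightarrow> 'c \<Rightarrow> 'e::unital_cstar_algebra"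
    and tensR :: "'c \<Rightarrow> 'd \<Rightarrow> 'e"
    and \<Delta> :: "'c \<Rightarrow> 'd"
  assumes tens: "spatial_tensor_product tens"
    and tensL: "spatial_tensor_product tensL"
    and tensR: "spatial_tensor_product tensR"
    and tens_assoc: "tensL (tens a b) c = tensR a (tens b c)"
    and comult_hom: "unital_star_hom \<Delta>"
    and coassoc: "\<exists>F G. unital_star_hom F \<and> (\<forall>a b. F (tens a b) = tensL (\<Delta> a) b) \<and>
        unital_star_hom G \<and> (\<forall>a b. G (tens a b) = tensR a (\<Delta> b)) \<and> (\<forall>a. F (\<Delta> a) = G (\<Delta> a))"
    and density_left: "closure (complex_vector.span {tens a 1 * \<Delta> b | a b. True}) = UNIV"
    and density_right: "closure (complex_vector.span {tens 1 a * \<Delta> b | a b. True}) = UNIV"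


section \<open>Representations and the CQG algebra\<close>

text \<open>An \<open>n\<close>-dimensional representation is a matrix \<open>u\<close> in \<open>M\<^sub>n(C)\<close>; only the entries with indices
  below \<open>n\<close> matter.\<close>

definition unitary_rep ::
    "('c::unital_cstar_algebra \<Rightarrow> 'c \<Rightarrow> 'd::unital_cstar_algebra) \<Rightarrow> ('c \<Rightarrow> 'd) \<Rightarrow>
     nat \<Rightarrow> (nat \<Rightarrow> nat \<Rightarrow> 'c) \<Rightarrow> bool" where
  "unitary_rep tens \<Delta> n u \<longleftrightarrow>
     (\<forall>i<n. \<forall>j<n. \<Delta> (u i j) = (\<Sum>k<n. tens (u i k) (u k j)) \<and>
        (\<Sum>k<n. u i k * star (u j k)) = (if i = j then 1 else 0) \<and>
        (\<Sum>k<n. star (u k i) * u k j) = (if i = j then 1 else 0))"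

text \<open>Subspaces of \<open>\<complex>\<^sup>n\<close> are given by their orthogonal projections \<open>p\<close>; the subspace is invariant
  if \<open>(p \<otimes> 1) u (p \<otimes> 1) = u (p \<otimes> 1)\<close>.\<close>

definition orth_projection :: "nat \<Rightarrow> (nat \<Rightarrow> nat \<Rightarrow> complex) \<Rightarrow> bool" where
  "orth_projection n p \<longleftrightarrow>
     (\<forall>i<n. \<forall>j<n. p i j = cnj (p j i) \<and> (\<Sum>k<n. p i k * p k j) = p i j)"

definition invariant_subspace ::
    "nat \<Rightarrow> (nat \<Rightarrow> nat \<Rightarrow> 'c::unital_cstar_algebra) \<Rightarrow> (nat \<Rightarrow> nat \<Rightarrow> complex) \<Rightarrow> bool" where
  "invariant_subspace n u p \<longleftrightarrow> orth_projection n p \<and>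
     (\<forall>i<n. \<forall>j<n. (\<Sum>k<n. \<Sum>l<n. (p i k * p l j) *\<^sub>C u k l) = (\<Sum>l<n. p l j *\<^sub>C u i l))"

definition irreducible_unitary_rep ::
    "('c::unital_cstar_algebra \<Rightarrow> 'c \<Rightarrow> 'd::unital_cstar_algebra) \<Rightarrow> ('c \<Rightarrow> 'd) \<Rightarrow>
     nat \<Rightarrow> (nat \<Rightarrow> nat \<Rightarrow> 'c) \<Rightarrow> bool" where
  "irreducible_unitary_rep tens \<Delta> n u \<longleftrightarrow> n > 0 \<and> unitary_rep tens \<Delta> n u \<and>
     (\<forall>p. invariant_subspace n u p \<longrightarrow>
        (\<forall>i<n. \<forall>j<n. p i j = 0) \<or> (\<forall>i<n. \<forall>j<n. p i j = (if i = j then 1 else 0)))"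

definition CQG_algebra ::
    "('c::unital_cstar_algebra \<Rightarrow> 'c \<Rightarrow> 'd::unital_cstar_algebra) \<Rightarrow> ('c \<Rightarrow> 'd) \<Rightarrow> 'c set" where
  "CQG_algebra tens \<Delta> = complex_vector.span
     {u i j | n u i j. irreducible_unitary_rep tens \<Delta> n u \<and> i < n \<and> j < n}"

definition rep_character :: "nat \<Rightarrow> (nat \<Rightarrow> nat \<Rightarrow> 'c::unital_cstar_algebra) \<Rightarrow> 'c" where
  "rep_character n u = (\<Sum>i<n. u i i)"


section \<open>The norm of the full enveloping C*-algebra\<close>

definition cstar_seminorm_on :: "'c::unital_cstar_algebra set \<Rightarrow> ('c \<Rightarrow> real) \<Rightarrow> bool" where
  "cstar_seminorm_on A p \<longleftrightarrow> (\<forall>a\<in>A. p a \<ge> 0) \<and>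
     (\<forall>a\<in>A. \<forall>b\<in>A. p (a + b) \<le> p a + p b) \<and> (\<forall>a\<in>A. \<forall>c. p (c *\<^sub>C a) = cmod c * p a) \<and>
     (\<forall>a\<in>A. \<forall>b\<in>A. p (a * b) \<le> p a * p b) \<and> (\<forall>a\<in>A. p (star a * a) = (p a)\<^sup>2)"

text \<open>The full norm on a *-algebra \<open>A\<close> is its largest C*-seminorm. For CQG algebras the supremum is
  finite, because the coefficients of a unitary matrix have norm at most 1.\<close>

definition full_norm :: "'c::unital_cstar_algebra set \<Rightarrow> 'c \<Rightarrow> ereal" where
  "full_norm A a = Sup {ereal (p a) | p. cstar_seminorm_on A p}"


section \<open>The automorphism group and its topology\<close>

text \<open>An automorphism of the Hopf *-algebra \<open>A\<close> is a function on the whole C*-algebra that is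
  \<open>undefined\<close> off \<open>A\<close>, so that automorphisms are equal iff they agree on \<open>A\<close>. The last clause is
  \<open>\<Delta> \<circ> \<alpha> = (\<alpha> \<otimes> \<alpha>) \<circ> \<Delta>\<close>, evaluated on representatives in the algebraic tensor product of
  \<open>A\<close> with itself. Bialgebra morphisms between Hopf algebras respect counits and antipodes.\<close>

definition Aut ::
    "('c::unital_cstar_algebra \<Rightarrow> 'c \<Rightarrow> 'd::unital_cstar_algebra) \<Rightarrow> ('c \<Rightarrow> 'd) \<Rightarrow> ('c \<Rightarrow> 'c) set" where
  "Aut tens \<Delta> = (let A = CQG_algebra tens \<Delta> in
     {\<alpha> \<in> extensional A. bij_betw \<alpha> A A \<and> \<alpha> 1 = 1 \<and>
        (\<forall>a\<in>A. \<forall>b\<in>A. \<alpha> (a + b) = \<alpha> a + \<alpha> b) \<and> (\<forall>a\<in>A. \<forall>c. \<alpha> (c *\<^sub>C a) = c *\<^sub>C \<alpha> a) \<and>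
        (\<forall>a\<in>A. \<forall>b\<in>A. \<alpha> (a * b) = \<alpha> a * \<alpha> b) \<and> (\<forall>a\<in>A. \<alpha> (star a) = star (\<alpha> a)) \<and>
        (\<forall>a\<in>A. \<forall>xs. set xs \<subseteq> A \<times> A \<longrightarrow> \<Delta> a = (\<Sum>(b, c)\<leftarrow>xs. tens b c) \<longrightarrow>
           \<Delta> (\<alpha> a) = (\<Sum>(b, c)\<leftarrow>xs. tens (\<alpha> b) (\<alpha> c)))})"

definition Aut_id ::
    "('c::unital_cstar_algebra \<Rightarrow> 'c \<Rightarrow> 'd::unital_cstar_algebra) \<Rightarrow> ('c \<Rightarrow> 'd) \<Rightarrow> 'c \<Rightarrow> 'c" where
  "Aut_id tens \<Delta> = (\<lambda>a\<in>CQG_algebra tens \<Delta>. a)"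

definition Aut_nhd ::
    "('c::unital_cstar_algebra \<Rightarrow> 'c \<Rightarrow> 'd::unital_cstar_algebra) \<Rightarrow> ('c \<Rightarrow> 'd) \<Rightarrow>
     'c set \<Rightarrow> real \<Rightarrow> ('c \<Rightarrow> 'c) set" where
  "Aut_nhd tens \<Delta> F \<epsilon> =
     {\<alpha> \<in> Aut tens \<Delta>. \<forall>a\<in>F. full_norm (CQG_algebra tens \<Delta>) (\<alpha> a - a) < ereal \<epsilon>}"

text \<open>The group topology with the sets \<open>Aut_nhd\<close> as a neighbourhood base at the identity: the
  neighbourhoods of \<open>\<alpha>\<close> are the left translates of these by \<open>\<alpha>\<close>.\<close>

definition Aut_open ::
    "('c::unital_cstar_algebra \<Rightarrow> 'c \<Rightarrow> 'd::unital_cstar_algebra) \<Rightarrow> ('c \<Rightarrow> 'd) \<Rightarrow>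
     ('c \<Rightarrow> 'c) set \<Rightarrow> bool" where
  "Aut_open tens \<Delta> U \<longleftrightarrow> U \<subseteq> Aut tens \<Delta> \<and>
     (\<forall>\<alpha>\<in>U. \<exists>F \<epsilon>. finite F \<and> F \<subseteq> CQG_algebra tens \<Delta> \<and> \<epsilon> > 0 \<and>
        (\<forall>\<gamma>\<in>Aut_nhd tens \<Delta> F \<epsilon>. compose (CQG_algebra tens \<Delta>) \<alpha> \<gamma> \<in> U))"

lemma istopology_Aut_open: "istopology (Aut_open tens \<Delta>)"
  unfolding istopology_def
proof (intro conjI allI impI)
  let ?A = "CQG_algebra tens \<Delta>"
  let ?N = "Aut_nhd tens \<Delta>"
  have openD: "\<exists>F \<epsilon>. finite F \<and> F \<subseteq> ?A \<and> \<epsilon> > 0 \<and> (\<forall>\<gamma>\<in>?N F \<epsilon>. compose ?A \<alpha> \<gamma> \<in> U)"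
    if "Aut_open tens \<Delta> U" "\<alpha> \<in> U" for U \<alpha>
    using that(1)[unfolded Aut_open_def, THEN conjunct2, rule_format, OF that(2)] .
  have sub: "U \<subseteq> Aut tens \<Delta>" if "Aut_open tens \<Delta> U" for U
    using that[unfolded Aut_open_def] by (rule conjunct1)
  {
    fix S T
    assume S: "Aut_open tens \<Delta> S" and T: "Aut_open tens \<Delta> T"
    have "\<exists>F \<epsilon>. finite F \<and> F \<subseteq> ?A \<and> \<epsilon> > 0 \<and> (\<forall>\<gamma>\<in>?N F \<epsilon>. compose ?A \<alpha> \<gamma> \<in> S \<inter> T)"
      if \<alpha>: "\<alpha> \<in> S \<inter> T" for \<alpha>
    proof -
      from openD[OF S, of \<alpha>] \<alpha> obtain F \<epsilon> where
        F: "finite F" "F \<subseteq> ?A" "\<epsilon> > 0" and FS: "\<forall>\<gamma>\<in>?N F \<epsilon>. compose ?A \<alpha> \<gamma> \<in> S" by auto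
      from openD[OF T, of \<alpha>] \<alpha> obtain F' \<epsilon>' where
        F': "finite F'" "F' \<subseteq> ?A" "\<epsilon>' > 0" and FT: "\<forall>\<gamma>\<in>?N F' \<epsilon>'. compose ?A \<alpha> \<gamma> \<in> T" by auto
      have "?N (F \<union> F') (min \<epsilon> \<epsilon>') \<subseteq> ?N F \<epsilon> \<inter> ?N F' \<epsilon>'"
        unfolding Aut_nhd_def ereal_min by auto
      then have "\<forall>\<gamma>\<in>?N (F \<union> F') (min \<epsilon> \<epsilon>'). compose ?A \<alpha> \<gamma> \<in> S \<inter> T"
        using FS FT by blast
      moreover have "finite (F \<union> F')" "F \<union> F' \<subseteq> ?A" "min \<epsilon> \<epsilon>' > 0"
        using F F' by simp_all
      ultimately show ?thesis by blast
    qed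
    then show "Aut_open tens \<Delta> (S \<inter> T)"
      unfolding Aut_open_def using sub[OF S] by (simp add: le_infI1)
  }
  {
    fix K assume K: "\<forall>S\<in>K. Aut_open tens \<Delta> S"
    have "\<exists>F \<epsilon>. finite F \<and> F \<subseteq> ?A \<and> \<epsilon> > 0 \<and> (\<forall>\<gamma>\<in>?N F \<epsilon>. compose ?A \<alpha> \<gamma> \<in> \<Union>K)"
      if \<alpha>: "\<alpha> \<in> \<Union>K" for \<alpha>
    proof -
      from \<alpha> obtain S where S: "S \<in> K" "\<alpha> \<in> S" by (rule UnionE)
      with K have "Aut_open tens \<Delta> S" by simp
      from openD[OF this S(2)] show ?thesis using S(1) by (meson UnionI)
    qed
    moreover have "\<Union>K \<subseteq> Aut tens \<Delta>"
      using K sub by (simp add: Sup_least)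
    ultimately show "Aut_open tens \<Delta> (\<Union>K)"
      unfolding Aut_open_def by simp
  }
qed

definition Aut_topology ::
    "('c::unital_cstar_algebra \<Rightarrow> 'c \<Rightarrow> 'd::unital_cstar_algebra) \<Rightarrow> ('c \<Rightarrow> 'd) \<Rightarrow>
     ('c \<Rightarrow> 'c) topology" where
  "Aut_topology tens \<Delta> = topology (Aut_open tens \<Delta>)"

text \<open>Characters depend only on the equivalence class of the representation, so quantifying over
  irreducible representations amounts to quantifying over \<open>Irr(G)\<close>.\<close>

definition Aut_chi ::
    "('c::unital_cstar_algebra \<Rightarrow> 'c \<Rightarrow> 'd::unital_cstar_algebra) \<Rightarrow> ('c \<Rightarrow> 'd) \<Rightarrow> ('c \<Rightarrow> 'c) set" where
  "Aut_chi tens \<Delta> = {\<alpha> \<in> Aut tens \<Delta>. \<forall>n u. irreducible_unitary_rep tens \<Delta> n u \<longrightarrow>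
     \<alpha> (rep_character n u) = rep_character n u}"

definition Aut_0 ::
    "('c::unital_cstar_algebra \<Rightarrow> 'c \<Rightarrow> 'd::unital_cstar_algebra) \<Rightarrow> ('c \<Rightarrow> 'd) \<Rightarrow> ('c \<Rightarrow> 'c) set" where
  "Aut_0 tens \<Delta> = connected_component_of_set (Aut_topology tens \<Delta>) (Aut_id tens \<Delta>)"

definition Aut_chi_0 ::
    "('c::unital_cstar_algebra \<Rightarrow> 'c \<Rightarrow> 'd::unital_cstar_algebra) \<Rightarrow> ('c \<Rightarrow> 'd) \<Rightarrow> ('c \<Rightarrow> 'c) set" where
  "Aut_chi_0 tens \<Delta> = connected_component_of_set
     (subtopology (Aut_topology tens \<Delta>) (Aut_chi tens \<Delta>)) (Aut_id tens \<Delta>)"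

end

theory Submission
  imports Defs
begin

text \<open>
  The stabilizer in \<open>Aut(G)\<close> of the character of an irreducible representation \<open>u\<close> is an open subgroup, hence
  also closed, and a connected set that contains the identity cannot leave it. So the connected sets through the
  identity in \<open>Aut(G)\<close> all lie in \<open>Aut\<^sub>\<chi>(G)\<close>, and both components are the union of the same sets
  (\<open>connected_Aut_subset_Aut_chi\<close>).

  Openness means that \<open>\<alpha>(u)\<close> has the character of \<open>u\<close> as soon as its matrix entries are close to those of \<open>u\<close>
  (\<open>rep_character_eq_of_close\<close>). For a classical compact group one averages \<open>v\<^sup>* u\<close>, with \<open>v = \<alpha>(u)\<close>, over
  the Haar measure and gets an intertwiner near the identity. Here one convolution operator takes the place
  of the Haar state. Choose a state \<open>f\<close> that is faithful on the span of the entries of \<open>u\<close> and \<open>v\<close>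
  (\<open>faithful_state_on_finite_span\<close>). The matrices \<open>g(v\<^sup>* u)\<close>, where \<open>g\<close> runs over the iterated convolutions of a state
  with \<open>f\<close>, are an orbit of the map \<open>Y \<mapsto> f(v\<^sup>* Y u)\<close>, and they stay near the identity matrix since every \<open>g\<close> is a
  state. The mean ergodic theorem in finite dimension yields a nonzero fixed matrix \<open>Y\<close> (\<open>averaged_matrix\<close>).
  On the vectors where \<open>Y\<close> attains its norm, the Cauchy-Schwarz inequality for \<open>f\<close> becomes an equality;
  as \<open>f\<close> is faithful, \<open>v Y = Y u\<close> holds there and the space of these vectors is invariant under \<open>u\<close>
  (\<open>fixed_matrix_intertwines_on_null_space\<close>). By irreducibility it is everything, so \<open>Y\<close> is a multiple of a
  unitary matrix that conjugates \<open>u\<close> into \<open>v\<close> (\<open>rep_character_eq_of_fixed_matrix\<close>).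

  States are needed in sufficient number, and so are their products on the spatial tensor product. The former
  come from the Hahn-Banach theorem, once \<open>x\<^sup>* x\<close> is known to be positive (\<open>positive_star_mult_self\<close>); that is
  proved with power series for square roots instead of spectral theory. The product functional of two states
  is positive by Schur's product theorem, hence bounded by the spatial norm, and extends to a state
  (\<open>product_state\<close>).

  Multiplicativity of an automorphism can be used for \<open>u u\<^sup>*\<close> only if the CQG algebra is closed under products
  and the involution. It is whenever the identity map belongs to the automorphism group
  (\<open>CQG_algebra_closed\<close>); otherwise both components are empty.
\<close>

section \<open>Elementary C*-algebra\<close>

lemma star_scaleR: "star (r *\<^sub>R x) = r *\<^sub>R star (x::'a::unital_cstar_algebra)"
  by (metis complex_cnj_complex_of_real scaleC_of_real star_scaleC)

lemma star_zero [simp]: "star 0 = (0::'a::unital_cstar_algebra)"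
  by (metis add_cancel_right_left star_add)

lemma star_minus: "star (- x) = - star (x::'a::unital_cstar_algebra)"
  by (metis add_eq_0_iff star_add star_zero add.right_inverse)

lemma star_diff: "star (x - y) = star x - star (y::'a::unital_cstar_algebra)"
  by (metis diff_conv_add_uminus star_add star_minus)

lemma star_one [simp]: "star 1 = (1::'a::unital_cstar_algebra)"
  by (metis mult_1 mult_1_right star_mult star_star)

lemma star_sum: "star (sum f I) = (\<Sum>i\<in>I. star (f i :: 'a::unital_cstar_algebra))"
  by (induction I rule: infinite_finite_induct) (auto simp: star_add)

lemma star_power: "star (x ^ n) = star (x::'a::unital_cstar_algebra) ^ n"
  by (induction n) (simp_all add: star_mult power_commutes)

lemma norm_star [simp]: "norm (star x) = norm (x::'a::unital_cstar_algebra)"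
proof -
  have "norm y \<le> norm (star y)" for y :: 'a
  proof (cases "y = 0")
    case False
    have "norm y * norm y \<le> norm (star y) * norm y"
      using norm_mult_ineq[of "star y" y] by (simp add: cstar_identity power2_eq_square)
    with False show ?thesis by simp
  qed simp
  from this[of x] this[of "star x"] show ?thesis by (simp add: star_star)
qed

lemma bounded_linear_star: "bounded_linear (star :: 'a::unital_cstar_algebra \<Rightarrow> 'a)"
  by (rule bounded_linear_intro[where K=1]) (auto simp: star_add star_scaleR)

lemma norm_square_selfadjoint:
  "star x = x \<Longrightarrow> norm (x\<^sup>2) = (norm (x::'a::unital_cstar_algebra))\<^sup>2"
  using cstar_identity[of x] by (simp add: power2_eq_square)

lemma norm_power_selfadjoint:
  assumes "star x = (x::'a::unital_cstar_algebra)"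
  shows "norm (x ^ (2 ^ n)) = norm x ^ (2 ^ n)"
proof (induction n)
  case (Suc n)
  have "norm (x ^ (2 ^ Suc n)) = norm ((x ^ (2 ^ n))\<^sup>2)"
    by (simp add: power_mult [symmetric] mult.commute)
  also have "\<dots> = (norm (x ^ (2 ^ n)))\<^sup>2"
    by (rule norm_square_selfadjoint) (simp add: star_power assms)
  finally show ?case
    by (simp add: Suc power_mult [symmetric] mult.commute)
qed simp

lemma imaginary_scale:
  "\<i> *\<^sub>C \<i> *\<^sub>C x = - (x::'a::unital_cstar_algebra)"
  by (simp add: scaleC_scaleC)

text \<open>Commuting selfadjoint elements behave like the real and imaginary part of a number.\<close>

lemma star_mult_real_imaginary:
  fixes x y :: "'a::unital_cstar_algebra"
  assumes "star x = x" "star y = y" "x * y = y * x"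
  shows "star (x + \<i> *\<^sub>C y) * (x + \<i> *\<^sub>C y) = x\<^sup>2 + y\<^sup>2"
  using assms
  by (simp add: star_add star_scaleC algebra_simps mult_scaleC_left mult_scaleC_right
      imaginary_scale power2_eq_square)

text \<open>\<open>x\<close> is the real part \<open>(u + u\<^sup>*) / 2\<close> of \<open>u = x + i y\<close>, and \<open>u\<^sup>* u = x\<^sup>2 + y\<^sup>2\<close>.\<close>

lemma norm_le_real_imaginary:
  fixes x y :: "'a::unital_cstar_algebra"
  assumes "star x = x" "star y = y" "x * y = y * x"
  shows "(norm x)\<^sup>2 \<le> norm (x\<^sup>2 + y\<^sup>2)"
proof -
  let ?u = "x + \<i> *\<^sub>C y"
  have "?u + star ?u = 2 *\<^sub>R x"
    using assms by (simp add: star_add star_scaleC scaleR_2)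
  then have "2 * norm x \<le> norm ?u + norm (star ?u)"
    by (metis abs_numeral norm_scaleR norm_triangle_ineq)
  then have "norm x \<le> norm ?u" by simp
  then have "(norm x)\<^sup>2 \<le> (norm ?u)\<^sup>2" by (simp add: power_mono)
  then show ?thesis
    using star_mult_real_imaginary[OF assms] cstar_identity[of ?u] by simp
qed

subsection \<open>Square roots\<close>

text \<open>The coefficients of the power series of the square root of \<open>1 - z\<close>.\<close>

definition sqrt_coeff :: "nat \<Rightarrow> real" where
  "sqrt_coeff k = ((1/2) gchoose k) * (-1) ^ k"

lemma sqrt_coeff_0 [simp]: "sqrt_coeff 0 = 1"
  by (simp add: sqrt_coeff_def)

lemma sqrt_coeff_Suc_nonpos: "sqrt_coeff (Suc k) \<le> 0"
proof (induction k)
  case (Suc k)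
  have "((1/2::real) gchoose Suc (Suc k)) * real (Suc (Suc k)) = (1/2 - real (Suc k)) * (1/2 gchoose Suc k)"
    using gbinomial_absorb_comp[of "1/2::real" "Suc k"] gbinomial_absorption[of "Suc k" "1/2::real"]
    by (simp add: mult.commute)
  then have "(((1/2::real) gchoose Suc (Suc k)) * real (Suc (Suc k))) * (-1) ^ k =
      ((1/2 - real (Suc k)) * (1/2 gchoose Suc k)) * (-1) ^ k"
    by (rule arg_cong)
  then have "sqrt_coeff (Suc (Suc k)) = (real (Suc k) - 1/2) / real (Suc (Suc k)) * sqrt_coeff (Suc k)"
    unfolding sqrt_coeff_def by (simp add: field_simps)
  also have "\<dots> \<le> 0" by (intro mult_nonneg_nonpos Suc divide_nonneg_nonneg) auto
  finally show ?case .
qed (simp add: sqrt_coeff_def)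

lemma sum_sqrt_coeff_nonneg: "0 \<le> (\<Sum>k\<le>n. sqrt_coeff k)"
proof -
  have "(\<Sum>k\<le>n. sqrt_coeff k) = (-1) ^ n * ((-1/2) gchoose n)"
    unfolding sqrt_coeff_def by (subst gbinomial_sum_lower_neg) simp
  also have "\<dots> = pochhammer (1/2) n / fact n"
    by (subst gbinomial_pochhammer) (simp flip: power_mult_distrib)
  also have "\<dots> \<ge> 0" by (simp add: pochhammer_nonneg)
  finally show ?thesis .
qed

lemma sum_abs_sqrt_coeff_Suc_le: "(\<Sum>k<n. \<bar>sqrt_coeff (Suc k)\<bar>) \<le> 1"
proof -
  have "(\<Sum>k<n. \<bar>sqrt_coeff (Suc k)\<bar>) = - (\<Sum>k<n. sqrt_coeff (Suc k))"
    by (simp add: sqrt_coeff_Suc_nonpos sum_negf)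
  also have "\<dots> = 1 - (\<Sum>k\<le>n. sqrt_coeff k)"
    using sum.lessThan_Suc_shift[of sqrt_coeff n] by (simp add: lessThan_Suc_atMost)
  finally show ?thesis using sum_sqrt_coeff_nonneg[of n] by simp
qed

lemma summable_sqrt_coeff_Suc: "summable (\<lambda>k. \<bar>sqrt_coeff (Suc k)\<bar>)"
  by (rule summableI_nonneg_bounded[OF _ sum_abs_sqrt_coeff_Suc_le]) simp

text \<open>The series for the square root of \<open>1 - z\<close> still converges absolutely on the boundary of the unit
  ball, because all its coefficients but the first are nonpositive.\<close>

lemma sqrt_one_minus:
  fixes z :: "'a::unital_cstar_algebra"
  assumes "norm z \<le> 1"
  obtains v where "v\<^sup>2 = 1 - z" "norm (1 - v) \<le> 1" "star z = z \<Longrightarrow> star v = v"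
    "\<And>y. y * z = z * y \<Longrightarrow> y * v = v * y"
proof
  define a where "a k = sqrt_coeff k *\<^sub>R z ^ k" for k
  define v where "v = (\<Sum>k. a k)"
  have np: "norm (z ^ k) \<le> 1" for k
    using norm_power_ineq[of z k] power_le_one[of "norm z" k] assms by simp
  have nle: "norm (a (Suc k)) \<le> \<bar>sqrt_coeff (Suc k)\<bar>" for k
    unfolding a_def using mult_left_mono[OF np[of "Suc k"], of "\<bar>sqrt_coeff (Suc k)\<bar>"] by simp
  have "summable (\<lambda>k. norm (a (Suc k)))"
    by (rule summable_comparison_test'[OF summable_sqrt_coeff_Suc, of 0]) (use nle in auto)
  then have sn: "summable (\<lambda>k. norm (a k))" by (subst (asm) summable_Suc_iff)
  then have s: "summable a" by (rule summable_norm_cancel)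
  have "(\<lambda>k. \<Sum>i\<le>k. a i * a (k - i)) sums (v * v)"
    unfolding v_def by (rule Cauchy_product_sums[OF sn sn])
  moreover have "(\<Sum>i\<le>k. a i * a (k - i)) = ((1 gchoose k) * (-1) ^ k) *\<^sub>R z ^ k" for k
  proof -
    have "(\<Sum>i\<le>k. a i * a (k - i)) = (\<Sum>i\<le>k. (((1/2) gchoose i) * ((1/2) gchoose (k - i)) * (-1) ^ k) *\<^sub>R z ^ k)"
    proof (rule sum.cong)
      fix i assume "i \<in> {..k}"
      then have "z ^ i * z ^ (k - i) = z ^ k" "(-1) ^ i * (-1) ^ (k - i) = ((-1) ^ k :: real)"
        by (simp_all flip: power_add)
      then show "a i * a (k - i) = (((1/2) gchoose i) * ((1/2) gchoose (k - i)) * (-1) ^ k) *\<^sub>R z ^ k"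
        unfolding a_def sqrt_coeff_def by (simp add: mult_ac) 
    qed simp
    also have "\<dots> = ((\<Sum>i\<le>k. ((1/2) gchoose i) * ((1/2) gchoose (k - i))) * (-1) ^ k) *\<^sub>R z ^ k"
      by (simp add: scaleR_left.sum sum_distrib_right)
    also have "(\<Sum>i\<le>k. ((1/2) gchoose i) * ((1/2) gchoose (k - i))) = ((1::real) gchoose k)"
      using gbinomial_Vandermonde[of "1/2::real" "1/2" k] by (simp add: atLeast0AtMost)
    finally show ?thesis .
  qed
  ultimately have "(\<lambda>k. ((1 gchoose k) * (-1) ^ k) *\<^sub>R z ^ k) sums (v * v)" by simp
  moreover have "(\<lambda>k. ((1 gchoose k) * (-1) ^ k :: real) *\<^sub>R z ^ k) sums
      (\<Sum>k\<in>{0,1}. ((1 gchoose k) * (-1) ^ k :: real) *\<^sub>R z ^ k)"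
  proof (rule sums_finite)
    fix k :: nat assume "k \<notin> {0, 1}"
    then have "1 < k" by auto
    then have "((1::real) gchoose k) = 0"
      by (metis binomial_eq_0 binomial_gbinomial of_nat_0 of_nat_1)
    then show "((1 gchoose k) * (-1) ^ k :: real) *\<^sub>R z ^ k = 0" by simp
  qed simp
  ultimately have "v * v = (\<Sum>k\<in>{0,1}. ((1 gchoose k) * (-1) ^ k :: real) *\<^sub>R z ^ k)"
    by (rule sums_unique2)
  then show "v\<^sup>2 = 1 - z" by (simp add: power2_eq_square)
  have "v = 1 + (\<Sum>k. a (Suc k))"
    unfolding v_def using suminf_split_head[OF s] by (simp add: a_def)
  then have "norm (1 - v) = norm (\<Sum>k. a (Suc k))" by (simp add: norm_minus_commute)
  also have "\<dots> \<le> (\<Sum>k. \<bar>sqrt_coeff (Suc k)\<bar>)"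
    by (rule norm_suminf_le[OF nle summable_sqrt_coeff_Suc])
  also have "\<dots> \<le> 1"
    by (rule suminf_le_const[OF summable_sqrt_coeff_Suc sum_abs_sqrt_coeff_Suc_le])
  finally show "norm (1 - v) \<le> 1" .
  show "star v = v" if "star z = z"
  proof -
    have "star (a k) = a k" for k by (simp add: a_def star_scaleR star_power that)
    then show ?thesis unfolding v_def by (simp add: bounded_linear.suminf[OF bounded_linear_star s])
  qed
  show "y * v = v * y" if "y * z = z * y" for y
  proof -
    have "y * z ^ k = z ^ k * y" for k
      by (metis power_commuting_commutes that)
    then have "y * a k = a k * y" for k by (simp add: a_def)
    then show ?thesis
      unfolding v_def by (simp add: suminf_mult[OF s, symmetric] suminf_mult2[OF s])
  qed
qed

subsection \<open>Positive elements\<close>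

text \<open>The bound on \<open>t - a\<close> is a way to say, without spectra, that the spectrum of \<open>a\<close> lies in \<open>[0, 2 t]\<close>. It
  makes it plain that the positive elements form a convex cone.\<close>

definition positive :: "'a::unital_cstar_algebra \<Rightarrow> bool" where
  "positive a \<longleftrightarrow> star a = a \<and> (\<exists>t\<ge>0. norm (t *\<^sub>R 1 - a) \<le> t)"

lemma positive_add: "positive a \<Longrightarrow> positive b \<Longrightarrow> positive (a + b)"
proof -
  assume a: "positive a" and b: "positive b"
  from a obtain t where t: "t \<ge> 0" "norm (t *\<^sub>R 1 - a) \<le> t" unfolding positive_def by blast
  from b obtain s where s: "s \<ge> 0" "norm (s *\<^sub>R 1 - b) \<le> s" unfolding positive_def by blast
  have "norm ((t + s) *\<^sub>R 1 - (a + b)) \<le> t + s"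
    using norm_triangle_ineq[of "t *\<^sub>R 1 - a" "s *\<^sub>R 1 - b"] t s by (simp add: algebra_simps)
  then show ?thesis using a b t s unfolding positive_def by (auto simp: star_add intro!: exI[of _ "t + s"])
qed

lemma positive_scaleR: "positive a \<Longrightarrow> r \<ge> 0 \<Longrightarrow> positive (r *\<^sub>R a)"
proof -
  assume a: "positive a" and r: "r \<ge> 0"
  from a obtain t where t: "t \<ge> 0" "norm (t *\<^sub>R 1 - a) \<le> t" unfolding positive_def by blast
  have "norm ((r * t) *\<^sub>R 1 - r *\<^sub>R a) = r * norm (t *\<^sub>R 1 - a)"
    using r by (metis abs_of_nonneg norm_scaleR scaleR_right_diff_distrib scaleR_scaleR)
  then have "norm ((r * t) *\<^sub>R 1 - r *\<^sub>R a) \<le> r * t" using t r by (simp add: mult_left_mono)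
  then show ?thesis using a t r unfolding positive_def
    by (auto simp: star_scaleR intro!: exI[of _ "r * t"])
qed

text \<open>Up to the factor \<open>t\<close>, the element \<open>a\<close> is \<open>1 - z\<close> with \<open>z = 1 - a / t\<close> in the unit ball.\<close>

lemma positive_sqrt:
  assumes "positive a"
  obtains v where "positive v" "v\<^sup>2 = a" "\<And>y. y * a = a * y \<Longrightarrow> y * v = v * y"
proof -
  from assms obtain t where t: "t \<ge> 0" "norm (t *\<^sub>R 1 - a) \<le> t" and sa: "star a = a"
    unfolding positive_def by blast
  show ?thesis
  proof (cases "t = 0")
    case True
    with t have "a = 0" by simp
    then show ?thesis by (intro that[of 0]) (auto simp: positive_def intro!: exI[of _ 0])
  next
    case False
    with t have t0: "t > 0" by simp
    let ?z = "1 - (1 / t) *\<^sub>R a"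
    have "?z = (1 / t) *\<^sub>R (t *\<^sub>R 1 - a)" using t0 by (simp add: algebra_simps)
    then have "norm ?z = norm (t *\<^sub>R 1 - a) / t" using t0 by simp
    then have "norm ?z \<le> 1" using t t0 by (simp add: divide_le_eq)
    then obtain v where v: "v\<^sup>2 = 1 - ?z" "norm (1 - v) \<le> 1" "star ?z = ?z \<Longrightarrow> star v = v"
      "\<And>y. y * ?z = ?z * y \<Longrightarrow> y * v = v * y" by (rule sqrt_one_minus) blast
    have "positive v" unfolding positive_def using v
      by (auto simp: star_diff star_scaleR sa intro!: exI[of _ 1])
    show ?thesis
    proof (rule that[of "sqrt t *\<^sub>R v"])
      show "positive (sqrt t *\<^sub>R v)" by (rule positive_scaleR) (use \<open>positive v\<close> t0 in auto)
      have "(sqrt t *\<^sub>R v)\<^sup>2 = t *\<^sub>R v\<^sup>2" using t0 by (simp add: power2_eq_square)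
      then show "(sqrt t *\<^sub>R v)\<^sup>2 = a" using v(1) t0 by simp
      show "y * (sqrt t *\<^sub>R v) = sqrt t *\<^sub>R v * y" if "y * a = a * y" for y
        using v(4)[of y] that by (simp add: algebra_simps)
    qed
  qed
qed

lemma positive_selfadjoint: "positive a \<Longrightarrow> star a = a"
  by (simp add: positive_def)

text \<open>With \<open>v\<close> the square root of \<open>1 - x\<^sup>2\<close>, the element \<open>v + i x\<close> has norm 1, so its real part
  \<open>v\<close> has norm at most 1.\<close>

lemma norm_one_minus_square_le:
  fixes x :: "'a::unital_cstar_algebra"
  assumes "star x = x" "norm x \<le> 1"
  shows "norm (1 - x\<^sup>2) \<le> 1"
proof -
  have "norm (x\<^sup>2) \<le> 1"
    using assms by (simp add: norm_square_selfadjoint power_le_one)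
  then obtain v where v: "v\<^sup>2 = 1 - x\<^sup>2" "star (x\<^sup>2) = x\<^sup>2 \<Longrightarrow> star v = v"
      "\<And>y. y * x\<^sup>2 = x\<^sup>2 * y \<Longrightarrow> y * v = v * y" by (rule sqrt_one_minus) blast
  have sv: "star v = v" using v(2) assms by (simp add: star_power)
  have "x * v = v * x" by (rule v(3)) (simp add: power2_eq_square mult.assoc)
  then have "(norm v)\<^sup>2 \<le> norm (v\<^sup>2 + x\<^sup>2)" using assms sv by (intro norm_le_real_imaginary) auto
  then show ?thesis using v(1) norm_square_selfadjoint[OF sv] by simp
qed

lemma positive_square:
  fixes x :: "'a::unital_cstar_algebra"
  assumes "star x = x"
  shows "positive (x\<^sup>2)"
proof (cases "x = 0")
  case True
  then show ?thesis by (auto simp: positive_def intro!: exI[of _ 0])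
next
  case False
  let ?y = "(1 / norm x) *\<^sub>R x"
  have sy: "star ?y = ?y" using assms by (simp add: star_scaleR)
  have "norm (1 - ?y\<^sup>2) \<le> 1" by (rule norm_one_minus_square_le[OF sy]) simp
  then have "positive (?y\<^sup>2)" unfolding positive_def using sy
    by (auto simp: star_power simp del: scaleR_power intro!: exI[of _ 1])
  then have "positive ((norm x)\<^sup>2 *\<^sub>R ?y\<^sup>2)" by (rule positive_scaleR) simp
  moreover have "(norm x)\<^sup>2 *\<^sub>R ?y\<^sup>2 = x\<^sup>2" using False by (simp add: power2_eq_square)
  ultimately show ?thesis by simp
qed

lemma norm_one_minus_positive_le:
  assumes "positive a" "norm a \<le> 1"
  shows "norm (1 - a) \<le> 1"
proof -
  from assms(1) obtain v where v: "positive v" "v\<^sup>2 = a" by (rule positive_sqrt)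
  then have "star v = v" by (simp add: positive_selfadjoint)
  then have "(norm v)\<^sup>2 \<le> 1" using assms v norm_square_selfadjoint by metis
  then have "norm v \<le> 1" by (simp add: power_le_one_iff)
  then show ?thesis using norm_one_minus_square_le[OF \<open>star v = v\<close>] v by simp
qed

text \<open>The square roots \<open>v\<close> and \<open>w\<close> of \<open>a\<close> and \<open>- a\<close> commute, and \<open>v\<^sup>2 + w\<^sup>2 = 0\<close>.\<close>

lemma positive_antisym:
  assumes "positive a" "positive (- a)"
  shows "a = 0"
proof -
  from assms(1) obtain v where v: "positive v" "v\<^sup>2 = a" "\<And>y. y * a = a * y \<Longrightarrow> y * v = v * y"
    by (rule positive_sqrt) blast
  from assms(2) obtain w where w: "positive w" "w\<^sup>2 = - a" "\<And>y. y * (- a) = (- a) * y \<Longrightarrow> y * w = w * y"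
    by (rule positive_sqrt) blast
  have "a = - (w\<^sup>2)" using w(2) by simp
  then have "w * a = a * w" by (simp add: power2_eq_square mult.assoc)
  then have "w * v = v * w" by (rule v(3))
  then have "(norm v)\<^sup>2 \<le> norm (v\<^sup>2 + w\<^sup>2)"
    using v(1) w(1) by (intro norm_le_real_imaginary) (auto simp: positive_selfadjoint)
  moreover have "v\<^sup>2 + w\<^sup>2 = 0" unfolding v(2) w(2) by (rule add.right_inverse)
  ultimately have "v = 0" by simp
  with v(2) show ?thesis by simp
qed

text \<open>If \<open>a + b\<close> has norm 1 then \<open>1 - a = (1 - a - b) + b\<close> is positive. So \<open>a = v\<^sup>2\<close> and \<open>1 - a = w\<^sup>2\<close> with
  commuting selfadjoint \<open>v\<close> and \<open>w\<close>, and \<open>v + i w\<close> has norm 1.\<close>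

lemma norm_positive_mono:
  assumes "positive a" "positive b"
  shows "norm a \<le> norm (a + b)"
proof (cases "a + b = 0")
  case True
  then have "b = - a" by (simp add: eq_neg_iff_add_eq_0 add.commute)
  then show ?thesis using positive_antisym assms True by auto
next
  case False
  define s where "s = norm (a + b)"
  have s: "s > 0" using False by (simp add: s_def)
  let ?a = "(1 / s) *\<^sub>R a" and ?b = "(1 / s) *\<^sub>R b"
  have pa: "positive ?a" and pb: "positive ?b"
    using assms s by (simp_all add: positive_scaleR)
  have "norm ((1 / s) *\<^sub>R (a + b)) = 1" using s unfolding s_def norm_scaleR by simp
  then have "norm (?a + ?b) = 1" by (simp add: scaleR_right_distrib)
  then have "positive (1 - (?a + ?b))"
    using pa[THEN positive_selfadjoint] pb[THEN positive_selfadjoint]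
    unfolding positive_def star_diff star_add by (auto simp: add.commute intro!: exI[of _ 1])
  from positive_add[OF this pb] have "positive (1 - ?a)" by (simp add: algebra_simps)
  then obtain w where w: "positive w" "w\<^sup>2 = 1 - ?a" "\<And>y. y * (1 - ?a) = (1 - ?a) * y \<Longrightarrow> y * w = w * y"
    by (rule positive_sqrt) blast
  from pa obtain v where v: "positive v" "v\<^sup>2 = ?a"
    by (rule positive_sqrt) blast
  have "v * ?a = ?a * v" unfolding v(2)[symmetric] by (simp add: power2_eq_square mult.assoc)
  then have "v * (1 - ?a) = (1 - ?a) * v" by (simp add: right_diff_distrib left_diff_distrib)
  then have "v * w = w * v" by (rule w(3))
  then have "(norm v)\<^sup>2 \<le> norm (v\<^sup>2 + w\<^sup>2)"
    using v w by (intro norm_le_real_imaginary) (auto simp: positive_selfadjoint)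
  then have "(norm v)\<^sup>2 \<le> 1" using v w by simp
  then have "norm ?a \<le> 1"
    using norm_square_selfadjoint[of v] v by (simp add: positive_selfadjoint)
  then show ?thesis using s by (simp add: s_def field_simps)
qed

text \<open>Write \<open>k = w\<^sup>2\<close> and \<open>k' = y y\<^sup>*\<close>. As \<open>y\<^sup>* y + y y\<^sup>*\<close> is twice the sum of the squares of the real and the imaginary
  part of \<open>y\<close>, the element \<open>k'\<close> is positive. From \<open>(1 + k') y = y (1 - k)\<close> one gets \<open>\<parallel>(1 + k')\<^sup>m y\<parallel> \<le> 1\<close> for
  all \<open>m\<close>, so the powers of the selfadjoint element \<open>1 + k'\<close> grow at most linearly in norm. By the C*-identity
  its norm is at most 1, and \<open>- k'\<close> is positive as well.\<close>

lemma star_mult_self_eq_minus_square_imp_0: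
  fixes y w :: "'a::unital_cstar_algebra"
  assumes y: "star y * y = - (w\<^sup>2)" and w: "star w = w" and n: "norm y \<le> 1"
  shows "y = 0"
proof -
  define k where "k = w\<^sup>2"
  define k' where "k' = y * star y"
  have ns: "norm k' = (norm y)\<^sup>2" using cstar_identity[of "star y"] by (simp add: k'_def star_star)
  have sk': "star k' = k'" by (simp add: k'_def star_mult star_star)
  define a where "a = (1/2) *\<^sub>R (y + star y)"
  define b where "b = (\<i> / 2) *\<^sub>C (star y - y)"
  have sa: "star a = a" by (simp add: a_def star_scaleR star_add star_star add.commute)
  have sb: "star b = b"
    by (simp add: b_def star_diff star_star star_scaleC complex_vector.scale_right_diff_distrib)
  have "4 *\<^sub>R a\<^sup>2 = (y + star y) * (y + star y)" by (simp add: a_def power2_eq_square)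
  moreover have "4 *\<^sub>R b\<^sup>2 = - ((star y - y) * (star y - y))"
  proof -
    have "b\<^sup>2 = complex_of_real (- (1 / 4)) *\<^sub>C ((star y - y) * (star y - y))"
      by (simp add: b_def power2_eq_square mult_scaleC_left mult_scaleC_right scaleC_scaleC)
    then show ?thesis unfolding scaleC_of_real by simp
  qed
  ultimately have "4 *\<^sub>R a\<^sup>2 + 4 *\<^sub>R b\<^sup>2 = 2 *\<^sub>R (star y * y) + 2 *\<^sub>R (y * star y)"
    by (simp add: algebra_simps scaleR_2)
  then have "2 *\<^sub>R k' = 4 *\<^sub>R a\<^sup>2 + 4 *\<^sub>R b\<^sup>2 + 2 *\<^sub>R w\<^sup>2"
    using y by (simp add: k'_def)
  moreover have "k' = (1/2) *\<^sub>R (2 *\<^sub>R k')" by simp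
  ultimately have "k' = 2 *\<^sub>R a\<^sup>2 + 2 *\<^sub>R b\<^sup>2 + w\<^sup>2"
    by (simp add: scaleR_right_distrib del: scaleR_scaleR) simp
  then have pk': "positive k'"
    by (simp add: positive_add positive_scaleR positive_square sa sb w)
  have "norm k = (norm y)\<^sup>2" using cstar_identity[of y] by (simp add: y k_def)
  then have "norm k \<le> 1" using n by (simp add: power_le_one)
  then have nk: "norm (1 - k) \<le> 1"
    using positive_square[OF w] by (simp add: norm_one_minus_positive_le k_def)
  have comm: "(1 + k') ^ m * y = y * (1 - k) ^ m" for m
  proof (induction m)
    case (Suc m)
    have "(1 + k') * y = y * (1 - k)"
      using y by (simp add: k_def k'_def algebra_simps)
    then show ?case
      unfolding power_Suc power_Suc2[of "1 - k"] using Suc by (metis mult.assoc power_commutes)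
  qed simp
  have bd: "norm ((1 + k') ^ m * k') \<le> 1" for m
  proof -
    have "(1 + k') ^ m * k' = y * (1 - k) ^ m * star y"
      using comm[of m] by (metis k'_def mult.assoc)
    also have "norm \<dots> \<le> norm y * norm ((1 - k) ^ m) * norm (star y)"
      by (meson norm_mult_ineq mult_right_mono norm_ge_zero order_trans)
    also have "norm ((1 - k) ^ m) \<le> 1"
      using norm_power_ineq[of "1 - k" m] power_le_one[of "norm (1 - k)" m] nk by simp
    then have "norm y * norm ((1 - k) ^ m) * norm (star y) \<le> norm y * 1 * norm (star y)"
      by (intro mult_right_mono mult_left_mono) auto
    also have "\<dots> \<le> 1" using n by (simp add: mult_le_one)
    finally show ?thesis .
  qed
  \<comment> \<open>sum the bound over the telescoping differences of the powers\<close>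
  have lin: "norm ((1 + k') ^ m) \<le> 1 + real m" for m
  proof (induction m)
    case (Suc m)
    have "(1 + k') ^ Suc m = (1 + k') ^ m + (1 + k') ^ m * k'"
      unfolding power_Suc2 by (simp add: distrib_left)
    then show ?case using Suc bd[of m] norm_triangle_ineq[of "(1 + k') ^ m" "(1 + k') ^ m * k'"] by simp
  qed simp
  have "norm (1 + k') \<le> 1"
  proof (rule ccontr)
    assume "\<not> ?thesis"
    define d where "d = norm (1 + k') - 1"
    have d: "norm (1 + k') = 1 + d" "d > 0"
      using \<open>\<not> norm (1 + k') \<le> 1\<close> by (simp_all add: d_def)
    have "(1 + d) ^ (2 ^ n) \<le> 1 + 2 ^ n" for n :: nat
      using lin[of "2 ^ n"] norm_power_selfadjoint[of "1 + k'" n] d sk' by (simp add: star_add)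
    moreover have "\<exists>n. 1 + 2 ^ n < (1 + d) ^ (2 ^ n)"
    proof -
      obtain j :: nat where j: "2 / d\<^sup>2 < 2 ^ j" using real_arch_pow[of 2 "2 / d\<^sup>2"] by auto
      define m :: real where "m = 2 ^ j"
      have "1 + 2 * m < (1 + m * d)\<^sup>2"
      proof -
        have "2 < m * d\<^sup>2" using j d by (simp add: m_def field_simps)
        then have "2 * m < m * d\<^sup>2 * m" by (intro mult_strict_right_mono) (auto simp: m_def)
        moreover have "0 < m * d" using d by (simp add: m_def)
        ultimately show ?thesis by (simp add: power2_eq_square algebra_simps)
      qed
      also have "\<dots> \<le> ((1 + d) ^ (2 ^ j))\<^sup>2"
        using Bernoulli_inequality[of d "2 ^ j"] d by (intro power_mono) (auto simp: m_def)
      also have "\<dots> = (1 + d) ^ (2 ^ Suc j)" by (simp add: power_mult [symmetric] mult.commute)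
      finally show ?thesis unfolding m_def by (intro exI[of _ "Suc j"]) simp
    qed
    ultimately show False by (meson not_le)
  qed
  then have "positive (- k')" using sk' by (auto simp: positive_def star_minus intro!: exI[of _ 1])
  with pk' have "k' = 0" by (rule positive_antisym)
  then show ?thesis using ns by simp
qed

text \<open>Kaplansky's theorem: with \<open>g = \<bar>h\<bar>\<close> and \<open>m = g - h\<close>, twice the negative part of
  \<open>h = x\<^sup>* x\<close>, the element \<open>y = x m\<close> has \<open>y\<^sup>* y = m h m = - g m\<^sup>2\<close>.\<close>

lemma positive_star_mult_self: "positive (star x * x)"
proof -
  define h where "h = star x * x"
  have sh: "star h = h" by (simp add: h_def star_mult star_star)
  have "positive (h\<^sup>2)" by (rule positive_square[OF sh])
  then obtain g where g: "positive g" "g\<^sup>2 = h\<^sup>2" "\<And>y. y * h\<^sup>2 = h\<^sup>2 * y \<Longrightarrow> y * g = g * y"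
    by (rule positive_sqrt) blast
  have hg: "h * g = g * h" by (rule g(3)) (simp add: power2_eq_square mult.assoc)
  have sg: "star g = g" by (rule positive_selfadjoint[OF g(1)])
  define m where "m = g - h"
  have sm: "star m = m" by (simp add: m_def star_diff sg sh)
  have mg: "m * g = g * m" by (simp add: m_def algebra_simps hg)
  have hm: "h * m = - (g * m)"
    using g(2) by (simp add: m_def algebra_simps hg power2_eq_square)
  obtain r where r: "positive r" "r\<^sup>2 = g" "\<And>y. y * g = g * y \<Longrightarrow> y * r = r * y"
    using g(1) by (rule positive_sqrt) blast
  have sr: "star r = r" by (rule positive_selfadjoint[OF r(1)])
  have mr: "m * r = r * m" by (rule r(3)[OF mg])
  have rr: "r * (r * z) = g * z" for z using r(2) by (simp add: power2_eq_square flip: mult.assoc)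
  define w where "w = r * m"
  have sw: "star w = w" by (simp add: w_def star_mult sr sm mr)
  define y where "y = x * m"
  have "star y * y = m * (h * m)" by (simp add: y_def star_mult sm h_def mult.assoc)
  also have "\<dots> = - (w\<^sup>2)"
  proof -
    have "w\<^sup>2 = r * (m * r) * m" by (simp add: w_def power2_eq_square mult.assoc)
    also have "\<dots> = g * m * m" by (simp add: mr mult.assoc rr)
    finally show ?thesis by (simp add: hm mg flip: mult.assoc)
  qed
  finally have yw: "star y * y = - (w\<^sup>2)" .
  have "y = 0"
  proof (rule ccontr)
    assume "y \<noteq> 0"
    then have ny: "norm y > 0" by simp
    let ?c = "1 / norm y"
    have "?c *\<^sub>R y = 0"
    proof (rule star_mult_self_eq_minus_square_imp_0)
      show "star (?c *\<^sub>R y) * (?c *\<^sub>R y) = - ((?c *\<^sub>R w)\<^sup>2)"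
        using yw by (simp add: star_scaleR power2_eq_square)
      show "star (?c *\<^sub>R w) = ?c *\<^sub>R w" by (simp add: star_scaleR sw)
    qed (use ny in simp)
    with ny show False by simp
  qed
  with yw have "w\<^sup>2 = 0" by simp
  then have "w = 0" using norm_square_selfadjoint[OF sw] by simp
  then have gm: "g * m = 0" using rr[of m] by (simp add: w_def)
  have "m\<^sup>2 = g * m - h * m" by (simp add: power2_eq_square m_def algebra_simps)
  then have "m\<^sup>2 = 0" by (simp add: hm gm)
  then have "m = 0" using norm_square_selfadjoint[OF sm] by simp
  then have "h = g" by (simp add: m_def)
  with g(1) show ?thesis by (simp add: h_def)
qed

lemma norm_one_minus_star_mult_self_le:
  "norm x \<le> 1 \<Longrightarrow> norm (1 - star x * x) \<le> 1"
  by (rule norm_one_minus_positive_le[OF positive_star_mult_self])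
    (simp add: cstar_identity power_le_one)

text \<open>This follows from \<open>(1 + k)\<^sup>2 = 4 k + (1 - k)\<^sup>2 \<ge> 4 k\<close>.\<close>

lemma norm_one_plus_positive:
  assumes k: "positive k" and n: "norm k = 1"
  shows "norm (1 + k) = 2"
proof (rule antisym)
  show "norm (1 + k) \<le> 2" using norm_triangle_ineq[of 1 k] n by simp
  have sk: "star k = k" by (rule positive_selfadjoint[OF k])
  have "norm (4 *\<^sub>R k) \<le> norm (4 *\<^sub>R k + (1 - k)\<^sup>2)"
    by (rule norm_positive_mono) (simp_all add: positive_scaleR k positive_square star_diff sk)
  also have "4 *\<^sub>R k + (1 - k)\<^sup>2 = (1 + k)\<^sup>2"
  proof -
    have "(2 + 2) *\<^sub>R k = k + k + k + k" unfolding scaleR_left_distrib scaleR_2 by (simp add: add.assoc)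
    then have "4 *\<^sub>R k = k + k + k + k" by simp
    then show ?thesis by (simp add: power2_eq_square algebra_simps)
  qed
  also have "norm ((1 + k)\<^sup>2) = (norm (1 + k))\<^sup>2"
    by (rule norm_square_selfadjoint) (simp add: star_add sk)
  finally have "2\<^sup>2 \<le> (norm (1 + k))\<^sup>2" using n by simp
  then show "2 \<le> norm (1 + k)" by (rule power2_le_imp_le) simp
qed

section \<open>Extension of linear functionals\<close>

definition sublinear :: "('a::real_vector \<Rightarrow> real) \<Rightarrow> bool" where
  "sublinear q \<longleftrightarrow> (\<forall>x y. q (x + y) \<le> q x + q y) \<and> (\<forall>r x. r \<ge> 0 \<longrightarrow> q (r *\<^sub>R x) = r * q x)"

lemma sublinear_add: "sublinear q \<Longrightarrow> q (x + y) \<le> q x + q y"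
  and sublinear_scaleR: "sublinear q \<Longrightarrow> r \<ge> 0 \<Longrightarrow> q (r *\<^sub>R x) = r * q x"
  by (simp_all add: sublinear_def)

lemma sublinear_zero: "sublinear q \<Longrightarrow> q 0 = 0"
  using sublinear_scaleR[of q 0 0] by simp

lemma sublinear_minus: "sublinear q \<Longrightarrow> - q (- x) \<le> q x"
  using sublinear_add[of q x "- x"] sublinear_zero[of q] by simp

text \<open>The inequality for \<open>1 / r\<close> gives the reverse of the inequality for \<open>r\<close>.\<close>

lemma sublinearI:
  assumes add: "\<And>x y. q (x + y) \<le> q x + q y" and zero: "q 0 = 0"
    and scale: "\<And>r x. r > 0 \<Longrightarrow> q (r *\<^sub>R x) \<le> r * q x"
  shows "sublinear q"
proof -
  have "q (r *\<^sub>R x) = r * q x" if "r \<ge> 0" for r x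
  proof (cases "r = 0")
    case False
    with that have r: "r > 0" by simp
    have "q x \<le> (1 / r) * q (r *\<^sub>R x)" using scale[of "1 / r" "r *\<^sub>R x"] r by simp
    then have "r * q x \<le> q (r *\<^sub>R x)" using r by (simp add: field_simps)
    with scale[OF r, of x] show ?thesis by simp
  qed (simp add: zero)
  then show ?thesis using add by (simp add: sublinear_def)
qed

text \<open>A cone \<open>C\<close> of pairs \<open>(y, r)\<close>, each of them read as a constraint \<open>f y \<le> r\<close>, is absorbed into a
  sublinear functional by inf-convolution with \<open>p\<close>.\<close>

lemma sublinear_inf_convolution:
  fixes p :: "'a::real_vector \<Rightarrow> real" and C :: "('a \<times> real) set"
  assumes p: "sublinear p" and C0: "(0, 0) \<in> C"
    and Cadd: "\<And>y r z s. (y, r) \<in> C \<Longrightarrow> (z, s) \<in> C \<Longrightarrow> (y + z, r + s) \<in> C"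
    and Cscale: "\<And>y r t. (y, r) \<in> C \<Longrightarrow> t > 0 \<Longrightarrow> (t *\<^sub>R y, t * r) \<in> C"
    and Cp: "\<And>y r. (y, r) \<in> C \<Longrightarrow> 0 \<le> p (- y) + r"
  obtains q where "sublinear q" "\<And>x. q x \<le> p x" "\<And>y r. (y, r) \<in> C \<Longrightarrow> q y \<le> r"
proof -
  define S where "S x = (\<lambda>(y, r). p (x - y) + r) ` C" for x
  define q where "q x = Inf (S x)" for x
  have lower: "- p (- x) \<le> p (x - y) + r" if "(y, r) \<in> C" for x y r
    using Cp[OF that] sublinear_add[OF p, of "x - y" "- x"] by simp
  have bdd: "bdd_below (S x)" for x
    unfolding S_def by (rule bdd_belowI[of _ "- p (- x)"]) (use lower in auto)
  have ne: "S x \<noteq> {}" for x using C0 by (auto simp: S_def)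
  have le: "q x \<le> p (x - y) + r" if "(y, r) \<in> C" for x y r
    unfolding q_def by (rule cInf_lower[OF _ bdd]) (use that in \<open>force simp: S_def\<close>)
  have approx: "\<exists>y r. (y, r) \<in> C \<and> p (x - y) + r < q x + e" if "e > 0" for x e
    using cInf_lessD[OF ne[of x], of "q x + e"] that by (force simp: q_def S_def)
  show ?thesis
  proof (rule that)
    show "q x \<le> p x" for x using le[OF C0, of x] by simp
    show "q y \<le> r" if "(y, r) \<in> C" for y r
      using le[OF that, of y] sublinear_zero[OF p] by simp
    show "sublinear q"
    proof (rule sublinearI)
      fix x x' :: 'a
      show "q (x + x') \<le> q x + q x'"
      proof (rule field_le_epsilon)
        fix e :: real assume "e > 0"
        then have e: "e / 2 > 0" by simp
        from approx[OF e, of x] approx[OF e, of x'] obtain y r y' r' where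
          "(y, r) \<in> C" "p (x - y) + r < q x + e / 2" "(y', r') \<in> C" "p (x' - y') + r' < q x' + e / 2"
          by blast
        moreover from this have "q (x + x') \<le> p (x + x' - (y + y')) + (r + r')" by (intro le Cadd)
        moreover have "p (x + x' - (y + y')) \<le> p (x - y) + p (x' - y')"
          using sublinear_add[OF p, of "x - y" "x' - y'"] by (simp add: algebra_simps)
        ultimately show "q (x + x') \<le> q x + q x' + e" by simp
      qed
    next
      show "q 0 = 0"
      proof (rule antisym)
        show "q 0 \<le> 0" using le[OF C0, of 0] sublinear_zero[OF p] by simp
        show "0 \<le> q 0" unfolding q_def
          by (rule cInf_greatest[OF ne]) (use lower[of _ _ 0] sublinear_zero[OF p] in \<open>auto simp: S_def\<close>)
      qed
    next
      fix t :: real and x :: 'a assume t: "t > 0"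
      show "q (t *\<^sub>R x) \<le> t * q x"
      proof (rule field_le_epsilon)
        fix e :: real assume "e > 0"
        then have "e / t > 0" using t by simp
        then obtain y r where yr: "(y, r) \<in> C" "p (x - y) + r < q x + e / t" using approx by blast
        have "q (t *\<^sub>R x) \<le> p (t *\<^sub>R x - t *\<^sub>R y) + t * r" by (intro le Cscale yr t)
        also have "p (t *\<^sub>R x - t *\<^sub>R y) = t * p (x - y)"
          using sublinear_scaleR[OF p, of t "x - y"] t by (simp add: scaleR_right_diff_distrib)
        also have "t * p (x - y) + t * r \<le> t * (q x + e / t)"
          using mult_left_mono[OF less_imp_le[OF yr(2)], of t] t by (simp add: distrib_left)
        also have "\<dots> = t * q x + e" using t by (simp add: distrib_left)
        finally show "q (t *\<^sub>R x) \<le> t * q x + e" by simp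
      qed
    qed
  qed
qed

text \<open>Inf-convolution with the ray through \<open>(- x, - q x)\<close> does not increase \<open>q\<close>; by minimality it does not change \<open>q\<close>
  either, so \<open>q (- x) \<le> - q x\<close>.\<close>

lemma minimal_sublinear_linear:
  assumes q: "sublinear q" and min: "\<And>q'. sublinear q' \<Longrightarrow> (\<And>x. q' x \<le> q x) \<Longrightarrow> q' = q"
  shows "linear q"
proof -
  have odd: "q (- x) = - q x" for x
  proof -
    let ?C = "(\<lambda>t. (- (t *\<^sub>R x), - t * q x)) ` {0..}"
    obtain q' where q': "sublinear q'" "\<And>y. q' y \<le> q y" "\<And>y r. (y, r) \<in> ?C \<Longrightarrow> q' y \<le> r"
    proof (rule sublinear_inf_convolution[OF q, of ?C])
      show "(0, 0) \<in> ?C" by (auto intro!: image_eqI[of _ _ 0])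
      show "(y + z, r + s) \<in> ?C" if "(y, r) \<in> ?C" "(z, s) \<in> ?C" for y r z s
      proof -
        from that obtain a b where ab: "a \<ge> 0" "b \<ge> 0" "y = - (a *\<^sub>R x)" "r = - a * q x"
          "z = - (b *\<^sub>R x)" "s = - b * q x" by auto
        then show ?thesis
          by (intro image_eqI[of _ _ "a + b"]) (auto simp: algebra_simps)
      qed
      show "(t *\<^sub>R y, t * r) \<in> ?C" if "(y, r) \<in> ?C" "t > 0" for y r t
        using that by (auto simp: algebra_simps intro!: image_eqI[of _ _ "_ * t"])
      show "0 \<le> q (- y) + r" if "(y, r) \<in> ?C" for y r
        using that sublinear_scaleR[OF q] by auto
    qed blast
    have "(- x, - q x) \<in> ?C" by (auto intro!: image_eqI[of _ _ 1])
    then have "q' (- x) \<le> - q x" by (rule q'(3))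
    moreover have "q' = q" using q' by (intro min)
    ultimately show ?thesis using sublinear_minus[OF q, of x] by simp
  qed
  show ?thesis
  proof (rule linearI)
    fix x y
    have "q (x + y) \<le> q x + q y" by (rule sublinear_add[OF q])
    moreover have "q (- x + - y) \<le> q (- x) + q (- y)" by (rule sublinear_add[OF q])
    then have "- q (x + y) \<le> - q x - q y" using odd[of "x + y"] by (simp add: odd)
    ultimately show "q (x + y) = q x + q y" by simp
  next
    fix r x
    show "q (r *\<^sub>R x) = r *\<^sub>R q x"
    proof (cases "r \<ge> 0")
      case False
      then have "q ((- r) *\<^sub>R x) = (- r) * q x" using sublinear_scaleR[OF q, of "- r" x] by simp
      then show ?thesis using odd[of "r *\<^sub>R x"] by simp
    qed (simp add: sublinear_scaleR[OF q])
  qed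
qed

text \<open>Zorn's lemma provides a minimal sublinear functional below \<open>p\<close>. Pointwise infima of chains are sublinear, and
  finite because of the lower bound \<open>- p (- x)\<close>.\<close>

lemma linear_below_sublinear:
  assumes p: "sublinear p"
  obtains f where "linear f" "\<And>x. f x \<le> p x"
proof -
  define A where "A = {q. sublinear q \<and> (\<forall>x. q x \<le> p x)}"
  define R where "R q q' \<longleftrightarrow> (\<forall>x. q' x \<le> q x)" for q q' :: "'a \<Rightarrow> real"
  have "\<exists>m\<in>A. \<forall>a\<in>A. R m a \<longrightarrow> a = m"
  proof (rule predicate_Zorn)
    show "partial_order_on A (relation_of R A)"
      by (auto simp: partial_order_on_def preorder_on_def refl_on_def trans_def antisym_def
          relation_of_def R_def intro: order_trans intro!: ext antisym)
  next
    fix C assume C: "C \<in> Chains (relation_of R A)"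
    then have CA: "C \<subseteq> A" by (auto simp: Chains_def relation_of_def)
    have tot: "R a b \<or> R b a" if "a \<in> C" "b \<in> C" for a b
      using C that by (auto simp: Chains_def relation_of_def)
    show "\<exists>u\<in>A. \<forall>a\<in>C. R a u"
    proof (cases "C = {}")
      case True
      then show ?thesis using p by (auto simp: A_def)
    next
      case False
      define u where "u x = (INF a\<in>C. a x)" for x
      have lower: "- p (- x) \<le> a x" if "a \<in> C" for a x
      proof -
        have "sublinear a" "a (- x) \<le> p (- x)" using that CA by (auto simp: A_def)
        then show ?thesis using sublinear_minus[of a x] by simp
      qed
      have le: "u x \<le> a x" if "a \<in> C" for a x
        unfolding u_def by (rule cINF_lower[OF _ that]) (use lower in \<open>auto intro!: bdd_belowI\<close>)
      have approx: "\<exists>a\<in>C. a x < u x + e" if "e > 0" for x e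
        using cInf_lessD[of "(\<lambda>a. a x) ` C" "u x + e"] that False by (auto simp: u_def)
      have sub: "sublinear a" if "a \<in> C" for a using that CA by (auto simp: A_def)
      have "sublinear u"
      proof (rule sublinearI)
        fix x y
        show "u (x + y) \<le> u x + u y"
        proof (rule field_le_epsilon)
          fix e :: real assume "e > 0"
          then have e: "e / 2 > 0" by simp
          from approx[OF e, of x] approx[OF e, of y] obtain a b where
            ab: "a \<in> C" "a x < u x + e / 2" "b \<in> C" "b y < u y + e / 2" by blast
          \<comment> \<open>the smaller one of two members of the chain serves both arguments\<close>
          obtain c where c: "c \<in> C" "c x \<le> a x" "c y \<le> b y"
            using tot[OF ab(1) ab(3)] ab unfolding R_def by blast
          have "u (x + y) \<le> c x + c y"
            using le[OF c(1), of "x + y"] sublinear_add[OF sub[OF c(1)], of x y] by simp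
          then show "u (x + y) \<le> u x + u y + e" using ab c by simp
        qed
      next
        have "a 0 = 0" if "a \<in> C" for a using sublinear_zero[OF sub[OF that]] .
        then have "(\<lambda>a. a 0) ` C = {0}" using False by force
        then show "u 0 = 0" by (simp add: u_def)
      next
        fix r :: real and x assume r: "r > 0"
        show "u (r *\<^sub>R x) \<le> r * u x"
        proof (rule field_le_epsilon)
          fix e :: real assume "e > 0"
          then have "e / r > 0" using r by simp
          then obtain a where a: "a \<in> C" "a x < u x + e / r" using approx by blast
          have "u (r *\<^sub>R x) \<le> r * a x"
            using le[OF a(1), of "r *\<^sub>R x"] sublinear_scaleR[OF sub[OF a(1)], of r x] r by simp
          also have "\<dots> \<le> r * (u x + e / r)" using a r by (intro mult_left_mono) auto
          also have "\<dots> = r * u x + e" using r by (simp add: distrib_left)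
          finally show "u (r *\<^sub>R x) \<le> r * u x + e" .
        qed
      qed
      moreover have "u x \<le> p x" for x
      proof -
        obtain a where "a \<in> C" using False by blast
        moreover from this have "a x \<le> p x" using CA by (auto simp: A_def)
        ultimately show ?thesis using le[of a x] by simp
      qed
      ultimately show ?thesis using le by (intro bexI[of _ u]) (auto simp: A_def R_def)
    qed
  qed
  then obtain m where m: "m \<in> A" "\<And>a. a \<in> A \<Longrightarrow> R m a \<Longrightarrow> a = m" by blast
  have "linear m"
  proof (rule minimal_sublinear_linear)
    show "sublinear m" using m(1) by (simp add: A_def)
    show "q' = m" if "sublinear q'" "\<And>x. q' x \<le> m x" for q'
      using that m(1) by (intro m(2)) (auto simp: A_def R_def intro: order_trans)
  qed
  then show ?thesis using m(1) by (intro that[of m]) (auto simp: A_def)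
qed

text \<open>The Hahn-Banach theorem. The functional to be extended is given as a set of constraints, so that it may be
  described by representatives (such as sums of elementary tensors) without a proof that it is well defined.\<close>

lemma Hahn_Banach_cone:
  fixes C :: "('a::real_normed_vector \<times> real) set"
  assumes "(0, 0) \<in> C"
    and "\<And>y r z s. (y, r) \<in> C \<Longrightarrow> (z, s) \<in> C \<Longrightarrow> (y + z, r + s) \<in> C"
    and "\<And>y r t. (y, r) \<in> C \<Longrightarrow> t > 0 \<Longrightarrow> (t *\<^sub>R y, t * r) \<in> C"
    and "\<And>y r. (y, r) \<in> C \<Longrightarrow> - r \<le> norm y"
  obtains f where "linear f" "\<And>x. f x \<le> norm x" "\<And>y r. (y, r) \<in> C \<Longrightarrow> f y \<le> r"
proof -
  have n: "sublinear (norm :: 'a \<Rightarrow> real)" by (auto simp: sublinear_def norm_triangle_ineq)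
  obtain q where q: "sublinear q" "\<And>x. q x \<le> norm x" "\<And>y r. (y, r) \<in> C \<Longrightarrow> q y \<le> r"
    by (rule sublinear_inf_convolution[OF n assms(1-3)]) (use assms(4) in fastforce)+
  from q(1) obtain f where f: "linear f" "\<And>x. f x \<le> q x" by (rule linear_below_sublinear) blast
  show ?thesis
    by (rule that[OF f(1)]) (use f(2) q(2,3) in \<open>blast intro: order_trans\<close>)+
qed

section \<open>States\<close>

lemma state_one: "state \<phi> \<Longrightarrow> \<phi> 1 = 1"
  and state_nonneg: "state \<phi> \<Longrightarrow> \<phi> (star x * x) \<in> \<real>\<^sub>\<ge>\<^sub>0"
  by (simp_all add: state_def)

lemma vector_space_complex: "vector_space ((*) :: complex \<Rightarrow> complex \<Rightarrow> complex)"
  by unfold_locales (simp_all add: algebra_simps)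

lemma linear_functionalI:
  assumes "\<And>x y. \<phi> (x + y) = \<phi> x + \<phi> y" "\<And>c x. \<phi> (c *\<^sub>C x) = c * \<phi> x"
  shows "Vector_Spaces.linear scaleC (*) (\<phi> :: 'a::unital_cstar_algebra \<Rightarrow> complex)"
  unfolding Vector_Spaces.linear_iff
  using assms vector_space_complex complex_vector.vector_space_axioms by blast

lemma linear_functionalD:
  assumes "Vector_Spaces.linear scaleC (*) (\<phi> :: 'a::unital_cstar_algebra \<Rightarrow> complex)"
  shows "\<phi> (x + y) = \<phi> x + \<phi> y" "\<phi> (c *\<^sub>C x) = c * \<phi> x"
  using assms unfolding Vector_Spaces.linear_iff by auto

lemma state_add: "state \<phi> \<Longrightarrow> \<phi> (x + y) = \<phi> x + \<phi> y"
  and state_scaleC: "state \<phi> \<Longrightarrow> \<phi> (c *\<^sub>C x) = c * \<phi> x"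
  using linear_functionalD[of \<phi>] by (auto simp: state_def)

lemma state_zero: "state \<phi> \<Longrightarrow> \<phi> 0 = 0"
  using state_add[of \<phi> 0 0] by simp

lemma state_minus: "state \<phi> \<Longrightarrow> \<phi> (- x) = - \<phi> x"
  using state_add[of \<phi> x "- x"] by (simp add: state_zero eq_neg_iff_add_eq_0 add.commute)

lemma state_diff: "state \<phi> \<Longrightarrow> \<phi> (x - y) = \<phi> x - \<phi> y"
  using state_add[of \<phi> x "- y"] by (simp add: state_minus)

lemma state_sum: "state \<phi> \<Longrightarrow> \<phi> (sum f I) = (\<Sum>i\<in>I. \<phi> (f i))"
  by (induction I rule: infinite_finite_induct) (auto simp: state_zero state_add)

lemma state_nonneg_Re: "state \<phi> \<Longrightarrow> 0 \<le> Re (\<phi> (star x * x))"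
  and state_Im_eq_0: "state \<phi> \<Longrightarrow> Im (\<phi> (star x * x)) = 0"
  using state_nonneg[of \<phi> x] by (simp_all add: complex_nonneg_Reals_iff)

lemma state_square_eq_0_iff: "state \<phi> \<Longrightarrow> \<phi> (star x * x) = 0 \<longleftrightarrow> Re (\<phi> (star x * x)) \<le> 0"
  using state_nonneg_Re[of \<phi> x] state_Im_eq_0[of \<phi> x] by (auto simp: complex_eq_iff)

text \<open>The values at \<open>(x + c y)\<^sup>* (x + c y)\<close> are real; take \<open>c = 1\<close> and \<open>c = i\<close>.\<close>

lemma state_star_mult:
  assumes s: "state \<phi>"
  shows "\<phi> (star y * x) = cnj (\<phi> (star x * y))"
proof -
  have e: "\<phi> (star (x + c *\<^sub>C y) * (x + c *\<^sub>C y)) = \<phi> (star x * x) + c * \<phi> (star x * y)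
      + cnj c * \<phi> (star y * x) + complex_of_real ((cmod c)\<^sup>2) * \<phi> (star y * y)" for c
    by (simp add: star_add star_scaleC distrib_left distrib_right mult_scaleC_left mult_scaleC_right
        state_add[OF s] state_scaleC[OF s] complex_norm_square mult.commute del: of_real_power)
  have "Im (c * \<phi> (star x * y) + cnj c * \<phi> (star y * x)) = 0" for c
    using arg_cong[OF e[of c], of Im] state_Im_eq_0[OF s] by simp
  from this[of 1] this[of \<i>] show ?thesis by (simp add: complex_eq_iff)
qed

lemma state_star: "state \<phi> \<Longrightarrow> \<phi> (star x) = cnj (\<phi> x)"
  using state_star_mult[of \<phi> x 1] by simp

lemma state_Cauchy_Schwarz:
  assumes s: "state \<phi>"
  shows "(cmod (\<phi> (star x * y)))\<^sup>2 \<le> Re (\<phi> (star x * x)) * Re (\<phi> (star y * y))"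
proof -
  define z where "z = \<phi> (star x * y)"
  let ?A = "Re (\<phi> (star x * x))" and ?B = "Re (\<phi> (star y * y))"
  have e: "0 \<le> ?A + 2 * Re (c * z) + (cmod c)\<^sup>2 * ?B" for c
  proof -
    have "\<phi> (star (x + c *\<^sub>C y) * (x + c *\<^sub>C y)) = \<phi> (star x * x) + c * z
        + cnj (c * z) + complex_of_real ((cmod c)\<^sup>2) * \<phi> (star y * y)"
      by (simp add: star_add star_scaleC distrib_left distrib_right mult_scaleC_left mult_scaleC_right
          state_add[OF s] state_scaleC[OF s] complex_norm_square state_star_mult[OF s, of y x] z_def mult.commute
          del: of_real_power)
    from arg_cong[OF this, of Re] show ?thesis
      using state_nonneg_Re[OF s, of "x + c *\<^sub>C y"] by (simp add: algebra_simps)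
  qed
  have e2: "0 \<le> ?A - 2 * r * (cmod z)\<^sup>2 + r\<^sup>2 * (cmod z)\<^sup>2 * ?B" for r :: real
  proof -
    have "Re (- complex_of_real r * cnj z * z) = - r * (cmod z)\<^sup>2"
      by (simp add: cmod_power2) (simp add: power2_eq_square algebra_simps)
    then show ?thesis using e[of "- complex_of_real r * cnj z"]
      by (simp add: norm_mult power_mult_distrib)
  qed
  show ?thesis
  proof (cases "?B = 0")
    case True
    have "z = 0"
    proof (rule ccontr)
      assume "z \<noteq> 0"
      then have "(cmod z)\<^sup>2 > 0" by simp
      then show False using e2[of "(?A + 1) / (cmod z)\<^sup>2"] state_nonneg_Re[OF s, of x] True by simp
    qed
    then show ?thesis using True by (simp add: z_def)
  next
    case False
    then have B: "?B > 0" using state_nonneg_Re[OF s, of y] by linarith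
    have "0 \<le> ?A - (cmod z)\<^sup>2 / ?B"
      using e2[of "1 / ?B"] B by (simp add: power2_eq_square field_simps)
    then show ?thesis using B by (simp add: z_def field_simps)
  qed
qed

lemma state_eq_0: "state \<phi> \<Longrightarrow> \<phi> (star x * x) = 0 \<Longrightarrow> \<phi> (y * x) = 0"
  using state_Cauchy_Schwarz[of \<phi> "star y" x] by (simp add: star_star)

text \<open>In the unit ball \<open>1 - x\<^sup>* x\<close> is the square of a selfadjoint element, so the state is nonnegative there.\<close>

lemma state_star_mult_self_le:
  assumes s: "state \<phi>"
  shows "Re (\<phi> (star x * x)) \<le> (norm x)\<^sup>2"
proof (cases "x = 0")
  case True
  then show ?thesis by (simp add: state_zero[OF s])
next
  case False
  let ?y = "complex_of_real (1 / norm x) *\<^sub>C x"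
  have "norm (star ?y * ?y) \<le> 1" using False by (simp add: cstar_identity norm_scaleC norm_divide)
  then obtain v where v: "v\<^sup>2 = 1 - star ?y * ?y"
    "star (star ?y * ?y) = star ?y * ?y \<Longrightarrow> star v = v" by (rule sqrt_one_minus) blast
  have "star v = v" by (rule v(2)) (simp add: star_mult star_star)
  then have "0 \<le> Re (\<phi> (1 - star ?y * ?y))"
    using state_nonneg_Re[OF s, of v] v(1) by (simp add: power2_eq_square)
  then have "Re (\<phi> (star ?y * ?y)) \<le> 1" by (simp add: state_diff[OF s] state_one[OF s])
  moreover have "\<phi> (star ?y * ?y) = complex_of_real ((1 / norm x)\<^sup>2) * \<phi> (star x * x)"
    by (simp add: star_scaleC mult_scaleC_left mult_scaleC_right state_scaleC[OF s] power2_eq_square)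
  then have "Re (\<phi> (star ?y * ?y)) = (1 / norm x)\<^sup>2 * Re (\<phi> (star x * x))"
    by (simp only: Re_complex_of_real times_complex.sel Im_complex_of_real)
  ultimately have "(1 / norm x)\<^sup>2 * Re (\<phi> (star x * x)) \<le> 1" by simp
  then show ?thesis using False by (simp add: power_divide divide_le_eq)
qed

lemma unital_star_homD:
  assumes "unital_star_hom h"
  shows "h (x + y) = h x + h y" "h (c *\<^sub>C x) = c *\<^sub>C h x" "h 1 = 1" "h (x * y) = h x * h y"
    "h (star x) = star (h x)"
proof -
  have l: "Vector_Spaces.linear scaleC scaleC h" using assms by (simp add: unital_star_hom_def)
  show "h (x + y) = h x + h y" "h (c *\<^sub>C x) = c *\<^sub>C h x"
    using l unfolding Vector_Spaces.linear_iff by auto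
qed (use assms in \<open>simp_all add: unital_star_hom_def\<close>)

lemma state_comp_hom:
  assumes "state \<phi>" "unital_star_hom h"
  shows "state (\<lambda>x. \<phi> (h x))"
proof -
  have "\<phi> (h (star x * x)) \<in> \<real>\<^sub>\<ge>\<^sub>0" for x
    using state_nonneg[OF assms(1), of "h x"] by (simp add: unital_star_homD[OF assms(2)])
  moreover have "Vector_Spaces.linear scaleC (*) (\<lambda>x. \<phi> (h x))"
    by (rule linear_functionalI)
      (simp_all add: unital_star_homD[OF assms(2)] state_add[OF assms(1)] state_scaleC[OF assms(1)])
  ultimately show ?thesis
    by (simp add: state_def unital_star_homD[OF assms(2)] state_one[OF assms(1)])
qed

lemma state_midpoint:
  assumes "state \<phi>" "state \<psi>"
  shows "state (\<lambda>x. (\<phi> x + \<psi> x) / 2)"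
proof -
  have "(\<phi> (star x * x) + \<psi> (star x * x)) / 2 \<in> \<real>\<^sub>\<ge>\<^sub>0" for x
    using assms[THEN state_nonneg, of x] by (simp add: complex_nonneg_Reals_iff)
  moreover have "Vector_Spaces.linear scaleC (*) (\<lambda>x. (\<phi> x + \<psi> x) / 2)"
    by (rule linear_functionalI)
      (simp_all add: assms[THEN state_add] assms[THEN state_scaleC] algebra_simps add_divide_distrib)
  ultimately show ?thesis
    by (simp add: state_def assms[THEN state_one])
qed

text \<open>A functional of norm 1 with value 1 at the unit is a state; it is given here by its real part. Reality on
  selfadjoint \<open>h\<close> comes from \<open>\<bar>f (h + i t)\<bar>\<^sup>2 \<le> \<parallel>h\<parallel>\<^sup>2 + t\<^sup>2\<close> for all real \<open>t\<close>, positivity from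
  \<open>\<bar>1 - f (x\<^sup>* x)\<bar> \<le> 1\<close> on the unit ball.\<close>

lemma state_of_real_functional:
  fixes f :: "'a::unital_cstar_algebra \<Rightarrow> real"
  assumes l: "linear f" and n: "\<And>x. f x \<le> norm x" and one: "f 1 = 1"
  shows "state (\<lambda>x. Complex (f x) (- f (\<i> *\<^sub>C x)))"
proof -
  define F where "F x = Complex (f x) (- f (\<i> *\<^sub>C x))" for x
  have cs: "c *\<^sub>C x = Re c *\<^sub>R x + Im c *\<^sub>R (\<i> *\<^sub>C x)" for c and x :: 'a
  proof -
    have "c = complex_of_real (Re c) + complex_of_real (Im c) * \<i>" by (simp add: complex_eq_iff)
    then have "c *\<^sub>C x = complex_of_real (Re c) *\<^sub>C x + complex_of_real (Im c) *\<^sub>C \<i> *\<^sub>C x"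
      by (metis scaleC_add_left scaleC_scaleC)
    then show ?thesis by (simp only: scaleC_of_real)
  qed
  have Fadd: "F (x + y) = F x + F y" for x y
    by (simp add: F_def scaleC_add_right linear_add[OF l] complex_eq_iff)
  have fs: "f (c *\<^sub>C x) = Re c * f x + Im c * f (\<i> *\<^sub>C x)" for c x
    by (subst cs) (simp add: linear_add[OF l] linear_scale[OF l])
  have Fs: "F (c *\<^sub>C x) = c * F x" for c x
    using fs[of "\<i> * c" x] fs[of c x] by (simp add: F_def complex_eq_iff scaleC_scaleC)
  have Fn: "cmod (F x) \<le> norm x" for x
  proof (cases "F x = 0")
    case False
    let ?c = "cnj (F x) / cmod (F x)"
    have "F (?c *\<^sub>C x) = cmod (F x)"
      using False complex_norm_square[of "F x"]
      by (simp add: Fs power2_eq_square mult.commute[of "cnj _"] divide_eq_eq del: of_real_mult flip: of_real_mult)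
    then have "f (?c *\<^sub>C x) = cmod (F x)" by (simp add: F_def complex_eq_iff)
    then show ?thesis using n[of "?c *\<^sub>C x"] False by (simp add: norm_scaleC norm_divide)
  qed simp
  have F1: "F 1 = 1"
  proof -
    have "Re (F 1) = 1" by (simp add: F_def one)
    moreover have "(cmod (F 1))\<^sup>2 \<le> 1" using Fn[of 1] by (simp add: power_le_one)
    ultimately show ?thesis by (simp add: cmod_power2 complex_eq_iff)
  qed
  have real: "Im (F h) = 0" if h: "star h = h" for h
  proof (rule ccontr)
    assume neq: "Im (F h) \<noteq> 0"
    have key: "(Im (F h) + t)\<^sup>2 \<le> (norm h)\<^sup>2 + t\<^sup>2" for t
    proof -
      let ?u = "h + \<i> *\<^sub>C (t *\<^sub>R 1)"
      have "F ?u = F h + \<i> * t"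
        using Fs[of "complex_of_real t" 1] by (simp add: Fadd Fs F1 scaleC_of_real)
      then have "\<bar>Im (F h) + t\<bar> \<le> norm ?u"
        using Fn[of ?u] abs_Im_le_cmod[of "F ?u"] by simp
      then have "(Im (F h) + t)\<^sup>2 \<le> (norm ?u)\<^sup>2"
        by (metis abs_ge_zero power2_abs power_mono)
      also have "\<dots> = norm (h\<^sup>2 + (t *\<^sub>R 1)\<^sup>2)"
        unfolding cstar_identity[symmetric]
        by (subst star_mult_real_imaginary) (simp_all add: h star_scaleR)
      also have "\<dots> \<le> norm (h\<^sup>2) + norm ((t *\<^sub>R 1 :: 'a)\<^sup>2)" by (rule norm_triangle_ineq)
      also have "\<dots> = (norm h)\<^sup>2 + t\<^sup>2" by (simp add: norm_square_selfadjoint h)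
      finally show ?thesis .
    qed
    from key[of "(norm h)\<^sup>2 / Im (F h)"] neq have "(Im (F h))\<^sup>2 + 2 * (norm h)\<^sup>2 \<le> (norm h)\<^sup>2"
      by (simp add: power2_sum)
    then have "(Im (F h))\<^sup>2 \<le> 0" using zero_le_power2[of "norm h"] by linarith
    then show False using neq by simp
  qed
  have "F (star x * x) \<in> \<real>\<^sub>\<ge>\<^sub>0" for x
  proof (cases "x = 0")
    case True
    then show ?thesis using Fn[of 0] by simp
  next
    case False
    let ?y = "complex_of_real (1 / norm x) *\<^sub>C x"
    have "norm ?y \<le> 1" using False by (simp add: norm_scaleC norm_divide)
    then have "norm (1 - star ?y * ?y) \<le> 1" by (rule norm_one_minus_star_mult_self_le)
    then have "cmod (F (1 - star ?y * ?y)) \<le> 1" using Fn order_trans by blast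
    moreover have "F (1 - star ?y * ?y) + F (star ?y * ?y) = 1" 
      unfolding Fadd[symmetric] using F1 by simp
    ultimately have "Re (F (star ?y * ?y)) \<ge> 0"
      using complex_Re_le_cmod[of "F (1 - star ?y * ?y)"] by (simp add: complex_eq_iff)
    moreover have "F (star ?y * ?y) = complex_of_real ((1 / norm x)\<^sup>2) * F (star x * x)"
      by (simp add: star_scaleC mult_scaleC_left mult_scaleC_right Fs power2_eq_square)
    ultimately have "0 \<le> (1 / norm x)\<^sup>2 * Re (F (star x * x))"
      by (simp only: times_complex.sel Re_complex_of_real Im_complex_of_real)
    moreover have "(1 / norm x)\<^sup>2 > 0" using False by simp
    ultimately have "Re (F (star x * x)) \<ge> 0" using zero_le_mult_iff by (metis not_le)
    then show ?thesis using real[of "star x * x"]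
      by (simp add: complex_nonneg_Reals_iff star_mult star_star)
  qed
  then show ?thesis
    using linear_functionalI[of F] Fadd Fs F1 unfolding state_def F_def by blast
qed

text \<open>A functional of norm 1 that attains the norm 2 of \<open>1 + k\<close>, where \<open>k\<close> is \<open>x\<^sup>* x\<close> scaled to norm 1, takes the
  value 1 at both \<open>1\<close> and \<open>k\<close>. It is obtained from the constraint \<open>f (- (1 + k)) \<le> - 2\<close>.\<close>

lemma state_exists:
  fixes x :: "'a::unital_cstar_algebra"
  assumes "x \<noteq> 0"
  obtains \<phi> where "state \<phi>" "\<phi> (star x * x) \<noteq> 0"
proof -
  let ?y = "complex_of_real (1 / norm x) *\<^sub>C x"
  define k where "k = star ?y * ?y"
  have "norm ?y = 1" using assms by (simp add: norm_scaleC norm_divide)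
  then have nk: "norm k = 1" by (simp add: k_def cstar_identity)
  have "positive k" unfolding k_def by (rule positive_star_mult_self)
  then have n2: "norm (1 + k) = 2" using nk by (rule norm_one_plus_positive)
  define C where "C = (\<lambda>t. (- (t *\<^sub>R (1 + k)), - 2 * t)) ` {0..}"
  obtain f where f: "linear f" "\<And>x. f x \<le> norm x" "\<And>y r. (y, r) \<in> C \<Longrightarrow> f y \<le> r"
  proof (rule Hahn_Banach_cone[of C])
    show "(0, 0) \<in> C" by (auto simp: C_def intro!: image_eqI[of _ _ 0])
    show "(y + z, r + s) \<in> C" if yz: "(y, r) \<in> C" "(z, s) \<in> C" for y r z s
    proof -
      from yz obtain a b where "a \<ge> 0" "b \<ge> 0" "y = - (a *\<^sub>R (1 + k))" "r = - 2 * a"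
        "z = - (b *\<^sub>R (1 + k))" "s = - 2 * b" unfolding C_def by blast
      then show ?thesis unfolding C_def
        by (intro image_eqI[of _ _ "a + b"]) (simp_all add: scaleR_add_left)
    qed
    show "(t *\<^sub>R y, t * r) \<in> C" if "(y, r) \<in> C" "t > 0" for y r t
      using that by (auto simp: C_def algebra_simps intro!: image_eqI[of _ _ "_ * t"])
    show "- r \<le> norm y" if "(y, r) \<in> C" for y r
      using that n2 by (auto simp: C_def)
  qed blast
  have "(- (1 + k), - 2) \<in> C" unfolding C_def by (rule image_eqI[of _ _ 1]) auto
  then have "f (- (1 + k)) \<le> - 2" by (rule f(3))
  then have "2 \<le> f 1 + f k" by (simp add: linear_add[OF f(1)] linear_diff[OF f(1)] linear_neg[OF f(1)])
  moreover have "f 1 \<le> 1" "f k \<le> 1" using f(2)[of 1] f(2)[of k] nk by simp_all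
  ultimately have f1: "f 1 = 1" "f k = 1" by linarith+
  define \<phi> where "\<phi> x = Complex (f x) (- f (\<i> *\<^sub>C x))" for x
  have s: "state \<phi>" unfolding \<phi>_def by (rule state_of_real_functional[OF f(1,2) f1(1)])
  have "\<phi> k \<noteq> 0" by (simp add: \<phi>_def f1 complex_eq_iff)
  then have "\<phi> (star x * x) \<noteq> 0"
    by (auto simp: k_def star_scaleC mult_scaleC_left mult_scaleC_right state_scaleC[OF s])
  with s show ?thesis by (rule that)
qed

text \<open>If the null space of \<open>\<phi>\<close> in the span of \<open>insert a E\<close> meets the span of \<open>E\<close> trivially, then it is
  at most one-dimensional, and averaging with a state that does not vanish there makes \<open>\<phi>\<close> faithful.\<close>

lemma faithful_state_on_finite_span:
  fixes E :: "'a::unital_cstar_algebra set"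
  assumes "finite E"
  obtains \<phi> where "state \<phi>" "\<And>x. x \<in> complex_vector.span E \<Longrightarrow> \<phi> (star x * x) = 0 \<Longrightarrow> x = 0"
proof -
  have "\<exists>\<phi>. state \<phi> \<and> (\<forall>x\<in>complex_vector.span E. \<phi> (star x * x) = 0 \<longrightarrow> x = 0)"
    using assms
  proof (induction E)
    case empty
    obtain \<phi> :: "'a \<Rightarrow> complex" where "state \<phi>" by (rule state_exists[of 1]) auto
    then show ?case by auto
  next
    case (insert a E)
    then obtain \<phi> where \<phi>: "state \<phi>" "\<And>x. x \<in> complex_vector.span E \<Longrightarrow> \<phi> (star x * x) = 0 \<Longrightarrow> x = 0"
      by blast
    show ?case
    proof (cases "\<exists>x\<in>complex_vector.span (insert a E). \<phi> (star x * x) = 0 \<and> x \<noteq> 0")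
      case False
      then show ?thesis using \<phi> by blast
    next
      case True
      then obtain x where x: "x \<in> complex_vector.span (insert a E)" "\<phi> (star x * x) = 0" "x \<noteq> 0" by blast
      obtain \<psi> where \<psi>: "state \<psi>" "\<psi> (star x * x) \<noteq> 0" using x(3) by (rule state_exists)
      define \<theta> where "\<theta> y = (\<phi> y + \<psi> y) / 2" for y
      have "state \<theta>" unfolding \<theta>_def by (rule state_midpoint[OF \<phi>(1) \<psi>(1)])
      moreover have "y = 0" if y: "y \<in> complex_vector.span (insert a E)" "\<theta> (star y * y) = 0" for y
      proof -
        have "\<phi> (star y * y) = 0 \<and> \<psi> (star y * y) = 0"
          using y(2) state_nonneg_Re[OF \<phi>(1), of y] state_nonneg_Re[OF \<psi>(1), of y]
            state_Im_eq_0[OF \<phi>(1), of y] state_Im_eq_0[OF \<psi>(1), of y]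
          unfolding \<theta>_def by (auto simp: complex_eq_iff)
        then have y0: "\<phi> (star y * y) = 0" "\<psi> (star y * y) = 0" by auto
        obtain c where c: "x - c *\<^sub>C a \<in> complex_vector.span E"
          using x(1) by (auto simp: complex_vector.span_insert)
        obtain d where d: "y - d *\<^sub>C a \<in> complex_vector.span E"
          using y(1) by (auto simp: complex_vector.span_insert)
        have null: "\<phi> (star (r *\<^sub>C x + s *\<^sub>C y) * (r *\<^sub>C x + s *\<^sub>C y)) = 0" for r s
          using state_eq_0[OF \<phi>(1) x(2)] state_eq_0[OF \<phi>(1) y0(1)]
          by (simp add: star_add star_scaleC distrib_left distrib_right mult_scaleC_left mult_scaleC_right
              state_add[OF \<phi>(1)] state_scaleC[OF \<phi>(1)])
        have "c \<noteq> 0"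
        proof
          assume "c = 0"
          then have "x \<in> complex_vector.span E" using c by simp
          with \<phi>(2) x show False by blast
        qed
        have "c *\<^sub>C (y - d *\<^sub>C a) - d *\<^sub>C (x - c *\<^sub>C a) = (- d) *\<^sub>C x + c *\<^sub>C y"
          by (simp add: complex_vector.scale_right_diff_distrib scaleC_scaleC mult.commute)
        moreover have "c *\<^sub>C (y - d *\<^sub>C a) - d *\<^sub>C (x - c *\<^sub>C a) \<in> complex_vector.span E"
          by (rule complex_vector.span_diff; rule complex_vector.span_scale) (rule d, rule c)
        ultimately have "(- d) *\<^sub>C x + c *\<^sub>C y = 0" using null \<phi>(2) by metis
        then have "c *\<^sub>C y = d *\<^sub>C x" by simp
        then have yx: "y = (d / c) *\<^sub>C x" using \<open>c \<noteq> 0\<close>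
          by (metis complex_vector.scale_one divide_self_if mult.commute scaleC_scaleC times_divide_eq_left times_divide_eq_right)
        then have "\<psi> (star y * y) = (d / c) * cnj (d / c) * \<psi> (star x * x)"
          by (simp add: star_scaleC mult_scaleC_left mult_scaleC_right state_scaleC[OF \<psi>(1)])
        with y0(2) \<psi>(2) \<open>c \<noteq> 0\<close> have "d = 0" by simp
        then show "y = 0" using yx by simp
      qed
      ultimately show ?thesis by blast
    qed
  qed
  then show ?thesis using that by blast
qed

section \<open>Product states\<close>

definition psd :: "'i set \<Rightarrow> ('i \<Rightarrow> 'i \<Rightarrow> complex) \<Rightarrow> bool" where
  "psd I P \<longleftrightarrow> (\<forall>i\<in>I. \<forall>j\<in>I. P j i = cnj (P i j)) \<and>
     (\<forall>c. 0 \<le> Re (\<Sum>i\<in>I. \<Sum>j\<in>I. cnj (c i) * c j * P i j))"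

lemma psd_hermitian: "psd I P \<Longrightarrow> i \<in> I \<Longrightarrow> j \<in> I \<Longrightarrow> P j i = cnj (P i j)"
  and psd_nonneg: "psd I P \<Longrightarrow> 0 \<le> Re (\<Sum>i\<in>I. \<Sum>j\<in>I. cnj (c i) * c j * P i j)"
  unfolding psd_def by blast+

lemma psd_support:
  assumes "psd I P" "finite I" "J \<subseteq> I"
  shows "0 \<le> Re (\<Sum>i\<in>J. \<Sum>j\<in>J. cnj (c i) * c j * P i j)"
proof -
  let ?c = "\<lambda>i. if i \<in> J then c i else 0"
  have "(\<Sum>i\<in>I. \<Sum>j\<in>I. cnj (?c i) * ?c j * P i j) = (\<Sum>i\<in>J. \<Sum>j\<in>I. cnj (?c i) * ?c j * P i j)"
    using assms by (intro sum.mono_neutral_right) auto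
  also have "\<dots> = (\<Sum>i\<in>J. \<Sum>j\<in>J. cnj (c i) * c j * P i j)"
    using assms by (intro sum.cong sum.mono_neutral_cong_right) auto
  finally show ?thesis using psd_nonneg[OF assms(1), of ?c] by simp
qed

lemma psd_diagonal:
  assumes "psd I P" "finite I" "a \<in> I"
  shows "0 \<le> Re (P a a)" "Im (P a a) = 0"
  using psd_support[OF assms(1,2), of "{a}" "\<lambda>_. 1"] psd_hermitian[OF assms(1), of a a] assms(3)
  by (auto simp: complex_eq_iff)

lemma psd_zero_row:
  assumes P: "psd I P" and I: "finite I" "a \<in> I" "j \<in> I" and z: "P a a = 0"
  shows "P a j = 0"
proof (cases "j = a")
  case True
  then show ?thesis using z by simp
next
  case False
  let ?z = "P a j"
  have "0 \<le> Re (P j j) - 2 * s * (cmod ?z)\<^sup>2" for s :: real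
  proof -
    let ?c = "\<lambda>i. if i = j then 1 else - complex_of_real s * ?z"
    have "(\<Sum>i\<in>{a, j}. \<Sum>k\<in>{a, j}. cnj (?c i) * ?c k * P i k)
        = P j j - complex_of_real s * (cnj ?z * ?z) - complex_of_real s * (?z * cnj ?z)"
      using False z psd_hermitian[OF P I(2,3)] by simp
    also have "\<dots> = P j j - complex_of_real (2 * s * (cmod ?z)\<^sup>2)"
      using complex_norm_square[of ?z] by (simp add: mult.commute)
    finally show ?thesis using psd_support[OF P I(1), of "{a, j}" ?c] I by simp
  qed
  from this[of "(Re (P j j) + 1) / (2 * (cmod ?z)\<^sup>2)"] show ?thesis
    by (cases "?z = 0") auto
qed

text \<open>The Schur complement with respect to a diagonal entry \<open>d\<close>. If \<open>d = 0\<close> then the whole row vanishes, and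
  division by zero gives the right value.\<close>

lemma psd_Schur_complement:
  assumes P: "psd (insert a I) P" and I: "finite I" "a \<notin> I"
  defines "Q \<equiv> \<lambda>i j. P i j - P i a * P a j / P a a"
  shows "psd I Q" "\<And>j. j \<in> insert a I \<Longrightarrow> Q a j = 0" "\<And>j. j \<in> insert a I \<Longrightarrow> Q j a = 0"
proof -
  have fin: "finite (insert a I)" using I by simp
  have row0: "P a j = 0" "P j a = 0" if "P a a = 0" "j \<in> insert a I" for j
    using psd_zero_row[OF P fin _ that(2,1)] psd_hermitian[OF P, of a j] that(2) by auto
  show "Q a j = 0" "Q j a = 0" if "j \<in> insert a I" for j
    using row0[OF _ that] by (cases "P a a = 0"; simp add: Q_def)+
  define d where "d = Re (P a a)"
  have d: "P a a = complex_of_real d" "d \<ge> 0"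
    using psd_diagonal[OF P fin, of a] by (auto simp: d_def complex_eq_iff)
  have herm: "P j i = cnj (P i j)" if "i \<in> insert a I" "j \<in> insert a I" for i j
    using psd_hermitian[OF P that] .
  have hermQ: "Q j i = cnj (Q i j)" if ij: "i \<in> I" "j \<in> I" for i j
  proof -
    have "P j i = cnj (P i j)" "P j a = cnj (P a j)" "P a i = cnj (P i a)" using ij by (auto intro: herm)
    then show ?thesis by (simp add: Q_def d mult.commute)
  qed
  have "0 \<le> Re (\<Sum>i\<in>I. \<Sum>j\<in>I. cnj (c i) * c j * Q i j)" for c
  proof -
    define S where "S = (\<Sum>j\<in>I. c j * P a j)"
    have S': "(\<Sum>i\<in>I. cnj (c i) * P i a) = cnj S"
      unfolding S_def cnj_sum complex_cnj_mult by (intro sum.cong refl arg_cong2[of _ _ _ _ "(*)"] herm) auto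
    have "(\<Sum>i\<in>I. \<Sum>j\<in>I. cnj (c i) * c j * Q i j) = (\<Sum>i\<in>I. \<Sum>j\<in>I. cnj (c i) * c j * P i j)
        - (\<Sum>i\<in>I. \<Sum>j\<in>I. (cnj (c i) * P i a) * (c j * P a j) / P a a)"
      unfolding sum_subtractf[symmetric] Q_def by (simp add: algebra_simps)
    also have "(\<Sum>i\<in>I. \<Sum>j\<in>I. (cnj (c i) * P i a) * (c j * P a j) / P a a)
        = (\<Sum>i\<in>I. cnj (c i) * P i a) * (\<Sum>j\<in>I. c j * P a j) / P a a"
      unfolding sum_product sum_divide_distrib ..
    also have "\<dots> = cnj S * S / P a a" unfolding S' S_def[symmetric] ..
    finally have 1: "(\<Sum>i\<in>I. \<Sum>j\<in>I. cnj (c i) * c j * Q i j) =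
      (\<Sum>i\<in>I. \<Sum>j\<in>I. cnj (c i) * c j * P i j) - cnj S * S / P a a" .
    let ?e = "\<lambda>i. if i = a then - S / P a a else c i"
    have e: "?e i = c i" if "i \<in> I" for i using that I by auto
    have "(\<Sum>i\<in>insert a I. \<Sum>j\<in>insert a I. cnj (?e i) * ?e j * P i j)
       = cnj (?e a) * ?e a * P a a + (\<Sum>j\<in>I. cnj (?e a) * c j * P a j)
         + (\<Sum>i\<in>I. cnj (c i) * ?e a * P i a) + (\<Sum>i\<in>I. \<Sum>j\<in>I. cnj (c i) * c j * P i j)"
      using I by (simp add: sum.distrib sum_subtractf sum_negf e cong: sum.cong)
    also have "(\<Sum>j\<in>I. cnj (?e a) * c j * P a j) = cnj (?e a) * S"
      by (simp add: S_def sum_distrib_left mult.assoc)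
    also have "(\<Sum>i\<in>I. cnj (c i) * ?e a * P i a) = ?e a * cnj S"
      by (simp add: S'[symmetric] sum_distrib_left mult_ac)
    also have "cnj (?e a) * ?e a * P a a + cnj (?e a) * S + ?e a * cnj S = - (cnj S * S / P a a)"
      using d by (cases "P a a = 0") (auto simp: field_simps)
    finally have "(\<Sum>i\<in>insert a I. \<Sum>j\<in>insert a I. cnj (?e i) * ?e j * P i j) =
        (\<Sum>i\<in>I. \<Sum>j\<in>I. cnj (c i) * c j * Q i j)" unfolding 1 by simp
    then show ?thesis using psd_nonneg[OF P, of ?e] by simp
  qed
  with hermQ show "psd I Q" unfolding psd_def by blast
qed

text \<open>Schur's product theorem, by splitting off one rank-one summand of \<open>Q\<close> after the other.\<close>

lemma psd_trace_nonneg: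
  assumes "finite I" "psd I P" "psd I Q"
  shows "0 \<le> Re (\<Sum>i\<in>I. \<Sum>j\<in>I. P i j * Q i j)"
  using assms
proof (induction I arbitrary: Q)
  case (insert a I)
  define Q' where "Q' i j = Q i j - Q i a * Q a j / Q a a" for i j
  note Q' = psd_Schur_complement[OF insert.prems(2) insert.hyps(1,2), folded Q'_def]
  have fin: "finite (insert a I)" using insert.hyps by simp
  obtain d where d: "Q a a = complex_of_real d" "d \<ge> 0"
    using psd_diagonal[OF insert.prems(2) fin, of a]
    by (metis complex_of_real_def complex_surj insertI1)
  have "psd I P"
    unfolding psd_def using psd_hermitian[OF insert.prems(1)] psd_support[OF insert.prems(1) fin, of I]
    by blast
  then have 1: "0 \<le> Re (\<Sum>i\<in>I. \<Sum>j\<in>I. P i j * Q' i j)" using insert.IH Q'(1) by blast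
  have 2: "(\<Sum>i\<in>insert a I. \<Sum>j\<in>insert a I. P i j * Q' i j) = (\<Sum>i\<in>I. \<Sum>j\<in>I. P i j * Q' i j)"
    using insert.hyps Q'(2,3) by (simp add: sum.distrib)
  have cQ: "cnj (Q a i) = Q i a" if "i \<in> insert a I" for i
    using psd_hermitian[OF insert.prems(2) _ that, of a] by simp
  have 3: "(\<Sum>i\<in>insert a I. \<Sum>j\<in>insert a I. P i j * (Q i a * Q a j / Q a a)) =
     (\<Sum>i\<in>insert a I. \<Sum>j\<in>insert a I. cnj (Q a i) * Q a j * P i j) / complex_of_real d"
    unfolding sum_divide_distrib
    by (intro sum.cong refl) (simp only: cQ d(1) mult_ac times_divide_eq_right)
  have 4: "0 \<le> Re ((\<Sum>i\<in>insert a I. \<Sum>j\<in>insert a I. cnj (Q a i) * Q a j * P i j) / complex_of_real d)"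
    using psd_nonneg[OF insert.prems(1), of "Q a"] d by (simp only: Re_divide_of_real divide_nonneg_nonneg)
  have "(\<Sum>i\<in>insert a I. \<Sum>j\<in>insert a I. P i j * Q i j) =
     (\<Sum>i\<in>insert a I. \<Sum>j\<in>insert a I. P i j * (Q i a * Q a j / Q a a))
     + (\<Sum>i\<in>insert a I. \<Sum>j\<in>insert a I. P i j * Q' i j)"
    unfolding sum.distrib[symmetric] Q'_def distrib_left[symmetric] by simp
  then show ?case unfolding 2 3 using 1 4 by simp
qed simp

lemma psd_state:
  assumes s: "state \<phi>" and I: "finite I"
  shows "psd I (\<lambda>i j. \<phi> (star (x i) * x j))"
proof -
  have "\<phi> (star (\<Sum>i\<in>I. c i *\<^sub>C x i) * (\<Sum>i\<in>I. c i *\<^sub>C x i)) =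
      (\<Sum>i\<in>I. \<Sum>j\<in>I. cnj (c i) * c j * \<phi> (star (x i) * x j))" for c
    by (simp add: star_sum sum_product star_scaleC mult_scaleC_left mult_scaleC_right state_sum[OF s]
        state_scaleC[OF s] mult_ac)
  then show ?thesis
    unfolding psd_def using state_nonneg_Re[OF s] state_star_mult[OF s] by metis
qed

lemma product_functional_Nil [simp]: "product_functional \<phi> \<psi> [] = 0"
  and product_functional_Cons [simp]:
    "product_functional \<phi> \<psi> ((a, b) # xs) = \<phi> a * \<psi> b + product_functional \<phi> \<psi> xs"
  and product_functional_append [simp]:
    "product_functional \<phi> \<psi> (xs @ ys) = product_functional \<phi> \<psi> xs + product_functional \<phi> \<psi> ys"
  by (simp_all add: product_functional_def)

lemma product_functional_formal_mult_star:
  "product_functional \<phi> \<psi> (formal_mult (formal_star xs) ys) =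
     (\<Sum>(a, b)\<leftarrow>xs. \<Sum>(c, d)\<leftarrow>ys. \<phi> (star a * c) * \<psi> (star b * d))"
proof (induction xs)
  case (Cons x xs)
  obtain a b where x: "x = (a, b)" by (cases x)
  have "product_functional \<phi> \<psi> (map (\<lambda>(c, d). (star a * c, star b * d)) ys) =
     (\<Sum>(c, d)\<leftarrow>ys. \<phi> (star a * c) * \<psi> (star b * d))"
    by (induction ys) auto
  with Cons show ?case by (simp add: x formal_mult_def formal_star_def)
qed (simp add: formal_mult_def formal_star_def)

lemma product_functional_positive:
  assumes "state \<phi>" "state \<psi>"
  shows "0 \<le> Re (product_functional \<phi> \<psi> (formal_mult (formal_star xs) xs))"
proof -
  let ?a = "\<lambda>i. fst (xs ! i)" and ?b = "\<lambda>i. snd (xs ! i)"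
  have "product_functional \<phi> \<psi> (formal_mult (formal_star xs) xs) =
    (\<Sum>i<length xs. \<Sum>j<length xs. \<phi> (star (?a i) * ?a j) * \<psi> (star (?b i) * ?b j))"
    unfolding product_functional_formal_mult_star sum_list_sum_nth case_prod_beta
    by (simp add: atLeast0LessThan)
  then show ?thesis
    using psd_trace_nonneg[OF _ psd_state[OF assms(1), of "{..<length xs}" ?a]
        psd_state[OF assms(2), of "{..<length xs}" ?b]] by simp
qed

text \<open>Cauchy-Schwarz against the unit: evaluate positivity at \<open>x - \<Phi>(x) (1 \<otimes> 1)\<close>.\<close>

lemma product_functional_Cauchy_Schwarz:
  assumes \<phi>: "state \<phi>" and \<psi>: "state \<psi>"
  shows "(cmod (product_functional \<phi> \<psi> xs))\<^sup>2 \<le>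
    Re (product_functional \<phi> \<psi> (formal_mult (formal_star xs) xs))"
proof -
  let ?F = "product_functional \<phi> \<psi>"
  define z where "z = ?F xs"
  have sp: "(\<Sum>(a, b)\<leftarrow>xs. (\<Sum>(c, d)\<leftarrow>ys. f a b c d) + g a b) =
     (\<Sum>(a, b)\<leftarrow>xs. \<Sum>(c, d)\<leftarrow>ys. f a b c d) + (\<Sum>(a, b)\<leftarrow>xs. g a b)"
    for f :: "'a \<Rightarrow> 'b \<Rightarrow> 'a \<Rightarrow> 'b \<Rightarrow> complex" and g ys
    by (induction xs) auto
  have r: "(\<Sum>(a, b)\<leftarrow>xs. \<phi> (star a * (- z) *\<^sub>C 1) * \<psi> (star b * 1)) = - z * cnj (?F xs)" 
    by (induction xs) (auto simp: mult_scaleC_right state_scaleC[OF \<phi>] state_minus[OF \<phi>] state_star[OF \<phi>] state_star[OF \<psi>] algebra_simps)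
  have l: "(\<Sum>(c, d)\<leftarrow>xs. \<phi> (star ((- z) *\<^sub>C 1) * c) * \<psi> (star 1 * d)) = - cnj z * ?F xs"
    by (induction xs) (auto simp: star_scaleC star_minus mult_scaleC_left state_scaleC[OF \<phi>] state_minus[OF \<phi>] algebra_simps)
  have q: "\<phi> (star ((- z) *\<^sub>C 1) * (- z) *\<^sub>C 1) * \<psi> (star 1 * 1) = cnj z * z"
    by (simp add: star_scaleC star_minus mult_scaleC_left mult_scaleC_right scaleC_scaleC
        state_scaleC[OF \<phi>] state_minus[OF \<phi>] state_one[OF \<phi>] state_one[OF \<psi>])
  have "?F (formal_mult (formal_star (xs @ [((- z) *\<^sub>C 1, 1)])) (xs @ [((- z) *\<^sub>C 1, 1)])) =
      ?F (formal_mult (formal_star xs) xs) - z * cnj z - cnj z * z + cnj z * z"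
    unfolding product_functional_formal_mult_star
    using r l q by (simp add: sp z_def)
  also have "\<dots> = ?F (formal_mult (formal_star xs) xs) - complex_of_real ((cmod z)\<^sup>2)"
    unfolding complex_norm_square by simp
  finally show ?thesis
    using product_functional_positive[OF \<phi> \<psi>, of "xs @ [((- z) *\<^sub>C 1, 1)]"] by (simp add: z_def)
qed

lemma formal_mult_one: "formal_mult xs [(1, 1)] = (xs :: ('a::monoid_mult \<times> 'b::monoid_mult) list)"
  by (induction xs) (auto simp: formal_mult_def)

lemma norm_product_functional_le:
  assumes t: "spatial_tensor_product t" and \<phi>: "state \<phi>" and \<psi>: "state \<psi>"
  shows "cmod (product_functional \<phi> \<psi> xs) \<le> norm (\<Sum>(a, b)\<leftarrow>xs. t a b)"
proof -
  let ?F = "product_functional \<phi> \<psi>"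
  have "ereal (sqrt (Re (?F (formal_mult (formal_star (formal_mult xs [(1, 1)])) (formal_mult xs [(1, 1)])))))
      \<le> spatial_norm xs"
    unfolding spatial_norm_def
    by (rule Sup_upper) (use \<phi> \<psi> in \<open>auto simp: formal_mult_def formal_star_def state_one intro!: exI[of _ "[(1,1)]"] exI[of _ \<phi>] exI[of _ \<psi>]\<close>)
  moreover have "ereal (norm (\<Sum>(a, b)\<leftarrow>xs. t a b)) = spatial_norm xs"
    using t by (simp add: spatial_tensor_product_def)
  ultimately have "sqrt (Re (?F (formal_mult (formal_star xs) xs))) \<le> norm (\<Sum>(a, b)\<leftarrow>xs. t a b)"
    by (metis ereal_less_eq(3) formal_mult_one)
  moreover have "cmod (?F xs) \<le> sqrt (Re (?F (formal_mult (formal_star xs) xs)))"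
    using product_functional_Cauchy_Schwarz[OF \<phi> \<psi>] by (rule real_le_rsqrt)
  ultimately show ?thesis by simp
qed

lemma spatial_tensor_productD:
  assumes "spatial_tensor_product t"
  shows "t a (b + b') = t a b + t a b'" "t a (c *\<^sub>C b) = c *\<^sub>C t a b"
    "t (a + a') b = t a b + t a' b" "t (c *\<^sub>C a) b = c *\<^sub>C t a b"
    "t a b * t a' b' = t (a * a') (b * b')" "star (t a b) = t (star a) (star b)"
    "closure (complex_vector.span {t a b | a b. True}) = UNIV"
proof -
  have l1: "Vector_Spaces.linear scaleC scaleC (t a)" for a using assms by (simp add: spatial_tensor_product_def)
  have l2: "Vector_Spaces.linear scaleC scaleC (\<lambda>a. t a b)" for b using assms by (simp add: spatial_tensor_product_def)
  show "t a (b + b') = t a b + t a b'" "t a (c *\<^sub>C b) = c *\<^sub>C t a b"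
    using l1[of a] unfolding Vector_Spaces.linear_iff by auto
  show "t (a + a') b = t a b + t a' b" "t (c *\<^sub>C a) b = c *\<^sub>C t a b"
    using l2[of b] unfolding Vector_Spaces.linear_iff by auto
  show "t a b * t a' b' = t (a * a') (b * b')" "star (t a b) = t (star a) (star b)"
    "closure (complex_vector.span {t a b | a b. True}) = UNIV"
    using assms by (simp_all add: spatial_tensor_product_def)
qed

lemma tensor_one_one:
  assumes t: "spatial_tensor_product t"
  shows "t 1 1 = 1"
proof -
  note D = spatial_tensor_productD[OF t]
  have "{x. t 1 1 * x = x} = UNIV"
  proof -
    have "closed {x. t 1 1 * x = x}" by (intro closed_Collect_eq continuous_intros)
    moreover have "complex_vector.span {t a b | a b. True} \<subseteq> {x. t 1 1 * x = x}"
    proof (rule complex_vector.span_minimal)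
      show "complex_vector.subspace {x. t 1 1 * x = x}"
        by (rule complex_vector.subspaceI) (auto simp: distrib_left mult_scaleC_right)
    qed (auto simp: D)
    ultimately show ?thesis using closure_minimal D(7) by blast
  qed
  then show ?thesis by (metis (mono_tags) UNIV_I mem_Collect_eq mult.right_neutral)
qed

text \<open>The functional \<open>\<phi> \<otimes> \<psi>\<close> is contractive on the algebraic tensor product by the choice of the spatial
  norm. A norm-preserving extension to the whole algebra is a state, as it takes the value 1 at the unit.\<close>

lemma product_state:
  fixes t :: "'a::unital_cstar_algebra \<Rightarrow> 'b::unital_cstar_algebra \<Rightarrow> 'd::unital_cstar_algebra"
  assumes t: "spatial_tensor_product t" and \<phi>: "state \<phi>" and \<psi>: "state \<psi>"
  obtains \<theta> where "state \<theta>" "\<And>xs. \<theta> (\<Sum>(a, b)\<leftarrow>xs. t a b) = product_functional \<phi> \<psi> xs"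
proof -
  note D = spatial_tensor_productD[OF t]
  let ?F = "product_functional \<phi> \<psi>"
  let ?s = "\<lambda>xs. \<Sum>(a, b)\<leftarrow>xs. t a b"
  have sc: "?s (map (\<lambda>(a, b). (c *\<^sub>C a, b)) xs) = c *\<^sub>C ?s xs" for c xs
    by (induction xs) (auto simp: D scaleC_add_right)
  have Fc: "?F (map (\<lambda>(a, b). (c *\<^sub>C a, b)) xs) = c * ?F xs" for c xs
    by (induction xs) (auto simp: state_scaleC[OF \<phi>] algebra_simps)
  define C where "C = range (\<lambda>xs. (?s xs, Re (?F xs)))"
  obtain f where f: "linear f" "\<And>x. f x \<le> norm x" "\<And>y r. (y, r) \<in> C \<Longrightarrow> f y \<le> r"
  proof (rule Hahn_Banach_cone[of C])
    show "(0, 0) \<in> C" by (auto simp: C_def intro!: image_eqI[of _ _ "[]"])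
    show "(y + z, r + s) \<in> C" if yz: "(y, r) \<in> C" "(z, s) \<in> C" for y r z s
    proof -
      from yz obtain xs ys where "y = ?s xs" "r = Re (?F xs)" "z = ?s ys" "s = Re (?F ys)"
        unfolding C_def by blast
      then show ?thesis unfolding C_def by (intro image_eqI[of _ _ "xs @ ys"]) simp_all
    qed
    show "(r *\<^sub>R y, r * s) \<in> C" if y: "(y, s) \<in> C" for y s r
    proof -
      from y obtain xs where "y = ?s xs" "s = Re (?F xs)" unfolding C_def by blast
      then show ?thesis unfolding C_def
        by (intro image_eqI[of _ _ "map (\<lambda>(a, b). (complex_of_real r *\<^sub>C a, b)) xs"])
          (unfold sc Fc, simp_all add: scaleC_of_real)
    qed
    show "- r \<le> norm y" if "(y, r) \<in> C" for y r
    proof -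
      from that obtain xs where "y = ?s xs" "r = Re (?F xs)" unfolding C_def by blast
      then show ?thesis
        using norm_product_functional_le[OF t \<phi> \<psi>, of xs] abs_Re_le_cmod[of "?F xs"] by simp
    qed
  qed blast
  have le: "f (?s xs) \<le> Re (?F xs)" for xs by (rule f(3)) (simp add: C_def)
  have eq: "f (?s xs) = Re (?F xs)" for xs
    using le[of xs] le[of "map (\<lambda>(a, b). ((- 1) *\<^sub>C a, b)) xs"]
    unfolding sc Fc by (simp add: linear_neg[OF f(1)])
  have "f 1 = 1"
    using eq[of "[(1, 1)]"] by (simp add: tensor_one_one[OF t] state_one[OF \<phi>] state_one[OF \<psi>])
  then have "state (\<lambda>x. Complex (f x) (- f (\<i> *\<^sub>C x)))" by (intro state_of_real_functional f)
  moreover have "Complex (f (?s xs)) (- f (\<i> *\<^sub>C ?s xs)) = ?F xs" for xs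
    using eq[of "map (\<lambda>(a, b). (\<i> *\<^sub>C a, b)) xs"] unfolding sc Fc
    by (simp add: eq complex_eq_iff)
  ultimately show ?thesis by (rule that)
qed

text \<open>The convolution product of states, as far as it is determined on the algebraic tensor product.\<close>

lemma convolution_state:
  fixes tens :: "'c::unital_cstar_algebra \<Rightarrow> 'c \<Rightarrow> 'd::unital_cstar_algebra"
  assumes "spatial_tensor_product tens" "unital_star_hom \<Delta>" "state \<phi>" "state \<psi>"
  obtains \<theta> where "state \<theta>"
    "\<And>a xs. \<Delta> a = (\<Sum>(b, c)\<leftarrow>xs. tens b c) \<Longrightarrow> \<theta> a = product_functional \<phi> \<psi> xs"
proof -
  obtain \<omega> where \<omega>: "state \<omega>" "\<And>xs. \<omega> (\<Sum>(a, b)\<leftarrow>xs. tens a b) = product_functional \<phi> \<psi> xs"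
    using product_state[OF assms(1,3,4)] by blast
  show ?thesis
    by (rule that[of "\<lambda>a. \<omega> (\<Delta> a)"]) (simp_all add: \<omega> state_comp_hom[OF \<omega>(1) assms(2)])
qed

section \<open>Linear algebra in \<open>\<complex>\<^sup>n\<close>\<close>

text \<open>Bolzano-Weierstrass for vectors and matrices whose size is a natural number.\<close>

lemma bounded_family_convergent_subseq:
  fixes X :: "nat \<Rightarrow> 'i \<Rightarrow> complex"
  assumes "finite I" "\<And>m i. i \<in> I \<Longrightarrow> cmod (X m i) \<le> B"
  obtains r Y where "strict_mono r" "\<And>i. i \<in> I \<Longrightarrow> (\<lambda>m. X (r m) i) \<longlonglongrightarrow> Y i"
proof -
  have "\<exists>r Y. strict_mono r \<and> (\<forall>i\<in>I. (\<lambda>m. X (r m) i) \<longlonglongrightarrow> Y i)"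
    using assms
  proof (induction I)
    case empty
    then show ?case using strict_mono_id by auto
  next
    case (insert a I)
    have "\<exists>r Y. strict_mono r \<and> (\<forall>i\<in>I. (\<lambda>m. X (r m) i) \<longlonglongrightarrow> Y i)"
      by (rule insert.IH) (use insert.prems in auto)
    then obtain r Y where r: "strict_mono r" "\<And>i. i \<in> I \<Longrightarrow> (\<lambda>m. X (r m) i) \<longlonglongrightarrow> Y i"
      by blast
    have "bounded (range (\<lambda>m. X (r m) a))"
      using insert.prems by (auto simp: bounded_iff)
    then obtain l s where s: "strict_mono s" "((\<lambda>m. X (r m) a) \<circ> s) \<longlonglongrightarrow> l"
      using bounded_imp_convergent_subsequence by blast
    have "(\<lambda>m. X ((r \<circ> s) m) i) \<longlonglongrightarrow> (Y(a := l)) i" if "i \<in> insert a I" for i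
    proof (cases "i = a")
      case True
      then show ?thesis using s(2) by (simp add: o_def)
    next
      case False
      then show ?thesis using LIMSEQ_subseq_LIMSEQ[OF r(2) s(1), of i] that by (simp add: o_def)
    qed
    moreover have "strict_mono (r \<circ> s)" using r(1) s(1) by (rule strict_mono_o)
    ultimately show ?case by blast
  qed
  then show ?thesis using that by blast
qed

definition average :: "(nat \<Rightarrow> 'i \<Rightarrow> complex) \<Rightarrow> nat \<Rightarrow> 'i \<Rightarrow> complex" where
  "average X m i = (\<Sum>k<Suc m. X k i) / of_nat (Suc m)"

text \<open>Mean ergodic theorem in finite dimension: \<open>average X m\<close> is moved by at most \<open>2 B / (m + 1)\<close> under the
  map that produces the orbit \<open>X\<close>.\<close>

lemma average_fixed_point:
  fixes X :: "nat \<Rightarrow> 'i \<Rightarrow> complex"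
  assumes I: "finite I" and B: "\<And>m i. i \<in> I \<Longrightarrow> cmod (X m i) \<le> B"
    and step: "\<And>m i. i \<in> I \<Longrightarrow> X (Suc m) i = (\<Sum>p\<in>I. X m p * K p i)"
  obtains r Y where "strict_mono r" "\<And>i. i \<in> I \<Longrightarrow> (\<lambda>m. average X (r m) i) \<longlonglongrightarrow> Y i"
    "\<And>i. i \<in> I \<Longrightarrow> (\<Sum>p\<in>I. Y p * K p i) = Y i"
proof -
  have avB: "cmod (average X m i) \<le> B" if "i \<in> I" for m i
  proof -
    have "cmod (\<Sum>k<Suc m. X k i) \<le> (\<Sum>k<Suc m. B)" by (rule sum_norm_le) (use B that in auto)
    then show ?thesis unfolding average_def norm_divide norm_of_nat
      by (simp add: divide_le_eq mult.commute del: sum.lessThan_Suc)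
  qed
  obtain r Y where r: "strict_mono r" "\<And>i. i \<in> I \<Longrightarrow> (\<lambda>m. average X (r m) i) \<longlonglongrightarrow> Y i"
    using bounded_family_convergent_subseq[of I "average X", OF I avB] by blast
  have "(\<Sum>p\<in>I. Y p * K p i) = Y i" if i: "i \<in> I" for i
  proof -
    have lim: "(\<lambda>m. (\<Sum>p\<in>I. average X (r m) p * K p i) - average X (r m) i) \<longlonglongrightarrow> (\<Sum>p\<in>I. Y p * K p i) - Y i"
      by (intro tendsto_intros r i)
    have diff: "(\<Sum>p\<in>I. average X m p * K p i) - average X m i = (X (Suc m) i - X 0 i) / of_nat (Suc m)" for m
    proof -
      have "(\<Sum>p\<in>I. average X m p * K p i) = (\<Sum>p\<in>I. \<Sum>k<Suc m. X k p * K p i) / of_nat (Suc m)"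
        unfolding average_def sum_divide_distrib sum_distrib_right by simp
      also have "(\<Sum>p\<in>I. \<Sum>k<Suc m. X k p * K p i) = (\<Sum>k<Suc m. X (Suc k) i)"
        by (subst sum.swap) (simp add: step[OF i] del: sum.lessThan_Suc)
      finally have "(\<Sum>p\<in>I. average X m p * K p i) - average X m i
          = ((\<Sum>k<Suc m. X (Suc k) i) - (\<Sum>k<Suc m. X k i)) / of_nat (Suc m)"
        by (simp add: average_def diff_divide_distrib del: sum.lessThan_Suc)
      also have "(\<Sum>k<Suc m. X (Suc k) i) - (\<Sum>k<Suc m. X k i) = X (Suc m) i - X 0 i"
        unfolding sum_subtractf[symmetric] by (rule sum_lessThan_telescope)
      finally show ?thesis .
    qed
    have "(\<lambda>m. (X (Suc m) i - X 0 i) / of_nat (Suc m)) \<longlonglongrightarrow> 0"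
    proof (rule Lim_null_comparison)
      show "\<forall>\<^sub>F m in sequentially. cmod ((X (Suc m) i - X 0 i) / of_nat (Suc m)) \<le> 2 * B * inverse (real (Suc m))"
      proof (intro always_eventually allI)
        fix m
        have "cmod (X (Suc m) i - X 0 i) \<le> 2 * B"
          using norm_triangle_ineq4[of "X (Suc m) i" "X 0 i"] B[OF i, of "Suc m"] B[OF i, of 0] by simp
        then show "cmod ((X (Suc m) i - X 0 i) / of_nat (Suc m)) \<le> 2 * B * inverse (real (Suc m))"
          by (simp add: norm_mult norm_inverse norm_of_nat divide_inverse mult_right_mono del: of_nat_Suc)
      qed
      show "(\<lambda>m. 2 * B * inverse (real (Suc m))) \<longlonglongrightarrow> 0"
        by (rule tendsto_mult_right_zero) (rule LIMSEQ_inverse_real_of_nat)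
    qed
    then have "(\<lambda>m. (\<Sum>p\<in>I. average X m p * K p i) - average X m i) \<longlonglongrightarrow> 0" by (simp only: diff)
    from LIMSEQ_subseq_LIMSEQ[OF this r(1)] lim show ?thesis
      using LIMSEQ_unique by (fastforce simp: o_def)
  qed
  with r show ?thesis by (rule that)
qed

lemma average_near:
  assumes X: "\<And>m. cmod (X m i - c) \<le> d" and lim: "(\<lambda>m. average X (r m) i) \<longlonglongrightarrow> y"
  shows "cmod (y - c) \<le> d"
proof (rule LIMSEQ_le_const2)
  show "(\<lambda>m. cmod (average X (r m) i - c)) \<longlonglongrightarrow> cmod (y - c)" by (intro tendsto_intros lim)
  have "cmod (average X m i - c) \<le> d" for m
  proof -
    have "average X m i - c = (\<Sum>k<Suc m. X k i - c) / of_nat (Suc m)"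
      by (simp add: average_def sum_subtractf diff_divide_distrib del: sum.lessThan_Suc of_nat_Suc)
    moreover have "cmod (\<Sum>k<Suc m. X k i - c) \<le> (\<Sum>k<Suc m. d)" by (rule sum_norm_le) (use X in auto)
    ultimately show ?thesis
      by (simp add: norm_divide divide_le_eq mult.commute norm_of_nat del: sum.lessThan_Suc of_nat_Suc)
  qed
  then show "\<exists>N. \<forall>m\<ge>N. cmod (average X (r m) i - c) \<le> d" by blast
qed

definition mat_vec :: "nat \<Rightarrow> (nat \<Rightarrow> nat \<Rightarrow> complex) \<Rightarrow> (nat \<Rightarrow> complex) \<Rightarrow> nat \<Rightarrow> complex" where
  "mat_vec n A x i = (\<Sum>j<n. A i j * x j)"

definition cinner :: "nat \<Rightarrow> (nat \<Rightarrow> complex) \<Rightarrow> (nat \<Rightarrow> complex) \<Rightarrow> complex" where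
  "cinner n x y = (\<Sum>i<n. cnj (x i) * y i)"

definition sqnorm :: "nat \<Rightarrow> (nat \<Rightarrow> complex) \<Rightarrow> real" where
  "sqnorm n x = (\<Sum>i<n. (cmod (x i))\<^sup>2)"

lemma cinner_self: "cinner n x x = complex_of_real (sqnorm n x)"
  unfolding cinner_def sqnorm_def of_real_sum complex_norm_square by (simp add: mult.commute)

lemma sqnorm_nonneg: "0 \<le> sqnorm n x"
  by (simp add: sqnorm_def sum_nonneg)

lemma sqnorm_eq_0: "sqnorm n x = 0 \<Longrightarrow> i < n \<Longrightarrow> x i = 0"
  by (simp add: sqnorm_def sum_nonneg_eq_0_iff)

lemma cmod_le_sqnorm: "i < n \<Longrightarrow> (cmod (x i))\<^sup>2 \<le> sqnorm n x"
  unfolding sqnorm_def by (rule member_le_sum) auto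

lemma sqnorm_scale: "sqnorm n (\<lambda>i. c * x i) = (cmod c)\<^sup>2 * sqnorm n x"
  by (simp add: sqnorm_def norm_mult power_mult_distrib sum_distrib_left)

lemma mat_vec_scale: "mat_vec n A (\<lambda>i. c * x i) = (\<lambda>i. c * mat_vec n A x i)"
  by (simp add: mat_vec_def sum_distrib_left mult_ac fun_eq_iff)

lemma cinner_mat_vec: "cinner n x (mat_vec n A y) = (\<Sum>i<n. \<Sum>j<n. cnj (x i) * y j * A i j)"
  by (simp add: cinner_def mat_vec_def sum_distrib_left mult_ac)

lemma cinner_adjoint: "cinner n x (mat_vec n A y) = cinner n (mat_vec n (\<lambda>i j. cnj (A j i)) x) y"
  unfolding cinner_mat_vec unfolding cinner_def mat_vec_def cnj_sum sum_distrib_right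
  by (subst sum.swap) (simp add: mult_ac)

lemma cinner_Cauchy_Schwarz: "(cmod (cinner n x y))\<^sup>2 \<le> sqnorm n x * sqnorm n y"
proof -
  have "cmod (cinner n x y) \<le> (\<Sum>i<n. cmod (x i) * cmod (y i))"
    unfolding cinner_def by (rule order_trans[OF norm_sum]) (simp add: norm_mult)
  then have "(cmod (cinner n x y))\<^sup>2 \<le> (\<Sum>i<n. cmod (x i) * cmod (y i))\<^sup>2"
    by (simp add: power_mono)
  also have "\<dots> \<le> sqnorm n x * sqnorm n y"
    unfolding sqnorm_def by (rule Cauchy_Schwarz_ineq_sum)
  finally show ?thesis .
qed

text \<open>The unit sphere is compact, so the operator norm of a matrix is attained.\<close>

lemma maximal_vector:
  assumes "i < n" "j < n" "Y i j \<noteq> (0::complex)"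
  obtains l z where "l > 0" "\<And>x. sqnorm n (mat_vec n Y x) \<le> l * sqnorm n x"
    "sqnorm n z = 1" "sqnorm n (mat_vec n Y z) = l"
proof -
  define S where "S = {x. sqnorm n x = 1}"
  define N where "N x = sqnorm n (mat_vec n Y x)" for x
  define M where "M = (\<Sum>i<n. (\<Sum>j<n. cmod (Y i j))\<^sup>2)"
  have le1: "cmod (x k) \<le> 1" if "x \<in> S" "k < n" for x k
    using cmod_le_sqnorm[OF that(2), of x] that(1) by (simp add: S_def power_le_one_iff)
  have bd: "N x \<le> M" if "x \<in> S" for x
    unfolding N_def M_def sqnorm_def
  proof (intro sum_mono power_mono)
    fix i assume "i \<in> {..<n}"
    show "cmod (mat_vec n Y x i) \<le> (\<Sum>j<n. cmod (Y i j))"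
      unfolding mat_vec_def
      by (rule sum_norm_le) (use le1[OF that] in \<open>simp add: norm_mult mult_left_le\<close>)
  qed auto
  let ?e = "\<lambda>k. if k = j then 1 else 0 :: complex"
  have e: "?e \<in> S" using assms(2) by (simp add: S_def sqnorm_def if_distrib[of cmod] if_distrib[of "\<lambda>x. x\<^sup>2"] cong: if_cong)
  have Ne: "N ?e > 0"
  proof -
    have "mat_vec n Y ?e i = Y i j" using assms(2) by (simp add: mat_vec_def if_distrib cong: if_cong)
    then have "(cmod (Y i j))\<^sup>2 \<le> N ?e" using cmod_le_sqnorm[OF assms(1), of "mat_vec n Y ?e"] by (simp add: N_def)
    moreover have "(cmod (Y i j))\<^sup>2 > 0" using assms(3) by simp
    ultimately show ?thesis by linarith
  qed
  define l where "l = (SUP x\<in>S. N x)"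
  have bdd: "bdd_above (N ` S)" using bd by (auto intro!: bdd_aboveI)
  have upper: "N x \<le> l" if "x \<in> S" for x unfolding l_def by (rule cSUP_upper[OF that bdd])
  have "\<exists>x. x \<in> S \<and> l - inverse (real (Suc m)) < N x" for m
    using less_cSUP_iff[OF _ bdd, of "l - inverse (real (Suc m))"] e by (fastforce simp: l_def)
  then obtain X where X: "\<And>m. X m \<in> S" "\<And>m. l - inverse (real (Suc m)) < N (X m)" by metis
  obtain r z where r: "strict_mono r" "\<And>i. i \<in> {..<n} \<Longrightarrow> (\<lambda>m. X (r m) i) \<longlonglongrightarrow> z i"
    using bounded_family_convergent_subseq[of "{..<n}" X 1] le1 X(1) by auto
  have limN: "(\<lambda>m. N (X (r m))) \<longlonglongrightarrow> N z"
    unfolding N_def sqnorm_def mat_vec_def by (intro tendsto_intros r)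
  have "(\<lambda>m. sqnorm n (X (r m))) \<longlonglongrightarrow> sqnorm n z"
    unfolding sqnorm_def by (intro tendsto_intros r)
  then have z1: "sqnorm n z = 1" using X(1) by (simp add: S_def LIMSEQ_const_iff)
  then have zS: "z \<in> S" by (simp add: S_def)
  have "l \<le> N z"
  proof (rule LIMSEQ_le[OF _ limN])
    have "(\<lambda>m. l - inverse (real (Suc m))) \<longlonglongrightarrow> l - 0"
      by (intro tendsto_intros LIMSEQ_inverse_real_of_nat)
    from LIMSEQ_subseq_LIMSEQ[OF this r(1)]
    show "(\<lambda>m. l - inverse (real (Suc (r m)))) \<longlonglongrightarrow> l" by (simp add: o_def)
  qed (use X(2) less_imp_le in blast)
  then have Nz: "N z = l" using upper[OF zS] by simp
  have "l > 0" using upper[OF e] Ne by simp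
  moreover have "sqnorm n (mat_vec n Y x) \<le> l * sqnorm n x" for x
  proof (cases "sqnorm n x = 0")
    case True
    then have "x k = 0" if "k < n" for k using sqnorm_eq_0 that by blast
    then show ?thesis by (simp add: True mat_vec_def sqnorm_def)
  next
    case False
    then have pos: "sqnorm n x > 0" using sqnorm_nonneg[of n x] by simp
    let ?c = "complex_of_real (1 / sqrt (sqnorm n x))"
    have c: "(cmod ?c)\<^sup>2 = 1 / sqnorm n x" using pos by (simp add: norm_divide power_divide)
    have "(\<lambda>i. ?c * x i) \<in> S" unfolding S_def mem_Collect_eq sqnorm_scale c using pos by simp
    from upper[OF this] have "1 / sqnorm n x * sqnorm n (mat_vec n Y x) \<le> l"
      unfolding N_def mat_vec_scale sqnorm_scale c .
    then show ?thesis using pos by (simp add: divide_le_eq)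
  qed
  ultimately show ?thesis using z1 Nz that unfolding N_def by blast
qed

text \<open>The mean ergodic projection of a selfadjoint contraction \<open>T\<close>, a limit of averages of the powers of \<open>T\<close>.\<close>

lemma fixed_space_projection:
  assumes herm: "\<And>i j. i < n \<Longrightarrow> j < n \<Longrightarrow> T j i = cnj (T i j)"
    and contr: "\<And>x. sqnorm n (mat_vec n T x) \<le> sqnorm n x"
  obtains p where "orth_projection n p" "\<And>i j. i < n \<Longrightarrow> j < n \<Longrightarrow> (\<Sum>k<n. T i k * p k j) = p i j"
    "\<And>x i. (\<And>k. k < n \<Longrightarrow> mat_vec n T x k = x k) \<Longrightarrow> i < n \<Longrightarrow> mat_vec n p x i = x i"
proof -
  define X where "X = rec_nat (\<lambda>(i, j). if i = j then 1 else 0 :: complex)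
     (\<lambda>_ A (i, j). \<Sum>q<n. T i q * A (q, j))"
  have X0: "X 0 (i, j) = (if i = j then 1 else 0)" for i j by (simp add: X_def)
  have XS: "X (Suc m) (i, j) = (\<Sum>q<n. T i q * X m (q, j))" for m i j by (simp add: X_def)
  let ?I = "{..<n} \<times> {..<n}"
  let ?K = "\<lambda>(p, q) (i, j). if q = j then T i p else 0"
  have nrm: "sqnorm n (\<lambda>i. X m (i, j)) \<le> 1" if "j < n" for m j
  proof (induction m)
    case 0
    have "(cmod (if i = j then 1 else 0))\<^sup>2 = (if i = j then 1 else 0 :: real)" for i by simp
    then show ?case using that by (simp add: sqnorm_def X0)
  next
    case (Suc m)
    have "(\<lambda>i. X (Suc m) (i, j)) = mat_vec n T (\<lambda>i. X m (i, j))" by (simp add: fun_eq_iff XS mat_vec_def)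
    then show ?case using contr[of "\<lambda>i. X m (i, j)"] Suc by simp
  qed
  have bd: "cmod (X m i) \<le> 1" if "i \<in> ?I" for m i
  proof -
    obtain a b where i: "i = (a, b)" "a < n" "b < n" using \<open>i \<in> ?I\<close> by auto
    then have "(cmod (X m i))\<^sup>2 \<le> 1"
      using cmod_le_sqnorm[of a n "\<lambda>i. X m (i, b)"] nrm[of b m] by simp
    then show ?thesis by (simp add: power_le_one_iff)
  qed
  have kernel: "(\<Sum>p\<in>?I. A p * ?K p (i, j)) = (\<Sum>q<n. T i q * A (q, j))" if "j < n" for A i j
  proof -
    have "(\<Sum>p\<in>?I. A p * ?K p (i, j)) = (\<Sum>q<n. \<Sum>s<n. A (q, s) * (if s = j then T i q else 0))"
      by (simp add: sum.cartesian_product case_prod_beta cong: if_cong)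
    also have "\<dots> = (\<Sum>q<n. T i q * A (q, j))"
      using that by (simp add: if_distrib mult.commute cong: if_cong)
    finally show ?thesis .
  qed
  have step: "X (Suc m) i = (\<Sum>p\<in>?I. X m p * ?K p i)" if "i \<in> ?I" for m i
    using that kernel XS by auto
  obtain r P where r: "strict_mono r" "\<And>i. i \<in> ?I \<Longrightarrow> (\<lambda>m. average X (r m) i) \<longlonglongrightarrow> P i"
    "\<And>i. i \<in> ?I \<Longrightarrow> (\<Sum>p\<in>?I. P p * ?K p i) = P i"
    using average_fixed_point[of ?I X 1 ?K, OF _ bd step] by auto
  define p where "p i j = P (i, j)" for i j
  have Tp: "(\<Sum>k<n. T i k * p k j) = p i j" if "i < n" "j < n" for i j
    using r(3)[of "(i, j)"] kernel[of j P i] that by (simp add: p_def)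
  have comm: "(\<Sum>q<n. X m (i, q) * T q j) = (\<Sum>q<n. T i q * X m (q, j))" if "i < n" "j < n" for m i j
    using that
  proof (induction m arbitrary: i)
    case 0
    then show ?case
      by (simp add: X0 if_distrib[of "\<lambda>y. y * _"] if_distrib[of "\<lambda>y. _ * y"] cong: if_cong)
  next
    case (Suc m)
    have "(\<Sum>q<n. X (Suc m) (i, q) * T q j) = (\<Sum>s<n. T i s * (\<Sum>q<n. X m (s, q) * T q j))"
      unfolding XS sum_distrib_left sum_distrib_right by (subst sum.swap) (simp add: mult.assoc)
    also have "\<dots> = (\<Sum>s<n. T i s * X (Suc m) (s, j))"
      using Suc by (intro sum.cong) (auto simp: XS)
    finally show ?case .
  qed
  have Xherm: "X m (j, i) = cnj (X m (i, j))" if "i < n" "j < n" for m i j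
    using that
  proof (induction m arbitrary: i j)
    case (Suc m)
    have "cnj (X (Suc m) (i, j)) = (\<Sum>q<n. X m (j, q) * T q i)"
      unfolding XS cnj_sum
    proof (intro sum.cong refl)
      fix q assume "q \<in> {..<n}"
      then have "T q i = cnj (T i q)" "X m (j, q) = cnj (X m (q, j))"
        using herm[of i q] Suc.IH[of q j] Suc.prems by (blast, blast)
      then show "cnj (T i q * X m (q, j)) = X m (j, q) * T q i" by simp
    qed
    then show ?case using comm[of j i m] Suc.prems by (simp add: XS)
  qed (simp add: X0)
  have pherm: "p i j = cnj (p j i)" if "i < n" "j < n" for i j
  proof -
    have "average X m (i, j) = cnj (average X m (j, i))" for m
      unfolding average_def using Xherm[OF that(2,1)] by simp
    moreover have "(\<lambda>m. cnj (average X (r m) (j, i))) \<longlonglongrightarrow> cnj (P (j, i))"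
      using that by (intro tendsto_intros r) auto
    ultimately show ?thesis
      using r(2)[of "(i, j)"] that LIMSEQ_unique unfolding p_def by auto
  qed
  have fixp: "mat_vec n p x i = x i" if x: "\<And>k. k < n \<Longrightarrow> mat_vec n T x k = x k" and i: "i < n" for x i
  proof -
    have Xx: "(\<Sum>j<n. X m (i, j) * x j) = x i" if "i < n" for m i
      using that
    proof (induction m arbitrary: i)
      case 0
      then show ?case by (simp add: X0 if_distrib[of "\<lambda>y. y * _"] cong: if_cong)
    next
      case (Suc m)
      have "(\<Sum>j<n. X (Suc m) (i, j) * x j) = (\<Sum>q<n. T i q * (\<Sum>j<n. X m (q, j) * x j))"
        unfolding XS sum_distrib_left sum_distrib_right by (subst sum.swap) (simp add: mult.assoc)
      also have "\<dots> = mat_vec n T x i" using Suc by (simp add: mat_vec_def)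
      finally show ?case using x Suc.prems by simp
    qed
    have "(\<Sum>j<n. average X m (i, j) * x j) = x i" for m
    proof -
      have "(\<Sum>j<n. average X m (i, j) * x j) = (\<Sum>k<Suc m. \<Sum>j<n. X k (i, j) * x j) / of_nat (Suc m)"
        unfolding average_def sum_distrib_right sum_divide_distrib
        by (subst sum.swap) (simp del: sum.lessThan_Suc add: sum_divide_distrib sum_distrib_right)
      also have "\<dots> = x i" by (simp only: Xx[OF i] sum_constant) (simp del: of_nat_Suc)
      finally show ?thesis .
    qed
    moreover have "(\<lambda>m. \<Sum>j<n. average X (r m) (i, j) * x j) \<longlonglongrightarrow> (\<Sum>j<n. P (i, j) * x j)"
      using i by (intro tendsto_intros r) auto
    ultimately show ?thesis by (simp add: mat_vec_def p_def LIMSEQ_const_iff)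
  qed
  have "(\<Sum>k<n. p i k * p k j) = p i j" if "i < n" "j < n" for i j
    using fixp[of "\<lambda>k. p k j" i] Tp that by (simp add: mat_vec_def)
  then have "orth_projection n p" using pherm unfolding orth_projection_def by blast
  then show ?thesis using Tp fixp by (rule that)
qed

text \<open>The projection onto the vectors on which \<open>Y\<close> attains its norm, which is the null space of
  \<open>Q = \<parallel>Y\<parallel>\<^sup>2 - Y\<^sup>* Y\<close>.\<close>

lemma maximal_projection:
  assumes "i < n" "j < n" "Y i j \<noteq> (0::complex)"
  obtains l p where "l > 0" "orth_projection n p" "\<exists>i<n. \<exists>j<n. p i j \<noteq> 0"
    "let Q = (\<lambda>i j. (if i = j then complex_of_real l else 0) - (\<Sum>k<n. cnj (Y k i) * Y k j)) in
       psd {..<n} Q \<and> psd {..<n} (\<lambda>i j. complex_of_real l * Q i j - (\<Sum>k<n. Q i k * Q k j)) \<and>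
       (\<forall>i<n. \<forall>j<n. (\<Sum>k<n. Q i k * p k j) = 0) \<and>
       (\<forall>x. (\<forall>i<n. mat_vec n Q x i = 0) \<longrightarrow> (\<forall>i<n. mat_vec n p x i = x i))"
proof -
  obtain l z where l: "l > 0" "\<And>x. sqnorm n (mat_vec n Y x) \<le> l * sqnorm n x"
    "sqnorm n z = 1" "sqnorm n (mat_vec n Y z) = l" using maximal_vector[of i n j Y, OF assms] by blast
  define Z where "Z i j = (\<Sum>k<n. cnj (Y k i) * Y k j)" for i j
  define Q where "Q i j = (if i = j then complex_of_real l else 0) - Z i j" for i j
  define T where "T i j = Z i j / complex_of_real l" for i j
  have Zh: "Z j i = cnj (Z i j)" for i j by (simp add: Z_def mult.commute)
  have Qh: "Q j i = cnj (Q i j)" for i j by (simp add: Q_def Zh[of j i])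
  have Zv: "mat_vec n Z x = mat_vec n (\<lambda>i j. cnj (Y j i)) (mat_vec n Y x)" for x
    unfolding mat_vec_def Z_def sum_distrib_left sum_distrib_right
    by (rule ext, subst sum.swap) (simp add: mult.assoc)
  have Qv: "mat_vec n Q x i = complex_of_real l * x i - mat_vec n Z x i" if "i < n" for x i
    using that by (simp add: mat_vec_def Q_def left_diff_distrib sum_subtractf if_distrib[of "\<lambda>y. y * _"] cong: if_cong)
  have ZY: "cinner n x (mat_vec n Z x) = complex_of_real (sqnorm n (mat_vec n Y x))" for x
    unfolding Zv cinner_self[symmetric] by (simp add: cinner_adjoint[of n x "\<lambda>i j. cnj (Y j i)"])
  have QY: "cinner n x (mat_vec n Q x) = complex_of_real (l * sqnorm n x - sqnorm n (mat_vec n Y x))" for x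
  proof -
    have "cinner n x (mat_vec n Q x) = complex_of_real l * cinner n x x - cinner n x (mat_vec n Z x)"
      by (simp add: cinner_def Qv right_diff_distrib sum_subtractf sum_distrib_left mult_ac)
    then show ?thesis unfolding ZY cinner_self by simp
  qed
  have Zn: "sqnorm n (mat_vec n Z x) \<le> l * sqnorm n (mat_vec n Y x)" for x
  proof -
    let ?w = "mat_vec n Z x" and ?y = "mat_vec n Y x"
    have "complex_of_real (sqnorm n ?w) = cinner n (mat_vec n Y ?w) ?y"
      unfolding cinner_self[symmetric] by (subst (2) Zv) (simp add: cinner_adjoint[of n ?w])
    then have "(sqnorm n ?w)\<^sup>2 = (cmod (cinner n (mat_vec n Y ?w) ?y))\<^sup>2" by (metis norm_of_real power2_abs)
    also have "\<dots> \<le> sqnorm n (mat_vec n Y ?w) * sqnorm n ?y" by (rule cinner_Cauchy_Schwarz)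
    also have "\<dots> \<le> l * sqnorm n ?w * sqnorm n ?y" by (intro mult_right_mono l sqnorm_nonneg)
    finally have "sqnorm n ?w * sqnorm n ?w \<le> (l * sqnorm n ?y) * sqnorm n ?w"
      by (simp add: power2_eq_square mult_ac)
    then show ?thesis using sqnorm_nonneg[of n ?w] sqnorm_nonneg[of n ?y] l(1)
      by (cases "sqnorm n ?w = 0") auto
  qed
  have Qn: "sqnorm n (mat_vec n Q x) \<le> l * (l * sqnorm n x - sqnorm n (mat_vec n Y x))" for x
  proof -
    have "complex_of_real (sqnorm n (mat_vec n Q x)) = complex_of_real (l\<^sup>2) * cinner n x x
       - complex_of_real l * cinner n x (mat_vec n Z x) - complex_of_real l * cnj (cinner n x (mat_vec n Z x))
       + cinner n (mat_vec n Z x) (mat_vec n Z x)"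
      unfolding cinner_self[symmetric] 
      by (simp add: cinner_def Qv algebra_simps sum_subtractf sum.distrib sum_distrib_left power2_eq_square)
    from arg_cong[OF this[unfolded ZY cinner_self complex_cnj_complex_of_real], of Re]
    have "sqnorm n (mat_vec n Q x) = l\<^sup>2 * sqnorm n x - 2 * l * sqnorm n (mat_vec n Y x) + sqnorm n (mat_vec n Z x)"
      by simp
    then show ?thesis using Zn[of x] by (simp add: power2_eq_square algebra_simps)
  qed
  have psdQ: "psd {..<n} Q"
    unfolding psd_def cinner_mat_vec[symmetric] QY
    by (intro conjI ballI allI) (rule Qh, use l(2) in simp)
  have psdR: "psd {..<n} (\<lambda>i j. complex_of_real l * Q i j - (\<Sum>k<n. Q i k * Q k j))"
    unfolding psd_def
  proof (intro conjI ballI allI)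
    fix i j
    have "cnj (\<Sum>k<n. Q i k * Q k j) = (\<Sum>k<n. Q j k * Q k i)"
      unfolding cnj_sum complex_cnj_mult Qh[symmetric] by (simp add: mult.commute)
    then show "complex_of_real l * Q j i - (\<Sum>k<n. Q j k * Q k i) =
        cnj (complex_of_real l * Q i j - (\<Sum>k<n. Q i k * Q k j))"
      by (simp add: Qh[symmetric])
  next
    fix c
    have "(\<Sum>i<n. \<Sum>j<n. cnj (c i) * c j * (complex_of_real l * Q i j - (\<Sum>k<n. Q i k * Q k j)))
       = complex_of_real l * cinner n c (mat_vec n Q c) - cinner n c (mat_vec n Q (mat_vec n Q c))"
    proof -
      have "cinner n c (mat_vec n Q (mat_vec n Q c)) = (\<Sum>i<n. \<Sum>j<n. cnj (c i) * c j * (\<Sum>k<n. Q i k * Q k j))"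
        unfolding cinner_def mat_vec_def sum_distrib_left
        by (rule sum.cong[OF refl], subst sum.swap) (simp add: mult_ac)
      then show ?thesis
        unfolding cinner_mat_vec by (simp add: right_diff_distrib sum_subtractf sum_distrib_left mult_ac)
    qed
    also have "cinner n c (mat_vec n Q (mat_vec n Q c)) = complex_of_real (sqnorm n (mat_vec n Q c))"
      unfolding cinner_adjoint[of n c Q "mat_vec n Q c"] Qh[symmetric] by (rule cinner_self)
    finally show "0 \<le> Re (\<Sum>i<n. \<Sum>j<n. cnj (c i) * c j * (complex_of_real l * Q i j - (\<Sum>k<n. Q i k * Q k j)))"
      using Qn[of c] by (simp add: QY)
  qed
  have Tv: "mat_vec n T x = (\<lambda>i. complex_of_real (1 / l) * mat_vec n Z x i)" for x
    by (simp add: mat_vec_def T_def sum_divide_distrib fun_eq_iff)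
  have QT: "(mat_vec n Q x i = 0) = (mat_vec n T x i = x i)" if "i < n" for x i
    using l(1) that by (auto simp: Qv Tv field_simps)
  have Tc: "sqnorm n (mat_vec n T x) \<le> sqnorm n x" for x
  proof -
    have "sqnorm n (mat_vec n Z x) \<le> l * (l * sqnorm n x)"
      using Zn[of x] mult_left_mono[OF l(2)[of x], of l] l(1) by linarith
    then show ?thesis unfolding Tv sqnorm_scale using l(1)
      by (simp add: norm_divide power_divide divide_le_eq power2_eq_square mult_ac)
  qed
  have Th: "T j i = cnj (T i j)" for i j unfolding T_def Zh[of j i] by simp
  obtain p where p: "orth_projection n p"
    "\<And>i j. i < n \<Longrightarrow> j < n \<Longrightarrow> (\<Sum>k<n. T i k * p k j) = p i j"
    "\<And>x i. (\<And>k. k < n \<Longrightarrow> mat_vec n T x k = x k) \<Longrightarrow> i < n \<Longrightarrow> mat_vec n p x i = x i"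
    by (rule fixed_space_projection[of n T, OF Th Tc]) blast
  have "sqnorm n (mat_vec n Q z) \<le> 0" using Qn[of z] l by simp
  then have "sqnorm n (mat_vec n Q z) = 0" using sqnorm_nonneg[of n "mat_vec n Q z"] by simp
  then have pz: "mat_vec n p z i = z i" if "i < n" for i
    using p(3)[of z i] QT sqnorm_eq_0 that by blast
  have "\<exists>i<n. \<exists>j<n. p i j \<noteq> 0"
  proof (rule ccontr)
    assume "\<not> ?thesis"
    then have "mat_vec n p z i = 0" if "i < n" for i
      using that by (auto simp: mat_vec_def intro!: sum.neutral)
    then have "z i = 0" if "i < n" for i using pz that by metis
    then show False using l(3) by (simp add: sqnorm_def)
  qed
  moreover have "(\<Sum>k<n. Q i k * p k j) = 0" if "i < n" "j < n" for i j
    using QT[of i "\<lambda>k. p k j"] p(2)[of i j] that by (simp add: mat_vec_def)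
  moreover have "mat_vec n p x i = x i" if "\<forall>i<n. mat_vec n Q x i = 0" "i < n" for x i
    using p(3)[of x i] QT that by blast
  ultimately show ?thesis
    using that[of l p] l(1) p(1) psdQ psdR unfolding Let_def Q_def Z_def by blast
qed

section \<open>Representations that are close to each other\<close>

lemma unitary_repD:
  assumes "unitary_rep tens \<Delta> n u" "i < n" "j < n"
  shows "\<Delta> (u i j) = (\<Sum>k<n. tens (u i k) (u k j))"
    "(\<Sum>k<n. star (u k i) * u k j) = (if i = j then 1 else 0)"
    "(\<Sum>k<n. u i k * star (u j k)) = (if i = j then 1 else 0)"
  using assms by (auto simp: unitary_rep_def)

lemma sum_list_product:
  "(\<Sum>x\<leftarrow>List.product [0..<n] [0..<n]. g x) = (\<Sum>p<n. \<Sum>q<n. g (p, q) :: 'a::comm_monoid_add)"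
proof -
  have "(\<Sum>x\<leftarrow>List.product [0..<n] [0..<n]. g x) = sum g ({..<n} \<times> {..<n})"
    by (subst sum.distinct_set_conv_list[symmetric]) (simp_all add: distinct_product atLeast0LessThan)
  then show ?thesis by (simp add: sum.cartesian_product)
qed

lemma state_column_le_1:
  assumes g: "state g" and v: "unitary_rep tens \<Delta> n v" and "k < n" "i < n"
  shows "Re (g (star (v k i) * v k i)) \<le> 1"
proof -
  have "Re (g (star (v k i) * v k i)) \<le> (\<Sum>k<n. Re (g (star (v k i) * v k i)))"
    by (rule member_le_sum) (use assms state_nonneg_Re[OF g] in auto)
  also have "\<dots> = Re (g (\<Sum>k<n. star (v k i) * v k i))" by (simp add: state_sum[OF g])
  also have "\<dots> = 1" using unitary_repD(2)[OF v assms(4,4)] by (simp add: state_one[OF g])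
  finally show ?thesis .
qed

text \<open>The matrix \<open>Y\<close> is a limit of means of the matrices with entries \<open>g ((v\<^sup>* u)\<^sub>i\<^sub>j)\<close>, where \<open>g\<close> runs over the orbit
  of a state under convolution with \<open>f\<close>. Each \<open>g\<close> is itself a state, so the distance of these matrices from
  the identity matrix \<open>v\<^sup>* v\<close> is controlled by \<open>v\<^sup>* (u - v)\<close>, uniformly along the orbit.\<close>

lemma averaged_matrix:
  fixes tens :: "'c::unital_cstar_algebra \<Rightarrow> 'c \<Rightarrow> 'd::unital_cstar_algebra"
  assumes tens: "spatial_tensor_product tens" and hom: "unital_star_hom \<Delta>"
    and u: "unitary_rep tens \<Delta> n u" and v: "unitary_rep tens \<Delta> n v" and f: "state f"
    and close: "\<And>i j. i < n \<Longrightarrow> j < n \<Longrightarrow> norm (u i j - v i j) \<le> e"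
  obtains Y where
    "\<And>i j. i < n \<Longrightarrow> j < n \<Longrightarrow> (\<Sum>k<n. \<Sum>l<n. Y k l * f (star (v k i) * u l j)) = Y i j"
    "\<And>i j. i < n \<Longrightarrow> j < n \<Longrightarrow> cmod (Y i j - (if i = j then 1 else 0)) \<le> real n * e"
proof -
  note T = spatial_tensor_productD[OF tens]
  define xs where "xs k i l j = map (\<lambda>(p, q). (star (v k p) * u l q, star (v p i) * u q j))
      (List.product [0..<n] [0..<n])" for k i l j
  have comult: "\<Delta> (star (v k i) * u l j) = (\<Sum>(a, b)\<leftarrow>xs k i l j. tens a b)"
    if "k < n" "i < n" "l < n" "j < n" for k i l j
  proof -
    have "\<Delta> (star (v k i) * u l j) =
        (\<Sum>p<n. \<Sum>q<n. tens (star (v k p) * u l q) (star (v p i) * u q j))"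
      using that by (simp add: unital_star_homD[OF hom] unitary_repD(1)[OF u] unitary_repD(1)[OF v]
          star_sum T sum_product)
    also have "\<dots> = (\<Sum>(a, b)\<leftarrow>xs k i l j. tens a b)"
      unfolding xs_def by (simp add: sum_list_product o_def case_prod_beta)
    finally show ?thesis .
  qed
  have "\<exists>g. \<forall>m. state (g m) \<and> (\<forall>a xs. \<Delta> a = (\<Sum>(b, c)\<leftarrow>xs. tens b c) \<longrightarrow>
      g (Suc m) a = product_functional (g m) f xs)"
    by (rule dependent_nat_choice) (use f convolution_state[OF tens hom _ f] in metis)+
  then obtain g where g: "\<And>m. state (g m)"
    "\<And>m a xs. \<Delta> a = (\<Sum>(b, c)\<leftarrow>xs. tens b c) \<Longrightarrow> g (Suc m) a = product_functional (g m) f xs"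
    by blast
  define X where "X m = (\<lambda>(i, j). \<Sum>k<n. g m (star (v k i) * u k j))" for m
  let ?I = "{..<n} \<times> {..<n}"
  let ?K = "\<lambda>(p, q) (i, j). f (star (v p i) * u q j)"
  have step: "X (Suc m) (i, j) = (\<Sum>p\<in>?I. X m p * ?K p (i, j))" if "i < n" "j < n" for m i j
  proof -
    have "X (Suc m) (i, j) = (\<Sum>k<n. \<Sum>p<n. \<Sum>q<n. g m (star (v k p) * u k q) * f (star (v p i) * u q j))"
      unfolding X_def prod.case
    proof (intro sum.cong refl)
      fix k assume "k \<in> {..<n}"
      then have "g (Suc m) (star (v k i) * u k j) = product_functional (g m) f (xs k i k j)"
        using comult that by (intro g(2)) auto
      then show "g (Suc m) (star (v k i) * u k j) =
          (\<Sum>p<n. \<Sum>q<n. g m (star (v k p) * u k q) * f (star (v p i) * u q j))"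
        by (simp add: product_functional_def xs_def sum_list_product o_def case_prod_beta)
    qed
    also have "\<dots> = (\<Sum>p<n. \<Sum>q<n. \<Sum>k<n. g m (star (v k p) * u k q) * f (star (v p i) * u q j))"
      by (subst sum.swap, rule sum.cong[OF refl], rule sum.swap)
    also have "\<dots> = (\<Sum>p<n. \<Sum>q<n. X m (p, q) * f (star (v p i) * u q j))"
      by (simp add: X_def sum_distrib_right)
    finally show ?thesis by (simp add: sum.cartesian_product case_prod_beta)
  qed
  have near: "cmod (X m (i, j) - (if i = j then 1 else 0)) \<le> real n * e" if "i < n" "j < n" for m i j
  proof -
    have "(if i = j then 1 else 0) = g m (\<Sum>k<n. star (v k i) * v k j)"
      using that unitary_repD(2)[OF v] by (simp add: state_one[OF g(1)] state_zero[OF g(1)])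
    then have "X m (i, j) - (if i = j then 1 else 0) = (\<Sum>k<n. g m (star (v k i) * (u k j - v k j)))"
      by (simp add: X_def state_sum[OF g(1)] right_diff_distrib state_diff[OF g(1)] sum_subtractf)
    also have "cmod \<dots> \<le> (\<Sum>k<n. e)"
    proof (rule sum_norm_le)
      fix k assume "k \<in> {..<n}"
      then have k: "k < n" by simp
      let ?d = "u k j - v k j"
      have "(cmod (g m (star (v k i) * ?d)))\<^sup>2 \<le> Re (g m (star (v k i) * v k i)) * Re (g m (star ?d * ?d))"
        by (rule state_Cauchy_Schwarz[OF g(1)])
      also have "\<dots> \<le> 1 * (norm ?d)\<^sup>2"
        by (intro mult_mono state_column_le_1[OF g(1) v k that(1)] state_star_mult_self_le[OF g(1)]
            state_nonneg_Re[OF g(1)]) auto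
      finally have "cmod (g m (star (v k i) * ?d)) \<le> norm ?d" by (simp add: power2_le_iff_abs_le)
      with close[OF k that(2)] show "cmod (g m (star (v k i) * ?d)) \<le> e" by simp
    qed
    finally show ?thesis by simp
  qed
  have bd: "cmod (X m i) \<le> real n * e + 1" if "i \<in> ?I" for m i
  proof -
    obtain a b where i: "i = (a, b)" "a < n" "b < n" using \<open>i \<in> ?I\<close> by auto
    have "cmod (X m (a, b)) \<le> cmod (X m (a, b) - (if a = b then 1 else 0)) + cmod (if a = b then 1 else 0)"
      by (metis diff_add_cancel norm_triangle_ineq)
    also have "\<dots> \<le> real n * e + 1" by (rule add_mono[OF near[OF i(2,3)]]) simp
    finally show ?thesis using i by simp
  qed
  have step': "X (Suc m) i = (\<Sum>p\<in>?I. X m p * ?K p i)" if "i \<in> ?I" for m i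
    using that by (elim SigmaE) (use step in simp)
  have fin: "finite ?I" by simp
  obtain r P where r: "strict_mono r" "\<And>i. i \<in> ?I \<Longrightarrow> (\<lambda>m. average X (r m) i) \<longlonglongrightarrow> P i"
    "\<And>i. i \<in> ?I \<Longrightarrow> (\<Sum>p\<in>?I. P p * ?K p i) = P i"
  proof (rule average_fixed_point[of ?I X "real n * e + 1" ?K, OF fin bd step'])
    fix r Y
    assume *: "strict_mono r" "\<And>i. i \<in> ?I \<Longrightarrow> (\<lambda>m. average X (r m) i) \<longlonglongrightarrow> Y i"
      "\<And>i. i \<in> ?I \<Longrightarrow> (\<Sum>p\<in>?I. Y p * ?K p i) = Y i"
    show thesis by (rule that[OF *])
  qed
  show ?thesis
  proof (rule that[of "\<lambda>i j. P (i, j)"])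
    fix i j assume ij: "i < n" "j < n"
    show "(\<Sum>k<n. \<Sum>l<n. P (k, l) * f (star (v k i) * u l j)) = P (i, j)"
      using r(3)[of "(i, j)"] ij by (simp add: sum.cartesian_product case_prod_beta)
    show "cmod (P (i, j) - (if i = j then 1 else 0)) \<le> real n * e"
      by (rule average_near[OF near[OF ij] r(2)]) (use ij in auto)
  qed
qed

lemma state_combination:
  assumes f: "state f"
  shows "f (star (\<Sum>k\<in>I. a k *\<^sub>C x k) * (\<Sum>l\<in>J. b l *\<^sub>C z l)) =
    (\<Sum>k\<in>I. \<Sum>l\<in>J. cnj (a k) * b l * f (star (x k) * z l))"
  by (simp add: star_sum sum_product star_scaleC mult_scaleC_left mult_scaleC_right state_sum[OF f]
      state_scaleC[OF f] mult_ac)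

lemma sum_swap_pairs:
  "(\<Sum>i\<in>A. \<Sum>k\<in>B. \<Sum>a\<in>C. \<Sum>j\<in>D. F i k a j) =
   (\<Sum>a\<in>C. \<Sum>j\<in>D. \<Sum>i\<in>A. \<Sum>k\<in>B. F i k a j :: 'b::comm_monoid_add)"
proof -
  have "(\<Sum>i\<in>A. \<Sum>k\<in>B. \<Sum>a\<in>C. \<Sum>j\<in>D. F i k a j) = (\<Sum>i\<in>A. \<Sum>a\<in>C. \<Sum>j\<in>D. \<Sum>k\<in>B. F i k a j)"
    by (intro sum.cong refl, subst sum.swap, intro sum.cong refl, subst sum.swap, rule refl)
  also have "\<dots> = (\<Sum>a\<in>C. \<Sum>j\<in>D. \<Sum>i\<in>A. \<Sum>k\<in>B. F i k a j)"
    by (subst sum.swap, intro sum.cong refl, subst sum.swap, rule refl)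
  finally show ?thesis .
qed

lemma state_orthonormal_columns:
  assumes f: "state f"
    and w: "\<And>i j. i < n \<Longrightarrow> j < n \<Longrightarrow> (\<Sum>k<n. star (w k i) * w k j) = (if i = j then 1 else 0)"
  shows "(\<Sum>i<n. f (star (\<Sum>k<n. a k *\<^sub>C w i k) * (\<Sum>k<n. b k *\<^sub>C w i k))) = cinner n a b"
proof -
  have "(\<Sum>i<n. f (star (\<Sum>k<n. a k *\<^sub>C w i k) * (\<Sum>k<n. b k *\<^sub>C w i k))) =
     (\<Sum>k<n. \<Sum>l<n. \<Sum>i<n. cnj (a k) * b l * f (star (w i k) * w i l))"
    unfolding state_combination[OF f]
    by (subst sum.swap, rule sum.cong[OF refl], rule sum.swap)
  also have "\<dots> = (\<Sum>k<n. \<Sum>l<n. cnj (a k) * b l * f (\<Sum>i<n. star (w i k) * w i l))"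
    by (simp add: state_sum[OF f] sum_distrib_left)
  also have "\<dots> = (\<Sum>k<n. \<Sum>l<n. cnj (a k) * b l * (if k = l then 1 else 0))"
    by (intro sum.cong refl) (simp add: w state_one[OF f] state_zero[OF f])
  also have "\<dots> = cinner n a b"
    by (simp add: cinner_def if_distrib cong: if_cong)
  finally show ?thesis .
qed

lemma sum_states_nonpos:
  assumes f: "state f" and le: "Re (\<Sum>i<n. f (star (x i) * x i)) \<le> 0" and i: "i < (n::nat)"
  shows "f (star (x i) * x i) = 0"
proof -
  have "Re (f (star (x i) * x i)) \<le> (\<Sum>i<n. Re (f (star (x i) * x i)))"
    by (rule member_le_sum) (use i state_nonneg_Re[OF f] in auto)
  then show ?thesis using le state_square_eq_0_iff[OF f] by simp
qed

text \<open>For \<open>z\<close> in the null space of \<open>Q = l - Y\<^sup>* Y\<close> put \<open>x = u z\<close>, \<open>s = v Y z\<close> and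
  \<open>t = Y u z\<close>. As \<open>Y\<close> is fixed by \<open>Y \<mapsto> (f \<otimes> id)(v\<^sup>* Y u)\<close>, the sum \<open>\<Sum>\<^sub>i f ((s\<^sub>i - t\<^sub>i)\<^sup>* (s\<^sub>i - t\<^sub>i))\<close> is
  minus the sum of the \<open>Q\<^sub>k\<^sub>l f (x\<^sub>k\<^sup>* x\<^sub>l)\<close>. The former is nonnegative because \<open>f\<close> is a state, the latter because
  \<open>Q\<close> is positive semidefinite; so both vanish. The first gives \<open>s = t\<close>, the second \<open>Q x = 0\<close>.\<close>

lemma fixed_matrix_intertwines_on_null_space:
  fixes u v :: "nat \<Rightarrow> nat \<Rightarrow> 'c::unital_cstar_algebra"
  assumes f: "state f"
    and faithful: "\<And>x. x \<in> complex_vector.span {w i j | w i j. w \<in> {u, v} \<and> i < n \<and> j < n} \<Longrightarrow>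
      f (star x * x) = 0 \<Longrightarrow> x = 0"
    and u: "\<And>i j. i < n \<Longrightarrow> j < n \<Longrightarrow> (\<Sum>k<n. star (u k i) * u k j) = (if i = j then 1 else 0)"
    and v: "\<And>i j. i < n \<Longrightarrow> j < n \<Longrightarrow> (\<Sum>k<n. star (v k i) * v k j) = (if i = j then 1 else 0)"
    and fixed: "\<And>i j. i < n \<Longrightarrow> j < n \<Longrightarrow> (\<Sum>k<n. \<Sum>l<n. Y k l * f (star (v k i) * u l j)) = Y i j"
    and Q_def: "\<And>i j. Q i j = (if i = j then complex_of_real l else 0) - (\<Sum>k<n. cnj (Y k i) * Y k j)"
    and psdQ: "psd {..<n} Q"
    and psdR: "psd {..<n} (\<lambda>i j. complex_of_real l * Q i j - (\<Sum>k<n. Q i k * Q k j))"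
    and z: "\<And>i. i < n \<Longrightarrow> mat_vec n Q z i = 0"
  defines "x \<equiv> \<lambda>i. \<Sum>j<n. z j *\<^sub>C u i j"
  shows "\<And>i. i < n \<Longrightarrow> (\<Sum>k<n. mat_vec n Y z k *\<^sub>C v i k) = (\<Sum>k<n. Y i k *\<^sub>C x k)"
    and "\<And>i. i < n \<Longrightarrow> (\<Sum>k<n. Q i k *\<^sub>C x k) = 0"
proof -
  let ?S = "complex_vector.span {w i j | w i j. w \<in> {u, v} \<and> i < n \<and> j < n}"
  define y where "y = mat_vec n Y z"
  define s where "s i = (\<Sum>k<n. y k *\<^sub>C v i k)" for i
  define t where "t i = (\<Sum>k<n. Y i k *\<^sub>C x k)" for i
  define P where "P k l = f (star (x k) * x l)" for k l
  define B where "B = (\<Sum>i<n. \<Sum>j<n. P i j * Q i j)"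
  have inS: "u i j \<in> ?S" "v i j \<in> ?S" if "i < n" "j < n" for i j
    using that by (auto intro!: complex_vector.span_base)
  have xS: "x i \<in> ?S" "s i \<in> ?S" if "i < n" for i
    unfolding x_def s_def using that by (intro complex_vector.span_sum complex_vector.span_scale inS; simp)+
  have combS: "(\<Sum>k<n. c k *\<^sub>C x k) \<in> ?S" for c
    by (intro complex_vector.span_sum complex_vector.span_scale xS) simp
  have psdP: "psd {..<n} P" unfolding P_def by (rule psd_state[OF f]) simp
  have cyy: "cinner n y y = complex_of_real (sqnorm n y)" by (rule cinner_self)
  have ss: "(\<Sum>i<n. f (star (s i) * s i)) = cinner n y y"
    unfolding s_def by (rule state_orthonormal_columns[OF f v])
  have xx: "(\<Sum>i<n. P i i) = cinner n z z"
    unfolding P_def x_def by (rule state_orthonormal_columns[OF f u])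
  have st: "(\<Sum>i<n. f (star (s i) * t i)) = cinner n y y"
  proof -
    have "f (star (s i) * t i) = (\<Sum>k<n. \<Sum>a<n. \<Sum>j<n. cnj (y a) * z j * (Y i k * f (star (v i a) * u k j)))" for i
    proof -
      have "f (star (s i) * t i) = (\<Sum>k<n. Y i k * f (star (s i) * x k))"
        by (simp add: t_def sum_distrib_left mult_scaleC_right state_sum[OF f] state_scaleC[OF f])
      also have "\<dots> = (\<Sum>k<n. \<Sum>a<n. \<Sum>j<n. cnj (y a) * z j * (Y i k * f (star (v i a) * u k j)))"
        unfolding s_def x_def state_combination[OF f] by (simp only: sum_distrib_left mult_ac)
      finally show ?thesis .
    qed
    then have "(\<Sum>i<n. f (star (s i) * t i)) =
      (\<Sum>i<n. \<Sum>k<n. \<Sum>a<n. \<Sum>j<n. cnj (y a) * z j * (Y i k * f (star (v i a) * u k j)))" by simp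
    also have "\<dots> = (\<Sum>a<n. \<Sum>j<n. cnj (y a) * z j * (\<Sum>i<n. \<Sum>k<n. Y i k * f (star (v i a) * u k j)))"
      unfolding sum_distrib_left by (rule sum_swap_pairs)
    also have "\<dots> = (\<Sum>a<n. \<Sum>j<n. cnj (y a) * z j * Y a j)"
      by (intro sum.cong refl arg_cong2[of _ _ _ _ "(*)"] fixed) auto
    also have "\<dots> = cinner n y (mat_vec n Y z)" by (simp add: cinner_mat_vec)
    finally show ?thesis by (simp add: y_def)
  qed
  have tt: "(\<Sum>i<n. f (star (t i) * t i)) = cinner n y y - B"
  proof -
    have "(\<Sum>i<n. f (star (t i) * t i)) = (\<Sum>k<n. \<Sum>j<n. \<Sum>i<n. cnj (Y i k) * Y i j * P k j)"
      unfolding t_def state_combination[OF f] P_def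
      by (subst sum.swap, rule sum.cong[OF refl], rule sum.swap)
    also have "\<dots> = (\<Sum>k<n. \<Sum>j<n. (if k = j then complex_of_real l else 0) * P k j - P k j * Q k j)"
      by (intro sum.cong refl) (simp add: Q_def sum_distrib_left sum_distrib_right algebra_simps)
    also have "\<dots> = complex_of_real l * cinner n z z - B"
      by (simp add: B_def sum_subtractf xx[symmetric] sum_distrib_left if_distrib[of "\<lambda>y. y * _"] cong: if_cong)
    also have "complex_of_real l * cinner n z z = cinner n y y"
    proof -
      have "cinner n y y = cinner n z (mat_vec n (\<lambda>i j. cnj (Y j i)) y)"
        unfolding cinner_adjoint by (simp add: y_def)
      also have "\<dots> = (\<Sum>i<n. cnj (z i) * (complex_of_real l * z i))"
        unfolding cinner_def
      proof (intro sum.cong refl arg_cong2[of _ _ _ _ "(*)"])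
        fix i assume "i \<in> {..<n}"
        then have i: "i < n" by simp
        have "mat_vec n (\<lambda>i j. cnj (Y j i)) y i = (\<Sum>j<n. (\<Sum>k<n. cnj (Y k i) * Y k j) * z j)"
          unfolding mat_vec_def y_def sum_distrib_left sum_distrib_right
          by (subst sum.swap) (simp add: mult.assoc)
        also have "\<dots> = complex_of_real l * z i - mat_vec n Q z i"
          using i by (simp add: mat_vec_def Q_def left_diff_distrib sum_subtractf if_distrib[of "\<lambda>y. y * _"] cong: if_cong)
        finally show "mat_vec n (\<lambda>i j. cnj (Y j i)) y i = complex_of_real l * z i" using z[OF i] by simp
      qed
      also have "\<dots> = complex_of_real l * cinner n z z" by (simp add: cinner_def sum_distrib_left mult_ac)
      finally show ?thesis ..
    qed
    finally show ?thesis .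
  qed
  have "(\<Sum>i<n. f (star (s i - t i) * (s i - t i))) = - B"
  proof -
    have "(\<Sum>i<n. f (star (s i - t i) * (s i - t i))) =
      (\<Sum>i<n. f (star (s i) * s i)) - (\<Sum>i<n. f (star (s i) * t i))
      - cnj (\<Sum>i<n. f (star (s i) * t i)) + (\<Sum>i<n. f (star (t i) * t i))"
      unfolding cnj_sum state_star_mult[OF f, symmetric] sum_subtractf[symmetric] sum.distrib[symmetric]
      by (simp add: star_diff algebra_simps state_diff[OF f] state_add[OF f])
    then show ?thesis unfolding ss st tt by (simp add: cyy)
  qed
  moreover have B0: "0 \<le> Re B" unfolding B_def by (rule psd_trace_nonneg[OF _ psdP psdQ]) simp
  ultimately have le: "Re (\<Sum>i<n. f (star (s i - t i) * (s i - t i))) \<le> 0" by simp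
  have "s i = t i" if "i < n" for i
  proof -
    have "s i - t i \<in> ?S" unfolding t_def
      by (rule complex_vector.span_diff[OF xS(2)[OF that] combS])
    then have "s i - t i = 0" using sum_states_nonpos[OF f le that] by (rule faithful)
    then show ?thesis by simp
  qed
  then show "\<And>i. i < n \<Longrightarrow> (\<Sum>k<n. mat_vec n Y z k *\<^sub>C v i k) = (\<Sum>k<n. Y i k *\<^sub>C x k)"
    by (simp add: s_def t_def y_def)
  have "0 \<le> Re (\<Sum>i<n. f (star (s i - t i) * (s i - t i)))"
    by (simp add: sum_nonneg state_nonneg_Re[OF f])
  then have RB: "Re B = 0" using \<open>(\<Sum>i<n. f (star (s i - t i) * (s i - t i))) = - B\<close> B0 by simp
  \<comment> \<open>since \<open>Q\<^sup>2 \<le> l Q\<close>, the form of \<open>Q\<^sup>2\<close>, which is \<open>\<Sum>\<^sub>i f (w\<^sub>i\<^sup>* w\<^sub>i)\<close>, vanishes along with that of \<open>Q\<close>\<close>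
  define w where "w i = (\<Sum>k<n. Q i k *\<^sub>C x k)" for i
  have "(\<Sum>i<n. f (star (w i) * w i)) = (\<Sum>k<n. \<Sum>j<n. \<Sum>i<n. cnj (Q i k) * Q i j * P k j)"
    unfolding w_def state_combination[OF f] P_def
    by (subst sum.swap, rule sum.cong[OF refl], rule sum.swap)
  also have "\<dots> = (\<Sum>k<n. \<Sum>j<n. P k j * (\<Sum>i<n. Q k i * Q i j))"
    unfolding sum_distrib_left
    by (intro sum.cong refl) (simp add: psd_hermitian[OF psdQ, symmetric] mult_ac)
  finally have ww: "(\<Sum>i<n. f (star (w i) * w i)) = (\<Sum>k<n. \<Sum>j<n. P k j * (\<Sum>i<n. Q k i * Q i j))" .
  have "0 \<le> Re (\<Sum>k<n. \<Sum>j<n. P k j * (complex_of_real l * Q k j - (\<Sum>i<n. Q k i * Q i j)))"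
    by (rule psd_trace_nonneg[OF _ psdP psdR]) simp
  also have "(\<Sum>k<n. \<Sum>j<n. P k j * (complex_of_real l * Q k j - (\<Sum>i<n. Q k i * Q i j))) =
      complex_of_real l * B - (\<Sum>i<n. f (star (w i) * w i))"
    unfolding ww B_def by (simp add: right_diff_distrib sum_subtractf sum_distrib_left mult_ac)
  finally have le: "Re (\<Sum>i<n. f (star (w i) * w i)) \<le> 0" by (simp add: RB)
  have "w i = 0" if "i < n" for i
    by (rule faithful[OF _ sum_states_nonpos[OF f le that]]) (unfold w_def, rule combS)
  then show "\<And>i. i < n \<Longrightarrow> (\<Sum>k<n. Q i k *\<^sub>C x k) = 0" by (simp add: w_def)
qed

text \<open>The range of \<open>p\<close> is therefore invariant under \<open>u\<close>. If \<open>u\<close> is irreducible then \<open>p = 1\<close>, hence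
  \<open>Y\<^sup>* Y = l\<close> and \<open>v Y = Y u\<close>; then \<open>Y Y\<^sup>* = l\<close> too, and the traces of \<open>v\<close> and \<open>u\<close> agree.\<close>

lemma rep_character_eq_of_fixed_matrix:
  fixes tens :: "'c::unital_cstar_algebra \<Rightarrow> 'c \<Rightarrow> 'd::unital_cstar_algebra"
  assumes irr: "irreducible_unitary_rep tens \<Delta> n u" and v: "unitary_rep tens \<Delta> n v" and f: "state f"
    and faithful: "\<And>x. x \<in> complex_vector.span {w i j | w i j. w \<in> {u, v} \<and> i < n \<and> j < n} \<Longrightarrow>
      f (star x * x) = 0 \<Longrightarrow> x = 0"
    and fixed: "\<And>i j. i < n \<Longrightarrow> j < n \<Longrightarrow> (\<Sum>k<n. \<Sum>l<n. Y k l * f (star (v k i) * u l j)) = Y i j"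
    and nonzero: "i\<^sub>0 < n" "j\<^sub>0 < n" "Y i\<^sub>0 j\<^sub>0 \<noteq> 0"
  shows "rep_character n v = rep_character n u"
proof -
  have u: "unitary_rep tens \<Delta> n u" using irr by (simp add: irreducible_unitary_rep_def)
  define Z where "Z i j = (\<Sum>k<n. cnj (Y k i) * Y k j)" for i j
  obtain l p where l: "l > 0" and p: "orth_projection n p" "\<exists>i<n. \<exists>j<n. p i j \<noteq> 0"
    and Qp: "let Q = (\<lambda>i j. (if i = j then complex_of_real l else 0) - (\<Sum>k<n. cnj (Y k i) * Y k j)) in
       psd {..<n} Q \<and> psd {..<n} (\<lambda>i j. complex_of_real l * Q i j - (\<Sum>k<n. Q i k * Q k j)) \<and>
       (\<forall>i<n. \<forall>j<n. (\<Sum>k<n. Q i k * p k j) = 0) \<and>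
       (\<forall>x. (\<forall>i<n. mat_vec n Q x i = 0) \<longrightarrow> (\<forall>i<n. mat_vec n p x i = x i))"
    using maximal_projection[of i\<^sub>0 n j\<^sub>0 Y, OF nonzero] by blast
  define Q where "Q i j = (if i = j then complex_of_real l else 0) - (\<Sum>k<n. cnj (Y k i) * Y k j)" for i j
  have Q: "psd {..<n} Q" "psd {..<n} (\<lambda>i j. complex_of_real l * Q i j - (\<Sum>k<n. Q i k * Q k j))"
    "\<And>i j. i < n \<Longrightarrow> j < n \<Longrightarrow> (\<Sum>k<n. Q i k * p k j) = 0"
    "\<And>x i. (\<And>i. i < n \<Longrightarrow> mat_vec n Q x i = 0) \<Longrightarrow> i < n \<Longrightarrow> mat_vec n p x i = x i"
    using Qp unfolding Let_def Q_def by blast+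
  note key = fixed_matrix_intertwines_on_null_space[OF f faithful unitary_repD(2)[OF u]
      unitary_repD(2)[OF v] fixed Q_def Q(1,2)]
  let ?S = "complex_vector.span {w i j | w i j. w \<in> {u, v} \<and> i < n \<and> j < n}"
  have "invariant_subspace n u p"
    unfolding invariant_subspace_def
  proof (intro conjI p(1) allI impI)
    fix i j assume ij: "i < n" "j < n"
    define x where "x i = (\<Sum>m<n. p m j *\<^sub>C u i m)" for i
    have Qx: "(\<Sum>k<n. Q i k *\<^sub>C x k) = 0" if "i < n" for i
      unfolding x_def by (rule key(2)) (use Q(3) ij that in \<open>simp_all add: mat_vec_def\<close>)
    \<comment> \<open>the functional \<open>a \<mapsto> f (d\<^sup>* a)\<close> turns \<open>Q x = 0\<close> into an equation between scalars, to which \<open>p\<close> applies\<close>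
    define d where "d = (\<Sum>k<n. p i k *\<^sub>C x k) - x i"
    have xS: "x k \<in> ?S" if "k < n" for k
      unfolding x_def using that
      by (intro complex_vector.span_sum complex_vector.span_scale complex_vector.span_base) auto
    have dS: "d \<in> ?S" unfolding d_def
      by (intro complex_vector.span_diff complex_vector.span_sum complex_vector.span_scale xS) (use ij in auto)
    have lin: "f (star d * (\<Sum>k<n. c k *\<^sub>C x k)) = mat_vec n (\<lambda>_. c) (\<lambda>k. f (star d * x k)) m" for c m
      by (simp add: mat_vec_def sum_distrib_left mult_scaleC_right state_sum[OF f] state_scaleC[OF f])
    have "mat_vec n Q (\<lambda>k. f (star d * x k)) m = 0" if "m < n" for m
      using lin[of "Q m"] Qx[OF that] by (simp add: mat_vec_def state_zero[OF f])
    then have "mat_vec n p (\<lambda>k. f (star d * x k)) i = f (star d * x i)" using ij by (intro Q(4))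
    then have "f (star d * d) = 0"
      unfolding d_def right_diff_distrib using lin[of "p i"]
      by (simp add: state_diff[OF f] mat_vec_def flip: d_def)
    then have "d = 0" using dS by (intro faithful)
    then have "(\<Sum>k<n. p i k *\<^sub>C x k) = x i" by (simp add: d_def)
    then show "(\<Sum>k<n. \<Sum>l<n. (p i k * p l j) *\<^sub>C u k l) = (\<Sum>l<n. p l j *\<^sub>C u i l)"
      by (simp add: x_def complex_vector.scale_sum_right scaleC_scaleC)
  qed
  then have p1: "p i j = (if i = j then 1 else 0)" if "i < n" "j < n" for i j
    using irr p(2) that unfolding irreducible_unitary_rep_def by blast
  have Q0: "Q i j = 0" if "i < n" "j < n" for i j
  proof -
    have "(\<Sum>k<n. Q i k * p k j) = (\<Sum>k<n. if k = j then Q i k else 0)"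
      by (intro sum.cong refl) (use p1 that in auto)
    then show ?thesis using Q(3)[OF that] that by simp
  qed
  have Zl: "Z i j = (if i = j then complex_of_real l else 0)" if "i < n" "j < n" for i j
    using Q0[OF that] by (simp add: Q_def Z_def)
  have vY: "(\<Sum>k<n. Y k j *\<^sub>C v i k) = (\<Sum>k<n. Y i k *\<^sub>C u k j)" if "i < n" "j < n" for i j
  proof -
    let ?e = "\<lambda>m. if m = j then 1 else 0 :: complex"
    have "(\<Sum>k<n. mat_vec n Y ?e k *\<^sub>C v i k) = (\<Sum>k<n. Y i k *\<^sub>C (\<Sum>m<n. ?e m *\<^sub>C u k m))"
      by (rule key(1)) (use Q0 that in \<open>simp_all add: mat_vec_def\<close>)
    moreover have "mat_vec n Y ?e k = Y k j" for k
      using that by (simp add: mat_vec_def if_distrib cong: if_cong)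
    moreover have "(\<Sum>m<n. ?e m *\<^sub>C u k m) = u k j" for k
      using that by (simp add: if_distrib[of "\<lambda>c. c *\<^sub>C _"] cong: if_cong)
    ultimately show ?thesis by simp
  qed
  define W where "W i j = (\<Sum>k<n. Y i k * cnj (Y j k))" for i j
  have Wl: "W i j = (if i = j then complex_of_real l else 0)" if "i < n" "j < n" for i j
  proof -
    \<comment> \<open>\<open>W / l\<close> is a projection of trace \<open>n\<close>, so the Hilbert-Schmidt norm of \<open>D = l - W\<close> vanishes\<close>
    define D where "D i j = (if i = j then complex_of_real l else 0) - W i j" for i j
    have trW: "(\<Sum>i<n. W i i) = of_nat n * complex_of_real l"
    proof -
      have "(\<Sum>i<n. W i i) = (\<Sum>k<n. Z k k)"
        unfolding W_def Z_def by (subst sum.swap) (simp add: mult.commute)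
      then show ?thesis by (simp add: Zl)
    qed
    have WW: "(\<Sum>j<n. W i j * W j i) = complex_of_real l * W i i" if "i < n" for i
    proof -
      have "(\<Sum>j<n. W i j * W j i) = (\<Sum>j<n. \<Sum>k<n. \<Sum>m<n. Y i k * cnj (Y i m) * (cnj (Y j k) * Y j m))"
        unfolding W_def sum_product by (simp add: mult_ac)
      also have "\<dots> = (\<Sum>k<n. \<Sum>m<n. \<Sum>j<n. Y i k * cnj (Y i m) * (cnj (Y j k) * Y j m))"
        by (subst sum.swap, rule sum.cong[OF refl], rule sum.swap)
      also have "\<dots> = (\<Sum>k<n. \<Sum>m<n. Y i k * cnj (Y i m) * Z k m)"
        by (simp add: Z_def sum_distrib_left)
      also have "\<dots> = (\<Sum>k<n. \<Sum>m<n. if k = m then Y i k * cnj (Y i m) * complex_of_real l else 0)"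
        by (intro sum.cong refl) (simp add: Zl)
      also have "\<dots> = complex_of_real l * W i i"
        by (simp add: W_def sum_distrib_left mult_ac)
      finally show ?thesis .
    qed
    have Dh: "D j i = cnj (D i j)" for i j by (simp add: D_def W_def mult.commute)
    have "complex_of_real (\<Sum>i<n. \<Sum>j<n. (cmod (D i j))\<^sup>2) = (\<Sum>i<n. \<Sum>j<n. D i j * D j i)"
      unfolding of_real_sum complex_norm_square Dh[symmetric] ..
    also have "\<dots> = (\<Sum>i<n. complex_of_real l * complex_of_real l - 2 * complex_of_real l * W i i + (\<Sum>j<n. W i j * W j i))"
    proof (intro sum.cong refl)
      fix i assume i: "i \<in> {..<n}"
      have "(\<Sum>j<n. D i j * D j i) = (\<Sum>j<n. (if i = j then complex_of_real l * complex_of_real l - 2 * complex_of_real l * W i i else 0) + W i j * W j i)"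
        by (intro sum.cong refl) (auto simp: D_def algebra_simps)
      then show "(\<Sum>j<n. D i j * D j i) = complex_of_real l * complex_of_real l - 2 * complex_of_real l * W i i + (\<Sum>j<n. W i j * W j i)"
        using i by (simp add: sum.distrib)
    qed
    also have "\<dots> = of_nat n * (complex_of_real l * complex_of_real l) - complex_of_real l * (\<Sum>i<n. W i i)"
      by (simp add: WW sum.distrib sum_subtractf sum_distrib_left algebra_simps)
    also have "\<dots> = 0" by (simp add: trW)
    finally have "(\<Sum>i<n. \<Sum>j<n. (cmod (D i j))\<^sup>2) = 0" by (simp only: of_real_eq_0_iff)
    then have "D i j = 0" using that by (simp add: sum_nonneg_eq_0_iff sum_nonneg)
    then show ?thesis by (simp add: D_def)
  qed
  have "complex_of_real l *\<^sub>C rep_character n v = (\<Sum>i<n. \<Sum>k<n. W k i *\<^sub>C v i k)"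
  proof -
    have "(\<Sum>k<n. W k i *\<^sub>C v i k) = complex_of_real l *\<^sub>C v i i" if "i < n" for i
    proof -
      have "(\<Sum>k<n. W k i *\<^sub>C v i k) = (\<Sum>k<n. if k = i then complex_of_real l *\<^sub>C v i k else 0)"
        by (intro sum.cong refl) (use Wl that in auto)
      then show ?thesis using that by simp
    qed
    then show ?thesis by (simp add: rep_character_def complex_vector.scale_sum_right)
  qed
  also have "\<dots> = (\<Sum>i<n. \<Sum>j<n. cnj (Y i j) *\<^sub>C (\<Sum>k<n. Y k j *\<^sub>C v i k))"
    unfolding W_def complex_vector.scale_sum_left complex_vector.scale_sum_right
    by (rule sum.cong[OF refl], subst sum.swap) (simp add: scaleC_scaleC mult.commute)
  also have "\<dots> = (\<Sum>i<n. \<Sum>j<n. cnj (Y i j) *\<^sub>C (\<Sum>k<n. Y i k *\<^sub>C u k j))"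
    by (intro sum.cong refl) (simp add: vY)
  also have "\<dots> = (\<Sum>j<n. \<Sum>k<n. Z j k *\<^sub>C u k j)"
    unfolding Z_def complex_vector.scale_sum_left complex_vector.scale_sum_right
    by (subst sum.swap, rule sum.cong[OF refl], subst sum.swap) (simp add: scaleC_scaleC)
  also have "\<dots> = complex_of_real l *\<^sub>C rep_character n u"
  proof -
    have "(\<Sum>k<n. Z j k *\<^sub>C u k j) = complex_of_real l *\<^sub>C u j j" if "j < n" for j
    proof -
      have "(\<Sum>k<n. Z j k *\<^sub>C u k j) = (\<Sum>k<n. if k = j then complex_of_real l *\<^sub>C u k j else 0)"
        by (intro sum.cong refl) (use Zl that in auto)
      then show ?thesis using that by simp
    qed
    then show ?thesis by (simp add: rep_character_def complex_vector.scale_sum_right)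
  qed
  finally show ?thesis using l by simp
qed

text \<open>The distance \<open>1 / (2 n)\<close> keeps the entry \<open>Y\<^sub>0\<^sub>0\<close> of the averaged matrix within \<open>1 / 2\<close> of 1, and away from 0.\<close>

lemma rep_character_eq_of_close:
  fixes tens :: "'c::unital_cstar_algebra \<Rightarrow> 'c \<Rightarrow> 'd::unital_cstar_algebra"
  assumes tens: "spatial_tensor_product tens" and hom: "unital_star_hom \<Delta>"
    and irr: "irreducible_unitary_rep tens \<Delta> n u" and v: "unitary_rep tens \<Delta> n v"
    and close: "\<And>i j. i < n \<Longrightarrow> j < n \<Longrightarrow> norm (v i j - u i j) < 1 / (2 * real n)"
  shows "rep_character n v = rep_character n u"
proof -
  let ?E = "{w i j | w i j. w \<in> {u, v} \<and> i < n \<and> j < n}"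
  have u: "unitary_rep tens \<Delta> n u" and n: "n > 0" using irr by (simp_all add: irreducible_unitary_rep_def)
  have "?E = (\<lambda>(w, i, j). w i j) ` ({u, v} \<times> {..<n} \<times> {..<n})" by force
  then have "finite ?E" by simp
  then obtain f where f: "state f"
    "\<And>x. x \<in> complex_vector.span ?E \<Longrightarrow> f (star x * x) = 0 \<Longrightarrow> x = 0"
    using faithful_state_on_finite_span by blast
  obtain Y where Y:
    "\<And>i j. i < n \<Longrightarrow> j < n \<Longrightarrow> (\<Sum>k<n. \<Sum>l<n. Y k l * f (star (v k i) * u l j)) = Y i j"
    "\<And>i j. i < n \<Longrightarrow> j < n \<Longrightarrow> cmod (Y i j - (if i = j then 1 else 0)) \<le> real n * (1 / (2 * real n))"
  proof (rule averaged_matrix[OF tens hom u v f(1), of "1 / (2 * real n)"])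
    show "norm (u i j - v i j) \<le> 1 / (2 * real n)" if "i < n" "j < n" for i j
      using close[OF that] by (simp add: norm_minus_commute)
  qed blast
  have "cmod (Y 0 0 - 1) \<le> 1 / 2" using Y(2)[OF n n] n by simp
  then have "Y 0 0 \<noteq> 0" by auto
  then show ?thesis
    using rep_character_eq_of_fixed_matrix[OF irr v f Y(1) n n] by blast
qed

section \<open>The automorphism group\<close>

lemma AutD:
  assumes "\<alpha> \<in> Aut tens \<Delta>"
  defines "A \<equiv> CQG_algebra tens \<Delta>"
  shows "\<alpha> \<in> extensional A" "bij_betw \<alpha> A A" "\<alpha> 1 = 1"
    "a \<in> A \<Longrightarrow> b \<in> A \<Longrightarrow> \<alpha> (a + b) = \<alpha> a + \<alpha> b" "a \<in> A \<Longrightarrow> \<alpha> (c *\<^sub>C a) = c *\<^sub>C \<alpha> a"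
    "a \<in> A \<Longrightarrow> b \<in> A \<Longrightarrow> \<alpha> (a * b) = \<alpha> a * \<alpha> b" "a \<in> A \<Longrightarrow> \<alpha> (star a) = star (\<alpha> a)"
    "a \<in> A \<Longrightarrow> set xs \<subseteq> A \<times> A \<Longrightarrow> \<Delta> a = (\<Sum>(b, c)\<leftarrow>xs. tens b c) \<Longrightarrow>
      \<Delta> (\<alpha> a) = (\<Sum>(b, c)\<leftarrow>xs. tens (\<alpha> b) (\<alpha> c))"
    "a \<in> A \<Longrightarrow> \<alpha> a \<in> A"
  using assms unfolding Aut_def Let_def bij_betw_def by blast+

lemma CQG_algebra_subspace: "complex_vector.subspace (CQG_algebra tens \<Delta>)"
  unfolding CQG_algebra_def by (rule complex_vector.subspace_span)

lemma CQG_algebra_coefficient: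
  "irreducible_unitary_rep tens \<Delta> n u \<Longrightarrow> i < n \<Longrightarrow> j < n \<Longrightarrow> u i j \<in> CQG_algebra tens \<Delta>"
  unfolding CQG_algebra_def by (rule complex_vector.span_base) blast

lemma CQG_algebra_sum:
  "(\<And>i. i \<in> I \<Longrightarrow> f i \<in> CQG_algebra tens \<Delta>) \<Longrightarrow> sum f I \<in> CQG_algebra tens \<Delta>"
  by (rule complex_vector.subspace_sum[OF CQG_algebra_subspace])

text \<open>Off \<open>A\<close> the identity map takes the constant value \<open>undefined\<close>, while \<open>(2 a) b = 2 (a b)\<close>; so if it is
  multiplicative on \<open>A\<close> and \<open>a b \<notin> A\<close> then \<open>a b = undefined = 2 (a b)\<close>, and \<open>a b = 0\<close> would lie in \<open>A\<close>. The
  same argument applies to \<open>a\<^sup>*\<close>.\<close>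

lemma CQG_algebra_closed:
  assumes id: "Aut_id tens \<Delta> \<in> Aut tens \<Delta>"
  defines "A \<equiv> CQG_algebra tens \<Delta>"
  shows "a \<in> A \<Longrightarrow> b \<in> A \<Longrightarrow> a * b \<in> A" and "a \<in> A \<Longrightarrow> star a \<in> A"
proof -
  note D = AutD[OF id, folded A_def]
  have sub: "complex_vector.subspace A" unfolding A_def by (rule CQG_algebra_subspace)
  have inA: "Aut_id tens \<Delta> x = x" if "x \<in> A" for x using that by (simp add: Aut_id_def A_def)
  have offA: "Aut_id tens \<Delta> x = undefined" if "x \<notin> A" for x using that by (simp add: Aut_id_def A_def)
  have cont: "x \<in> A" if 1: "x \<notin> A \<Longrightarrow> x = undefined" and 2: "2 *\<^sub>C x \<notin> A \<Longrightarrow> 2 *\<^sub>C x = undefined" for x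
  proof (rule ccontr)
    assume x: "x \<notin> A"
    have "(1/2) *\<^sub>C 2 *\<^sub>C x = x" by (simp add: scaleC_scaleC)
    then have "2 *\<^sub>C x \<notin> A" using complex_vector.subspace_scale[OF sub, of "2 *\<^sub>C x" "1/2"] x by auto
    then have "2 *\<^sub>C x = x" using 1[OF x] 2 by simp
    then have "(1 + 1) *\<^sub>C x = x" by simp
    then have "x = 0" unfolding scaleC_add_left by simp
    then show False using x complex_vector.subspace_0[OF sub] by simp
  qed
  show "a * b \<in> A" if ab: "a \<in> A" "b \<in> A" for a b
  proof (rule cont)
    show "a * b = undefined" if "a * b \<notin> A"
      using D(6)[OF ab] offA[OF that] inA ab by simp
    have a2: "2 *\<^sub>C a \<in> A" by (rule complex_vector.subspace_scale[OF sub ab(1)])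
    show "2 *\<^sub>C (a * b) = undefined" if "2 *\<^sub>C (a * b) \<notin> A"
      using D(6)[OF a2 ab(2)] offA[OF that] inA[OF a2] inA[OF ab(2)] by (simp add: mult_scaleC_left)
  qed
  show "star a \<in> A" if a: "a \<in> A" for a
  proof (rule cont)
    show "star a = undefined" if "star a \<notin> A"
      using D(7)[OF a] offA[OF that] inA[OF a] by simp
    have a2: "2 *\<^sub>C a \<in> A" by (rule complex_vector.subspace_scale[OF sub a])
    show "2 *\<^sub>C star a = undefined" if "2 *\<^sub>C star a \<notin> A"
      using D(7)[OF a2] offA[OF _, of "star (2 *\<^sub>C a)"] that inA[OF a2] by (simp add: star_scaleC)
  qed
qed

lemma Aut_zero:
  assumes "\<alpha> \<in> Aut tens \<Delta>"
  shows "\<alpha> 0 = 0"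
  using AutD(5)[OF assms complex_vector.subspace_0[OF CQG_algebra_subspace], of 0] by simp

lemma Aut_sum:
  assumes \<alpha>: "\<alpha> \<in> Aut tens \<Delta>" and "\<And>i. i \<in> I \<Longrightarrow> f i \<in> CQG_algebra tens \<Delta>"
  shows "\<alpha> (sum f I) = (\<Sum>i\<in>I. \<alpha> (f i))"
  using assms(2)
proof (induction I rule: infinite_finite_induct)
  case (insert i I)
  then have "\<alpha> (f i + sum f I) = \<alpha> (f i) + \<alpha> (sum f I)"
    by (intro AutD(4)[OF \<alpha>] CQG_algebra_sum) auto
  with insert show ?case by simp
qed (simp_all add: Aut_zero[OF \<alpha>])

lemma Aut_compose:
  assumes \<alpha>: "\<alpha> \<in> Aut tens \<Delta>" and \<beta>: "\<beta> \<in> Aut tens \<Delta>" and id: "Aut_id tens \<Delta> \<in> Aut tens \<Delta>"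
  shows "compose (CQG_algebra tens \<Delta>) \<alpha> \<beta> \<in> Aut tens \<Delta>"
proof -
  let ?A = "CQG_algebra tens \<Delta>" and ?c = "compose (CQG_algebra tens \<Delta>) \<alpha> \<beta>"
  note a = AutD[OF \<alpha>] and b = AutD[OF \<beta>] and cl = CQG_algebra_closed[OF id]
  have c: "?c x = \<alpha> (\<beta> x)" if "x \<in> ?A" for x using that by (simp add: compose_def)
  note sub = complex_vector.subspace_add[OF CQG_algebra_subspace]
    complex_vector.subspace_scale[OF CQG_algebra_subspace]
  have "?c 1 = 1"
  proof (cases "1 \<in> ?A")
    case False
    then have "?c 1 = \<alpha> 1" using extensional_arb[OF a(1)] by (simp add: compose_def)
    then show ?thesis by (simp add: a(3))
  qed (simp add: c a(3) b(3))
  moreover have "\<Delta> (?c x) = (\<Sum>(y, z)\<leftarrow>xs. tens (?c y) (?c z))"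
    if x: "x \<in> ?A" and xs: "set xs \<subseteq> ?A \<times> ?A" and e: "\<Delta> x = (\<Sum>(y, z)\<leftarrow>xs. tens y z)" for x xs
  proof -
    let ?ys = "map (\<lambda>(y, z). (\<beta> y, \<beta> z)) xs"
    have "\<Delta> (\<beta> x) = (\<Sum>(y, z)\<leftarrow>?ys. tens y z)"
      using b(8)[OF x xs e] by (simp add: o_def case_prod_unfold)
    moreover have "set ?ys \<subseteq> ?A \<times> ?A" using xs b(9) by auto
    ultimately have "\<Delta> (\<alpha> (\<beta> x)) = (\<Sum>(y, z)\<leftarrow>?ys. tens (\<alpha> y) (\<alpha> z))" by (intro a(8) b(9) x)
    also have "\<dots> = (\<Sum>(y, z)\<leftarrow>xs. tens (?c y) (?c z))"
      using xs unfolding map_map by (intro arg_cong[of _ _ sum_list] map_cong) (auto simp: c)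
    finally show ?thesis by (simp add: c x)
  qed
  moreover have "bij_betw ?c ?A ?A"
    using bij_betw_trans[OF b(2) a(2)] by (subst bij_betw_cong[of _ _ "\<alpha> \<circ> \<beta>"]) (simp_all add: c)
  moreover have "?c \<in> extensional ?A" by (rule compose_extensional)
  ultimately show ?thesis
    unfolding Aut_def Let_def mem_Collect_eq
    by (intro conjI ballI allI impI) (simp_all add: c sub cl a b)
qed

lemma unitary_rep_Aut:
  assumes \<alpha>: "\<alpha> \<in> Aut tens \<Delta>" and id: "Aut_id tens \<Delta> \<in> Aut tens \<Delta>"
    and irr: "irreducible_unitary_rep tens \<Delta> n u"
  shows "unitary_rep tens \<Delta> n (\<lambda>i j. \<alpha> (u i j))"
  unfolding unitary_rep_def
proof (intro allI impI conjI)
  fix i j assume ij: "i < n" "j < n"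
  have u: "unitary_rep tens \<Delta> n u" using irr by (simp add: irreducible_unitary_rep_def)
  note a = AutD[OF \<alpha>] and cl = CQG_algebra_closed[OF id]
  have inA: "u i j \<in> CQG_algebra tens \<Delta>" if "i < n" "j < n" for i j
    using CQG_algebra_coefficient[OF irr that] .
  have 1: "\<alpha> (if i = j then 1 else 0) = (if i = j then 1 else 0)" by (simp add: a(3) Aut_zero[OF \<alpha>])
  have "\<Delta> (\<alpha> (u i j)) = (\<Sum>(b, c)\<leftarrow>map (\<lambda>k. (u i k, u k j)) [0..<n]. tens (\<alpha> b) (\<alpha> c))"
    using ij unitary_repD(1)[OF u ij] inA
    by (intro a(8)) (auto simp: o_def interv_sum_list_conv_sum_set_nat atLeast0LessThan)
  then show "\<Delta> (\<alpha> (u i j)) = (\<Sum>k<n. tens (\<alpha> (u i k)) (\<alpha> (u k j)))"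
    by (simp add: o_def interv_sum_list_conv_sum_set_nat atLeast0LessThan)
  have "\<alpha> (\<Sum>k<n. u i k * star (u j k)) = (\<Sum>k<n. \<alpha> (u i k * star (u j k)))"
    by (rule Aut_sum[OF \<alpha>]) (use ij in \<open>simp add: cl inA\<close>)
  also have "\<dots> = (\<Sum>k<n. \<alpha> (u i k) * star (\<alpha> (u j k)))"
    by (intro sum.cong refl) (use ij in \<open>simp add: a(6,7) cl inA\<close>)
  finally have "(\<Sum>k<n. \<alpha> (u i k) * star (\<alpha> (u j k))) = \<alpha> (\<Sum>k<n. u i k * star (u j k))" ..
  then show "(\<Sum>k<n. \<alpha> (u i k) * star (\<alpha> (u j k))) = (if i = j then 1 else 0)"
    unfolding unitary_repD(3)[OF u ij] 1 .
  have "\<alpha> (\<Sum>k<n. star (u k i) * u k j) = (\<Sum>k<n. \<alpha> (star (u k i) * u k j))"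
    by (rule Aut_sum[OF \<alpha>]) (use ij in \<open>simp add: cl inA\<close>)
  also have "\<dots> = (\<Sum>k<n. star (\<alpha> (u k i)) * \<alpha> (u k j))"
    by (intro sum.cong refl) (use ij in \<open>simp add: a(6,7) cl inA\<close>)
  finally have "(\<Sum>k<n. star (\<alpha> (u k i)) * \<alpha> (u k j)) = \<alpha> (\<Sum>k<n. star (u k i) * u k j)" ..
  then show "(\<Sum>k<n. star (\<alpha> (u k i)) * \<alpha> (u k j)) = (if i = j then 1 else 0)"
    unfolding unitary_repD(2)[OF u ij] 1 .
qed

lemma norm_le_full_norm: "ereal (norm a) \<le> full_norm A a"
proof -
  have "cstar_seminorm_on A norm"
    by (auto simp: cstar_seminorm_on_def norm_triangle_ineq norm_scaleC norm_mult_ineq cstar_identity)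
  then show ?thesis unfolding full_norm_def by (intro Sup_upper) blast
qed

text \<open>The representation \<open>\<gamma>(u)\<close> is close to \<open>u\<close>, because the full norm dominates the given C*-norm.\<close>

lemma character_fixed_near_identity:
  fixes tens :: "'c::unital_cstar_algebra \<Rightarrow> 'c \<Rightarrow> 'd::unital_cstar_algebra"
  assumes tens: "spatial_tensor_product tens" and hom: "unital_star_hom \<Delta>"
    and id: "Aut_id tens \<Delta> \<in> Aut tens \<Delta>" and irr: "irreducible_unitary_rep tens \<Delta> n u"
    and \<gamma>: "\<gamma> \<in> Aut_nhd tens \<Delta> {u i j | i j. i < n \<and> j < n} (1 / (2 * real n))"
  shows "\<gamma> (rep_character n u) = rep_character n u"
proof -
  have g: "\<gamma> \<in> Aut tens \<Delta>" using \<gamma> by (simp add: Aut_nhd_def)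
  have "norm (\<gamma> (u i j) - u i j) < 1 / (2 * real n)" if "i < n" "j < n" for i j
  proof -
    have "full_norm (CQG_algebra tens \<Delta>) (\<gamma> (u i j) - u i j) < ereal (1 / (2 * real n))"
      using \<gamma> that unfolding Aut_nhd_def by blast
    then show ?thesis using norm_le_full_norm le_less_trans less_ereal.simps(1) by blast
  qed
  then have "rep_character n (\<lambda>i j. \<gamma> (u i j)) = rep_character n u"
    by (rule rep_character_eq_of_close[OF tens hom irr unitary_rep_Aut[OF g id irr]])
  moreover have "\<gamma> (rep_character n u) = rep_character n (\<lambda>i j. \<gamma> (u i j))"
    unfolding rep_character_def by (rule Aut_sum[OF g]) (use CQG_algebra_coefficient[OF irr] in auto)
  ultimately show ?thesis by simp
qed

lemma openin_Aut_topology: "openin (Aut_topology tens \<Delta>) U \<longleftrightarrow> Aut_open tens \<Delta> U"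
  unfolding Aut_topology_def by (simp add: topology_inverse'[OF istopology_Aut_open])

lemma topspace_Aut_topology: "topspace (Aut_topology tens \<Delta>) \<subseteq> Aut tens \<Delta>"
  unfolding topspace_def openin_Aut_topology by (auto simp: Aut_open_def)

text \<open>Composing \<open>\<alpha>\<close> with a \<open>\<gamma>\<close> near the identity does not change its value at the character. With equality to the
  character for \<open>P\<close>, and with its negation, the stabilizer of the character is seen to be open and closed.\<close>

lemma Aut_open_character_value:
  fixes tens :: "'c::unital_cstar_algebra \<Rightarrow> 'c \<Rightarrow> 'd::unital_cstar_algebra"
  assumes tens: "spatial_tensor_product tens" and hom: "unital_star_hom \<Delta>"
    and id: "Aut_id tens \<Delta> \<in> Aut tens \<Delta>" and irr: "irreducible_unitary_rep tens \<Delta> n u"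
  shows "Aut_open tens \<Delta> {\<alpha> \<in> Aut tens \<Delta>. P (\<alpha> (rep_character n u))}"
  unfolding Aut_open_def
proof (intro conjI ballI)
  let ?A = "CQG_algebra tens \<Delta>" and ?F = "{u i j | i j. i < n \<and> j < n}"
  have n: "n > 0" using irr by (simp add: irreducible_unitary_rep_def)
  have chi: "rep_character n u \<in> ?A"
    unfolding rep_character_def by (rule CQG_algebra_sum) (use CQG_algebra_coefficient[OF irr] in auto)
  fix \<alpha> assume "\<alpha> \<in> {\<alpha> \<in> Aut tens \<Delta>. P (\<alpha> (rep_character n u))}"
  then have \<alpha>: "\<alpha> \<in> Aut tens \<Delta>" "P (\<alpha> (rep_character n u))" by auto
  have "?F = (\<lambda>(i, j). u i j) ` ({..<n} \<times> {..<n})" by force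
  then have "finite ?F" by simp
  moreover have "?F \<subseteq> ?A" using CQG_algebra_coefficient[OF irr] by blast
  moreover have "compose ?A \<alpha> \<gamma> \<in> {\<alpha> \<in> Aut tens \<Delta>. P (\<alpha> (rep_character n u))}"
    if \<gamma>: "\<gamma> \<in> Aut_nhd tens \<Delta> ?F (1 / (2 * real n))" for \<gamma>
  proof -
    have "\<gamma> \<in> Aut tens \<Delta>" using \<gamma> by (simp add: Aut_nhd_def)
    then have "compose ?A \<alpha> \<gamma> \<in> Aut tens \<Delta>" by (rule Aut_compose[OF \<alpha>(1) _ id])
    moreover have "compose ?A \<alpha> \<gamma> (rep_character n u) = \<alpha> (rep_character n u)"
      using chi character_fixed_near_identity[OF tens hom id irr \<gamma>] by (simp add: compose_def)
    ultimately show ?thesis using \<alpha>(2) by simp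
  qed
  ultimately show "\<exists>F e. finite F \<and> F \<subseteq> ?A \<and> e > 0 \<and> (\<forall>\<gamma>\<in>Aut_nhd tens \<Delta> F e.
      compose ?A \<alpha> \<gamma> \<in> {\<alpha> \<in> Aut tens \<Delta>. P (\<alpha> (rep_character n u))})"
    using n by (intro exI[of _ ?F] exI[of _ "1 / (2 * real n)"]) simp
qed blast

lemma connected_Aut_subset_Aut_chi:
  fixes tens :: "'c::unital_cstar_algebra \<Rightarrow> 'c \<Rightarrow> 'd::unital_cstar_algebra"
  assumes tens: "spatial_tensor_product tens" and hom: "unital_star_hom \<Delta>"
    and T: "connectedin (Aut_topology tens \<Delta>) T" and idT: "Aut_id tens \<Delta> \<in> T"
  shows "T \<subseteq> Aut_chi tens \<Delta>"
proof
  fix \<alpha> assume \<alpha>T: "\<alpha> \<in> T"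
  have TA: "T \<subseteq> Aut tens \<Delta>"
    using connectedin_subset_topspace[OF T] topspace_Aut_topology by blast
  then have id: "Aut_id tens \<Delta> \<in> Aut tens \<Delta>" using idT by blast
  have "\<alpha> (rep_character n u) = rep_character n u" if irr: "irreducible_unitary_rep tens \<Delta> n u" for n u
  proof (rule ccontr)
    assume neq: "\<alpha> (rep_character n u) \<noteq> rep_character n u"
    let ?U = "{\<alpha> \<in> Aut tens \<Delta>. \<alpha> (rep_character n u) = rep_character n u}"
    let ?V = "{\<alpha> \<in> Aut tens \<Delta>. \<alpha> (rep_character n u) \<noteq> rep_character n u}"
    have "openin (Aut_topology tens \<Delta>) ?U" "openin (Aut_topology tens \<Delta>) ?V"
      unfolding openin_Aut_topology by (rule Aut_open_character_value[OF tens hom id irr])+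
    moreover have "T \<subseteq> ?U \<union> ?V" "?U \<inter> ?V \<inter> T = {}" using TA by auto
    moreover have "rep_character n u \<in> CQG_algebra tens \<Delta>"
      unfolding rep_character_def by (rule CQG_algebra_sum) (use CQG_algebra_coefficient[OF irr] in auto)
    then have "Aut_id tens \<Delta> \<in> ?U" using id by (simp add: Aut_id_def)
    then have "?U \<inter> T \<noteq> {}" using idT by blast
    moreover have "\<alpha> \<in> ?V" using TA \<alpha>T neq by blast
    then have "?V \<inter> T \<noteq> {}" using \<alpha>T by blast
    ultimately show False using T unfolding connectedin by blast
  qed
  then show "\<alpha> \<in> Aut_chi tens \<Delta>" using TA \<alpha>T unfolding Aut_chi_def by blast
qed

theorem theorem2p11:
  fixes tens :: "'c::unital_cstar_algebra \<Rightarrow> 'c \<Rightarrow> 'd::unital_cstar_algebra"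
    and tensL :: "'d \<Rightarrow> 'c \<Rightarrow> 'e::unital_cstar_algebra"
    and tensR :: "'c \<Rightarrow> 'd \<Rightarrow> 'e"
    and \<Delta> :: "'c \<Rightarrow> 'd"
  assumes "compact_quantum_group tens tensL tensR \<Delta>"
  shows "Aut_0 tens \<Delta> = Aut_chi_0 tens \<Delta>"
proof -
  have "spatial_tensor_product tens" "unital_star_hom \<Delta>"
    using compact_quantum_group.tens[OF assms] compact_quantum_group.comult_hom[OF assms] .
  note sub = connected_Aut_subset_Aut_chi[OF this]
  show ?thesis
    unfolding Aut_0_def Aut_chi_0_def connected_component_of_def connectedin_subtopology
    using sub by blast
qed

end
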